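(* Let $\mathcal{A}$ be an $O(1)$-approximation algorithm for $k$-means (without outliers) with running time $T(n)$ on inputs of size $n$. There exists an algorithm that, given a set $X\subset\mathbb{R}^d$ of $n$ points and $k,z\in\mathbb{N}$, outputs with constant probability a set $C$ of $k$ centers such that $f^X_{O(kz)}(C)\le O(1)\cdot Opt(X,k,z)$ (i.e. an $O(1)$-approximate solution to $k$-means with outliers discarding $O(kz)$ outliers), in expected time $O(kdn\log^2 n)+T(k\log n)$.
   Context: Distances are Euclidean; $d(x,C)=\min_{c\in C}d(x,c)$. For $k$ centers $C$ and $t\ge0$, $X_t(C)$ is the set of $n-t$ points of $X$ with smallest $d(x,C)$ and $f^X_t(C)=\sum_{x\in X_t(C)}d^2(x,C)$; $f^X=f^X_0$. $Opt(X,k,z)=\min_C f^X_z(C)$ over sets $C$ of $k$ points of $\mathbb{R}^d$ and $Opt(X,k)=Opt(X,k,0)$. $\mathcal{A}$ is an $\alpha$-approximation for $k$-means if on every (possibly weighted) finite input $(P,k)$ it outputs $k$ centers $C$ with $f^P(C)\le\alpha\,Opt(P,k)$. *)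

theory Defs
  imports "HOL-Probability.Probability"
begin

section \<open>k-means with outliers\<close>

text \<open>The dimension is an input of the algorithms, so a point of \<open>\<real>\<^sup>d\<close> is a list of length \<open>d\<close>.\<close>

type_synonym point = "real list"

definition points :: "nat \<Rightarrow> point set" where
  "points d = {x. length x = d}"

definition pdist :: "point \<Rightarrow> point \<Rightarrow> real" where
  "pdist x y = L2_set (\<lambda>i. x ! i - y ! i) {..<length x}"

definition sdist :: "point \<Rightarrow> point set \<Rightarrow> real" where
  "sdist x C = Min (pdist x ` C)"

definition center_sets :: "nat \<Rightarrow> nat \<Rightarrow> point set set" where
  "center_sets d k = {C. C \<subseteq> points d \<and> finite C \<and> card C = k}"

text \<open>Ties between equidistant points are broken arbitrarily; this does not affect \<open>kcost\<close>.
  For \<open>t \<ge> card X\<close> the set is empty.\<close>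

definition nearest :: "point set \<Rightarrow> nat \<Rightarrow> point set \<Rightarrow> point set" where
  "nearest X t C = (SOME Y. Y \<subseteq> X \<and> card Y = card X - t \<and>
                       (\<forall>y\<in>Y. \<forall>x\<in>X - Y. sdist y C \<le> sdist x C))"

definition kcost :: "point set \<Rightarrow> nat \<Rightarrow> point set \<Rightarrow> real" where
  "kcost X t C = (\<Sum>x\<in>nearest X t C. (sdist x C)\<^sup>2)"

definition Opt :: "nat \<Rightarrow> point set \<Rightarrow> nat \<Rightarrow> nat \<Rightarrow> real" where
  "Opt d X k z = (INF C\<in>center_sets d k. kcost X z C)"

definition wcost :: "(point \<Rightarrow> real) \<Rightarrow> point set \<Rightarrow> point set \<Rightarrow> real" where
  "wcost w P C = (\<Sum>x\<in>P. w x * (sdist x C)\<^sup>2)"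

definition wOpt :: "nat \<Rightarrow> (point \<Rightarrow> real) \<Rightarrow> point set \<Rightarrow> nat \<Rightarrow> real" where
  "wOpt d w P k = (INF C\<in>center_sets d k. wcost w P C)"

section \<open>Randomized real RAM programs\<close>

text \<open>
  Algorithms are programs of a randomized real RAM in which every primitive operation, every
  branch and every coin toss takes one time step. The memory consists of registers and arrays
  holding natural numbers (for counters and addresses) and real numbers (for data). A program
  names registers and arrays statically; array cells are addressed through registers.
  Natural numbers can only be added, subtracted (truncated at 0), compared and converted to reals;
  reals can be added, subtracted, multiplied, divided and compared. There is no rounding operation,
  and there are no real constants other than those obtained from natural numbers, so that no
  information can be hidden in the digits of a constant.
\<close>

record state =
  nreg :: "nat \<Rightarrow> nat"
  rreg :: "nat \<Rightarrow> real"
  narr :: "nat \<Rightarrow> nat \<Rightarrow> nat"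
  rarr :: "nat \<Rightarrow> nat \<Rightarrow> real"

datatype nat_op = NAdd | NSub

datatype real_op = RAdd | RSub | RMul | RDiv

text \<open>The arguments of tests and commands are names of registers and arrays, except for the
  literal in \<open>NConst\<close>.\<close>

datatype test = NLess nat nat | RLess nat nat

datatype com =
    Skip
  | NConst nat nat
  | NOp nat_op nat nat nat
  | NLoad nat nat nat
  | NStore nat nat nat
  | ROfNat nat nat
  | ROp real_op nat nat nat
  | RLoad nat nat nat
  | RStore nat nat nat
  | Toss nat nat
  | Seq com com
  | Branch test com com
  | While test com

primrec nat_op_val :: "nat_op \<Rightarrow> nat \<Rightarrow> nat \<Rightarrow> nat" where
  "nat_op_val NAdd m n = m + n"
| "nat_op_val NSub m n = m - n"

primrec real_op_val :: "real_op \<Rightarrow> real \<Rightarrow> real \<Rightarrow> real" where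
  "real_op_val RAdd x y = x + y"
| "real_op_val RSub x y = x - y"
| "real_op_val RMul x y = x * y"
| "real_op_val RDiv x y = x / y"

primrec test_val :: "test \<Rightarrow> state \<Rightarrow> bool" where
  "test_val (NLess i j) s \<longleftrightarrow> nreg s i < nreg s j"
| "test_val (RLess i j) s \<longleftrightarrow> rreg s i < rreg s j"

definition set_nreg :: "nat \<Rightarrow> nat \<Rightarrow> state \<Rightarrow> state" where
  "set_nreg r v s = s\<lparr>nreg := (nreg s)(r := v)\<rparr>"

definition set_rreg :: "nat \<Rightarrow> real \<Rightarrow> state \<Rightarrow> state" where
  "set_rreg r v s = s\<lparr>rreg := (rreg s)(r := v)\<rparr>"

definition set_narr :: "nat \<Rightarrow> nat \<Rightarrow> nat \<Rightarrow> state \<Rightarrow> state" where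
  "set_narr a i v s = s\<lparr>narr := (narr s)(a := (narr s a)(i := v))\<rparr>"

definition set_rarr :: "nat \<Rightarrow> nat \<Rightarrow> real \<Rightarrow> state \<Rightarrow> state" where
  "set_rarr a i v s = s\<lparr>rarr := (rarr s)(a := (rarr s a)(i := v))\<rparr>"

text \<open>\<open>Toss r p\<close> sets the natural register \<open>r\<close> to 1 with the probability held in the real register
  \<open>p\<close> (clipped to the unit interval by \<^const>\<open>bernoulli_pmf\<close>), and to 0 otherwise: it is the test
  \<open>U < p\<close> for a fresh uniform \<open>U\<close> in the unit interval.\<close>

primrec step :: "com \<Rightarrow> state \<Rightarrow> (com \<times> state) pmf" where
  "step Skip s = return_pmf (Skip, s)"
| "step (NConst r n) s = return_pmf (Skip, set_nreg r n s)"
| "step (NOp f r i j) s = return_pmf (Skip, set_nreg r (nat_op_val f (nreg s i) (nreg s j)) s)"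
| "step (NLoad r a i) s = return_pmf (Skip, set_nreg r (narr s a (nreg s i)) s)"
| "step (NStore a i r) s = return_pmf (Skip, set_narr a (nreg s i) (nreg s r) s)"
| "step (ROfNat r i) s = return_pmf (Skip, set_rreg r (real (nreg s i)) s)"
| "step (ROp f r i j) s = return_pmf (Skip, set_rreg r (real_op_val f (rreg s i) (rreg s j)) s)"
| "step (RLoad r a i) s = return_pmf (Skip, set_rreg r (rarr s a (nreg s i)) s)"
| "step (RStore a i r) s = return_pmf (Skip, set_rarr a (nreg s i) (rreg s r) s)"
| "step (Toss r p) s =
     map_pmf (\<lambda>b. (Skip, set_nreg r (if b then 1 else 0) s)) (bernoulli_pmf (rreg s p))"
| "step (Seq c1 c2) s =
     (if c1 = Skip then return_pmf (c2, s)
      else map_pmf (\<lambda>(c, s'). (Seq c c2, s')) (step c1 s))"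
| "step (Branch b c1 c2) s = return_pmf (if test_val b s then c1 else c2, s)"
| "step (While b c) s = return_pmf (if test_val b s then Seq c (While b c) else Skip, s)"

primrec run :: "nat \<Rightarrow> com \<Rightarrow> state \<Rightarrow> (com \<times> state) pmf" where
  "run 0 c s = return_pmf (c, s)"
| "run (Suc t) c s = bind_pmf (run t c s) (\<lambda>(c', s'). step c' s')"

text \<open>A halted configuration, i.e. one of the form \<open>(Skip, s)\<close>, stays unchanged forever. Hence the
  probabilities below increase with \<open>t\<close>, and their supremum is the probability that the program
  ever halts in a state satisfying \<open>Q\<close>.\<close>

definition result_prob :: "com \<Rightarrow> state \<Rightarrow> (state \<Rightarrow> bool) \<Rightarrow> real" where
  "result_prob c s Q = (SUP t. measure_pmf.prob (run t c s) {(c', s'). c' = Skip \<and> Q s'})"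

text \<open>Step number \<open>t\<close> is charged 1 iff the program is still running by then; the expected number of
  steps is the sum over \<open>t\<close> of the expected charges.\<close>

definition expected_time :: "com \<Rightarrow> state \<Rightarrow> ennreal" where
  "expected_time c s = (\<Sum>t. emeasure (measure_pmf (run t c s)) {(c', s'). c' \<noteq> Skip})"

section \<open>Clustering algorithms\<close>

text \<open>Inputs: the parameters \<open>d\<close>, \<open>n\<close>, \<open>k\<close>, \<open>z\<close> are in the natural registers 0 to 3, the points in
  row-major order in the real array 0, their weights in the real array 1; all other cells are 0.
  Outputs: \<open>k\<close> points in row-major order in the real array 2.\<close>

definition input_state ::
    "nat \<Rightarrow> nat \<Rightarrow> nat \<Rightarrow> point list \<Rightarrow> (point \<Rightarrow> real) \<Rightarrow> state" where
  "input_state d k z xs w =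
     \<lparr>nreg = (\<lambda>_. 0)(0 := d, 1 := length xs, 2 := k, 3 := z),
      rreg = (\<lambda>_. 0),
      narr = (\<lambda>_ _. 0),
      rarr = (\<lambda>_ _. 0)
        (0 := (\<lambda>i. if i < length xs * d then xs ! (i div d) ! (i mod d) else 0),
         1 := (\<lambda>i. if i < length xs then w (xs ! i) else 0))\<rparr>"

definition output_centers :: "nat \<Rightarrow> nat \<Rightarrow> state \<Rightarrow> point set" where
  "output_centers d k s = (\<lambda>j. map (\<lambda>l. rarr s 2 (j * d + l)) [0..<d]) ` {..<k}"

text \<open>Every run of \<open>A\<close> on a weighted set of \<open>m\<close> points halts within \<open>T d k m\<close> steps, with \<open>k\<close> centers
  whose cost is at most \<open>\<alpha>\<close> times the optimum. Any real RAM program needs at least \<open>k * d\<close> steps to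
  write its output, so the time bound has to be allowed to depend on \<open>d\<close> and \<open>k\<close> as well.\<close>

definition kmeans_approx_alg ::
    "real \<Rightarrow> (nat \<Rightarrow> nat \<Rightarrow> nat \<Rightarrow> real) \<Rightarrow> com \<Rightarrow> bool" where
  "kmeans_approx_alg \<alpha> T A \<longleftrightarrow>
     (\<forall>d k ps w. d \<ge> 1 \<longrightarrow> k \<ge> 1 \<longrightarrow> distinct ps \<longrightarrow> set ps \<subseteq> points d \<longrightarrow> (\<forall>x\<in>set ps. w x \<ge> 0) \<longrightarrow>
        (\<exists>t. real t \<le> T d k (length ps) \<and>
             (\<forall>(c, s)\<in>set_pmf (run t A (input_state d k 0 ps w)).
                c = Skip \<and>
                output_centers d k s \<in> center_sets d k \<and>
                wcost w (set ps) (output_centers d k s) \<le> \<alpha> * wOpt d w (set ps) k)))"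

end

theory Submission
  imports Defs
begin

text \<open>
  The algorithm chooses \<open>O(k)\<close> seeds one by one. Each point enters a random sample with probability
  \<open>1 / (8 z + 1)\<close>; with constant probability the largest squared distance \<open>\<tau>\<close> from a
  sampled point to the current seeds lies between the \<open>(12 z + 1)\<close>-th and the \<open>(4 z + 1)\<close>-th
  largest one. The next seed is then drawn with probability proportional to the squared distance truncated at
  \<open>\<tau>\<close>. The outliers carry at most a quarter of the truncated mass because \<open>4 z\<close> points reach the
  level \<open>\<tau>\<close>, and clusters that are already cheap carry at most another quarter, unless
  the seeds are good up to \<open>12 z\<close> outliers. So a constant fraction of the mass lies
  on points near the centers of expensive clusters, and each round makes some expensive cluster cheap with constant
  probability. If \<open>n\<close> is large, \<open>544 k\<close> rounds suffice with probability 1/2; if \<open>n\<close> is bounded, then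
  \<open>k\<close> rounds all succeed with a probability that is bounded from below. No estimate of the optimum is
  needed.

  Each seed is weighted by the number of points nearest to it, and seeds with at most \<open>32 z\<close> points get
  weight 0, which gives up \<open>O(k z)\<close> points. In the clusters of the other seeds the outliers are a minority, so the
  weighted instance has optimum \<open>O(Opt)\<close>. As \<open>T\<close> need not be monotone, the
  instance is padded by points of weight 0 to exactly \<open>\<lceil>k log n\<rceil>\<close> points before \<open>A\<close>, renamed to fresh
  registers and arrays, is run on it.
\<close>

section \<open>Programs with bounded running time\<close>

text \<open>Two seeding regimes are forced by the size of the instance for \<open>A\<close>: it has
  about \<open>k log n\<close> points, and all seeds must be among them. If \<open>544 k\<close>
  seeds do not fit, then \<open>n < 2 ^ 544\<close>; there are at most \<open>n\<close> clusters,
  and a run in which every round makes progress has probability at least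
  \<open>(3 / 272) ^ 2 ^ 544\<close>. The constants form one chain. With threshold 34, the points
  within twice the root mean square distance of an expensive cluster carry 3/34 of its mass.
  Coverage is measured against 136 = 4 * 34, so that cheap clusters hold less than a quarter of the
  truncated mass. Outliers take another quarter; the remaining half gives 3/68, and the factor 1/4
  for a suitable level gives 3/272. The potential argument halves this rate to 3/544. The comparison
  is with centers chosen among the input points, at the price of a factor 4. Everything then happens
  in a finite metric on indices, and no optimal center set has to exist. Randomness is analysed on
  lists of indices only; couplings tie these lists to the memory of the program.\<close>

lemma run_add: "run (t + u) c s = bind_pmf (run t c s) (\<lambda>(c', s'). run u c' s')"
proof (induction u)
  case 0
  show ?case by (simp add: case_prod_unfold bind_return_pmf')
next
  case (Suc u)
  then show ?case by (simp add: bind_assoc_pmf case_prod_unfold)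
qed

lemma run_1: "run (Suc 0) c s = step c s"
  by (simp add: bind_return_pmf)

lemma run_Suc_first: "run (Suc t) c s = bind_pmf (step c s) (\<lambda>(c', s'). run t c' s')"
  using run_add[of "Suc 0" t c s] unfolding run_1 by simp

lemma run_Skip [simp]: "run t Skip s = return_pmf (Skip, s)"
  by (induction t) (simp_all add: bind_return_pmf)

section \<open>Halting, sequencing and couplings with abstract distributions\<close>

definition halts :: "com \<Rightarrow> state \<Rightarrow> nat \<Rightarrow> bool" where
  "halts c s t \<longleftrightarrow> (\<forall>(c', s') \<in> set_pmf (run t c s). c' = Skip)"

lemma halts_0 [simp]: "halts c s 0 \<longleftrightarrow> c = Skip"
  by (simp add: halts_def)

lemma halts_Skip [simp]: "halts Skip s t"
  by (simp add: halts_def)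

lemma halts_Suc: "halts c s (Suc t) \<longleftrightarrow> (\<forall>(c', s') \<in> set_pmf (step c s). halts c' s' t)"
  unfolding halts_def run_Suc_first by (auto simp: set_bind_pmf)

lemma run_after_halt:
  assumes "halts c s t"
  shows "run (t + u) c s = run t c s"
proof -
  have "run (t + u) c s = bind_pmf (run t c s) return_pmf"
    unfolding run_add using assms by (intro bind_pmf_cong) (auto simp: halts_def)
  then show ?thesis by (simp add: bind_return_pmf')
qed

lemma run_after_halt_le:
  assumes "halts c s t" "t \<le> u"
  shows "run u c s = run t c s"
  using run_after_halt[OF assms(1), of "u - t"] assms(2) by simp

text \<open>Branches of \<open>c1\<close> may halt at different times. Those that finish early start
  \<open>c2\<close> early and then idle, which is harmless because \<open>Skip\<close> is
  stationary. The extra 1 is the step that discards the \<open>Skip\<close> in front of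
  \<open>c2\<close>.\<close>

lemma run_Seq:
  assumes "halts c1 s t1" "\<And>c' s'. (c', s') \<in> set_pmf (run t1 c1 s) \<Longrightarrow> halts c2 s' t2"
  shows "run (t1 + t2 + 1) (Seq c1 c2) s = bind_pmf (run t1 c1 s) (\<lambda>(c', s'). run t2 c2 s')"
  using assms
proof (induction t1 arbitrary: c1 s)
  case 0
  then have "c1 = Skip" by simp
  then show ?case by (simp add: run_Suc_first bind_return_pmf del: run.simps(2))
next
  case (Suc t1)
  show ?case
  proof (cases "c1 = Skip")
    case True
    have "halts c2 s t2" using Suc.prems(2)[of Skip s] True by (simp del: run.simps(2))
    then have "run (t2 + Suc t1) c2 s = run t2 c2 s" by (rule run_after_halt)
    then have "run (Suc (t1 + t2)) c2 s = run t2 c2 s" by (simp only: add.commute add_Suc_right)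
    then show ?thesis using True
      by (simp add: run_Suc_first[of "Suc (t1 + t2)"] bind_return_pmf del: run.simps(2))
  next
    case False
    have "run (Suc t1 + t2 + 1) (Seq c1 c2) s
        = bind_pmf (step c1 s) (\<lambda>(c, s'). run (t1 + t2 + 1) (Seq c c2) s')"
      using False run_Suc_first[of "t1 + t2 + 1" "Seq c1 c2" s]
      by (simp add: bind_map_pmf case_prod_unfold del: run.simps(2))
    also have "\<dots> = bind_pmf (step c1 s)
        (\<lambda>(c, s'). bind_pmf (run t1 c s') (\<lambda>(c', s''). run t2 c2 s''))"
    proof (intro bind_pmf_cong refl, clarify)
      fix c s' assume *: "(c, s') \<in> set_pmf (step c1 s)"
      show "run (t1 + t2 + 1) (Seq c c2) s' = bind_pmf (run t1 c s') (\<lambda>(c', s''). run t2 c2 s'')"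
      proof (rule Suc.IH)
        show "halts c s' t1" using Suc.prems(1) * by (auto simp: halts_Suc)
        fix c' s'' assume "(c', s'') \<in> set_pmf (run t1 c s')"
        then have "(c', s'') \<in> set_pmf (run (Suc t1) c1 s)"
          using * by (force simp: run_Suc_first set_bind_pmf simp del: run.simps(2))
        then show "halts c2 s'' t2" by (rule Suc.prems(2))
      qed
    qed
    also have "\<dots> = bind_pmf (run (Suc t1) c1 s) (\<lambda>(c', s'). run t2 c2 s')"
      by (simp add: run_Suc_first bind_assoc_pmf case_prod_unfold del: run.simps(2))
    finally show ?thesis .
  qed
qed

text \<open>A worst-case time bound together with a coupling: each outcome of the abstract
  distribution \<open>\<mu>\<close> is paired with final states that represent it. Probabilities can
  then be computed for \<open>\<mu>\<close> alone.\<close>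

definition exec :: "com \<Rightarrow> state \<Rightarrow> nat \<Rightarrow> 'a pmf \<Rightarrow> ('a \<Rightarrow> state \<Rightarrow> bool) \<Rightarrow> bool" where
  "exec c s t \<mu> R \<longleftrightarrow> halts c s t \<and> rel_pmf R \<mu> (map_pmf snd (run t c s))"

lemma exec_halts: "exec c s t \<mu> R \<Longrightarrow> halts c s t"
  by (simp add: exec_def)

lemma exec_mono:
  assumes "exec c s t \<mu> R" "t \<le> t'"
  shows "exec c s t' \<mu> R"
  using assms run_after_halt_le[of c s t t'] by (auto simp: exec_def halts_def)

lemma exec_conseq_reach:
  assumes "exec c s t \<mu> R"
    and "\<And>a c' s'. a \<in> set_pmf \<mu> \<Longrightarrow> (c', s') \<in> set_pmf (run t c s) \<Longrightarrow> R a s' \<Longrightarrow> R' a s'"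
  shows "exec c s t \<mu> R'"
  using assms unfolding exec_def by (auto elim!: pmf.rel_mono_strong)

lemma exec_conseq:
  assumes "exec c s t \<mu> R" "\<And>a s'. a \<in> set_pmf \<mu> \<Longrightarrow> R a s' \<Longrightarrow> R' a s'"
  shows "exec c s t \<mu> R'"
  using assms by (rule exec_conseq_reach) 

lemma exec_Seq:
  assumes 1: "exec c1 s t1 \<mu> S"
    and 2: "\<And>a s'. a \<in> set_pmf \<mu> \<Longrightarrow> S a s' \<Longrightarrow> exec c2 s' t2 (\<nu> a) R"
  shows "exec (Seq c1 c2) s (t1 + t2 + 1) (bind_pmf \<mu> \<nu>) R"
proof -
  have h1: "halts c1 s t1" and r1: "rel_pmf S \<mu> (map_pmf snd (run t1 c1 s))"
    using 1 by (auto simp: exec_def)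
  have h2: "halts c2 s' t2" if "(c', s') \<in> set_pmf (run t1 c1 s)" for c' s'
  proof -
    have "s' \<in> set_pmf (map_pmf snd (run t1 c1 s))" using that by force
    then obtain a where "a \<in> set_pmf \<mu>" "S a s'"
      using r1 by (meson rel_pmf_imp_rel_set rel_setD2)
    then show ?thesis using 2 exec_halts by blast
  qed
  have eq: "run (t1 + t2 + 1) (Seq c1 c2) s
      = bind_pmf (run t1 c1 s) (\<lambda>(c', s'). run t2 c2 s')"
    using h1 h2 by (rule run_Seq)
  have "halts (Seq c1 c2) s (t1 + t2 + 1)"
    using h2 unfolding halts_def eq by (fastforce simp: set_bind_pmf halts_def)
  moreover have "rel_pmf R (bind_pmf \<mu> \<nu>)
      (bind_pmf (map_pmf snd (run t1 c1 s)) (\<lambda>s'. map_pmf snd (run t2 c2 s')))"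
  proof (rule rel_pmf_bindI)
    show "rel_pmf (\<lambda>a s'. S a s' \<and> a \<in> set_pmf \<mu>) \<mu> (map_pmf snd (run t1 c1 s))"
      using r1 by (rule pmf.rel_mono_strong) auto
  qed (use 2 in \<open>auto simp: exec_def\<close>)
  ultimately show ?thesis
    unfolding exec_def eq by (simp add: map_bind_pmf bind_map_pmf case_prod_unfold)
qed

text \<open>Coupling with a point mass says that \<open>Q\<close> holds after every run; the program
  itself may still toss coins, as \<open>A\<close> does.\<close>

abbreviation det :: "com \<Rightarrow> state \<Rightarrow> nat \<Rightarrow> (state \<Rightarrow> bool) \<Rightarrow> bool" where
  "det c s t Q \<equiv> exec c s t (return_pmf ()) (\<lambda>_. Q)"

lemma det_Seq:
  assumes "det c1 s t1 Q" "\<And>s'. Q s' \<Longrightarrow> exec c2 s' t2 \<mu> R"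
  shows "exec (Seq c1 c2) s (t1 + t2 + 1) \<mu> R"
  using exec_Seq[OF assms(1), of c2 t2 "\<lambda>_. \<mu>" R] assms(2) by (simp add: bind_return_pmf)

lemma exec_Branch:
  assumes "test_val b s \<Longrightarrow> exec c1 s t \<mu> R" "\<not> test_val b s \<Longrightarrow> exec c2 s t \<mu> R"
  shows "exec (Branch b c1 c2) s (t + 1) \<mu> R"
  using assms unfolding exec_def
  by (auto simp: halts_Suc run_Suc_first bind_return_pmf simp del: run.simps(2))

section \<open>Iterated random steps and loops\<close>

primrec itr :: "(nat \<Rightarrow> 'a \<Rightarrow> 'a pmf) \<Rightarrow> nat \<Rightarrow> nat \<Rightarrow> 'a \<Rightarrow> 'a pmf" where
  "itr f j 0 a = return_pmf a"
| "itr f j (Suc m) a = bind_pmf (f j a) (itr f (Suc j) m)"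

text \<open>The recursion peels off the first round, as a loop does. The streaming distributions
  below are computed by conditioning on everything before the last item, which needs this
  form.\<close>

lemma itr_Suc_last: "itr f j (Suc m) a = bind_pmf (itr f j m a) (f (j + m))"
proof (induction m arbitrary: j a)
  case 0
  have "itr f (Suc j) 0 = return_pmf" by (simp add: fun_eq_iff)
  then show ?case by (simp add: bind_return_pmf bind_return_pmf')
next
  case (Suc m)
  have "itr f j (Suc (Suc m)) a = bind_pmf (f j a) (itr f (Suc j) (Suc m))"
    by (simp only: itr.simps)
  also have "\<dots> = bind_pmf (f j a) (\<lambda>a'. bind_pmf (itr f (Suc j) m a') (f (j + Suc m)))"
    unfolding Suc.IH by simp
  finally show ?case by (simp add: bind_assoc_pmf)
qed

lemma itr_return [simp]: "itr (\<lambda>_ a. return_pmf a) j m a = return_pmf a"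
  by (induction m arbitrary: j) (auto simp: bind_return_pmf)

text \<open>The arbitrary start \<open>j\<close> is what the induction over the remaining rounds
  needs. In each round 2 steps go to unfolding the loop and to discarding the \<open>Skip\<close>
  left by the body; the final 1 is the failing test.\<close>

lemma exec_While_from:
  assumes "J j a s" "j \<le> N"
    and test: "\<And>j a s. J j a s \<Longrightarrow> j \<le> N \<Longrightarrow> test_val b s \<longleftrightarrow> j < N"
    and body: "\<And>j a s. J j a s \<Longrightarrow> j < N \<Longrightarrow> exec c s tb (f j a) (J (Suc j))"
  shows "exec (While b c) s ((N - j) * (tb + 2) + 1) (itr f j (N - j) a) (J N)"
  using assms(1,2)
proof (induction "N - j" arbitrary: j a s)
  case 0
  then have "j = N" by simp
  then show ?case using 0 test[of j a s]
    by (simp add: exec_def halts_def bind_return_pmf rel_pmf_return_pmf1)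
next
  case (Suc m)
  then have j: "j < N" and m: "N - Suc j = m" by auto
  have "exec (Seq c (While b c)) s (tb + (m * (tb + 2) + 1) + 1) (bind_pmf (f j a) (itr f (Suc j) m)) (J N)"
  proof (rule exec_Seq)
    show "exec c s tb (f j a) (J (Suc j))" using Suc.prems j body by blast
    show "exec (While b c) s' (m * (tb + 2) + 1) (itr f (Suc j) m a') (J N)"
      if "J (Suc j) a' s'" for a' s'
      using Suc.hyps(1)[of "Suc j" a' s'] that j m by simp
  qed
  moreover have "step (While b c) s = return_pmf (Seq c (While b c), s)"
    using test[of j a s] Suc.prems j by simp
  then have "run (Suc t) (While b c) s = run t (Seq c (While b c)) s" for t
    unfolding run_Suc_first by (simp add: bind_return_pmf)
  moreover have "(N - j) * (tb + 2) + 1 = Suc (tb + (m * (tb + 2) + 1) + 1)" "N - j = Suc m"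
    using Suc.hyps(2) by (simp_all flip: Suc.hyps(2))
  ultimately show ?case by (simp only: exec_def halts_def itr.simps) blast
qed

lemma exec_While:
  assumes "J 0 a s"
    and "\<And>j a s. J j a s \<Longrightarrow> j \<le> N \<Longrightarrow> test_val b s \<longleftrightarrow> j < N"
    and "\<And>j a s. J j a s \<Longrightarrow> j < N \<Longrightarrow> exec c s tb (f j a) (J (Suc j))"
  shows "exec (While b c) s (N * (tb + 2) + 1) (itr f 0 N a) (J N)"
  using exec_While_from[of J 0 a s N b c tb f] assms by simp

section \<open>Frame conditions\<close>

datatype loc = NR nat | RR nat | NA nat | RA nat

primrec writes :: "com \<Rightarrow> loc set" where
  "writes Skip = {}"
| "writes (NConst r n) = {NR r}"
| "writes (NOp f r i j) = {NR r}"
| "writes (NLoad r a i) = {NR r}"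
| "writes (NStore a i r) = {NA a}"
| "writes (ROfNat r i) = {RR r}"
| "writes (ROp f r i j) = {RR r}"
| "writes (RLoad r a i) = {RR r}"
| "writes (RStore a i r) = {RA a}"
| "writes (Toss r p) = {NR r}"
| "writes (Seq c1 c2) = writes c1 \<union> writes c2"
| "writes (Branch b c1 c2) = writes c1 \<union> writes c2"
| "writes (While b c) = writes c"

definition agree_off :: "loc set \<Rightarrow> state \<Rightarrow> state \<Rightarrow> bool" where
  "agree_off W s s' \<longleftrightarrow>
     (\<forall>r. NR r \<notin> W \<longrightarrow> nreg s' r = nreg s r) \<and> (\<forall>r. RR r \<notin> W \<longrightarrow> rreg s' r = rreg s r) \<and>
     (\<forall>a. NA a \<notin> W \<longrightarrow> narr s' a = narr s a) \<and> (\<forall>a. RA a \<notin> W \<longrightarrow> rarr s' a = rarr s a)"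

lemma agree_off_refl [simp]: "agree_off W s s"
  by (simp add: agree_off_def)

lemma agree_off_trans: "agree_off W s s' \<Longrightarrow> agree_off W s' s'' \<Longrightarrow> agree_off W s s''"
  by (simp add: agree_off_def)

lemma agree_off_mono: "agree_off W s s' \<Longrightarrow> W \<subseteq> W' \<Longrightarrow> agree_off W' s s'"
  by (force simp: agree_off_def)

lemmas set_defs = set_nreg_def set_rreg_def set_narr_def set_rarr_def

text \<open>The inclusion for the residual program \<open>c'\<close> is what lets the frame property
  pass from one step to many.\<close>

lemma step_writes:
  "(c', s') \<in> set_pmf (step c s) \<Longrightarrow> agree_off (writes c) s s' \<and> writes c' \<subseteq> writes c"
proof (induction c arbitrary: c')
  case (Seq c1 c2)
  show ?case
  proof (cases "c1 = Skip")
    case False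
    with Seq.prems obtain c where "c' = Seq c c2" "(c, s') \<in> set_pmf (step c1 s)" by auto
    with Seq.IH(1)[of c] show ?thesis by (auto elim: agree_off_mono)
  qed (use Seq in auto)
qed (auto simp: agree_off_def set_defs split: if_splits)

lemma run_writes:
  "(c', s') \<in> set_pmf (run t c s) \<Longrightarrow> agree_off (writes c) s s' \<and> writes c' \<subseteq> writes c"
proof (induction t arbitrary: c' s')
  case (Suc t)
  then obtain c1 s1 where "(c1, s1) \<in> set_pmf (run t c s)" "(c', s') \<in> set_pmf (step c1 s1)"
    by (auto simp: set_bind_pmf)
  with Suc.IH[of c1 s1] step_writes[of c' s' c1 s1] show ?case
    by (meson agree_off_mono agree_off_trans order_trans)
qed simp

lemma exec_frame:
  assumes "exec c s t \<mu> R"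
  shows "exec c s t \<mu> (\<lambda>a s'. R a s' \<and> agree_off (writes c) s s')"
  using assms by (rule exec_conseq_reach) (auto dest: run_writes)

section \<open>Symbolic execution of loop-free code\<close>

primrec loop_free :: "com \<Rightarrow> bool" where
  "loop_free Skip \<longleftrightarrow> True"
| "loop_free (NConst r n) \<longleftrightarrow> True"
| "loop_free (NOp f r i j) \<longleftrightarrow> True"
| "loop_free (NLoad r a i) \<longleftrightarrow> True"
| "loop_free (NStore a i r) \<longleftrightarrow> True"
| "loop_free (ROfNat r i) \<longleftrightarrow> True"
| "loop_free (ROp f r i j) \<longleftrightarrow> True"
| "loop_free (RLoad r a i) \<longleftrightarrow> True"
| "loop_free (RStore a i r) \<longleftrightarrow> True"
| "loop_free (Toss r p) \<longleftrightarrow> True"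
| "loop_free (Seq c1 c2) \<longleftrightarrow> loop_free c1 \<and> loop_free c2"
| "loop_free (Branch b c1 c2) \<longleftrightarrow> loop_free c1 \<and> loop_free c2"
| "loop_free (While b c) \<longleftrightarrow> False"

primrec steps :: "com \<Rightarrow> nat" where
  "steps Skip = 0"
| "steps (NConst r n) = 1"
| "steps (NOp f r i j) = 1"
| "steps (NLoad r a i) = 1"
| "steps (NStore a i r) = 1"
| "steps (ROfNat r i) = 1"
| "steps (ROp f r i j) = 1"
| "steps (RLoad r a i) = 1"
| "steps (RStore a i r) = 1"
| "steps (Toss r p) = 1"
| "steps (Seq c1 c2) = steps c1 + steps c2 + 1"
| "steps (Branch b c1 c2) = max (steps c1) (steps c2) + 1"
| "steps (While b c) = 0"

text \<open>A big-step semantics that simplification can evaluate on concrete fragments; loops are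
  treated by invariants instead.\<close>

primrec denot :: "com \<Rightarrow> state \<Rightarrow> state pmf" where
  "denot Skip s = return_pmf s"
| "denot (NConst r n) s = return_pmf (set_nreg r n s)"
| "denot (NOp f r i j) s = return_pmf (set_nreg r (nat_op_val f (nreg s i) (nreg s j)) s)"
| "denot (NLoad r a i) s = return_pmf (set_nreg r (narr s a (nreg s i)) s)"
| "denot (NStore a i r) s = return_pmf (set_narr a (nreg s i) (nreg s r) s)"
| "denot (ROfNat r i) s = return_pmf (set_rreg r (real (nreg s i)) s)"
| "denot (ROp f r i j) s = return_pmf (set_rreg r (real_op_val f (rreg s i) (rreg s j)) s)"
| "denot (RLoad r a i) s = return_pmf (set_rreg r (rarr s a (nreg s i)) s)"
| "denot (RStore a i r) s = return_pmf (set_rarr a (nreg s i) (rreg s r) s)"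
| "denot (Toss r p) s =
     bind_pmf (bernoulli_pmf (rreg s p)) (\<lambda>b. return_pmf (set_nreg r (if b then 1 else 0) s))"
| "denot (Seq c1 c2) s = bind_pmf (denot c1 s) (denot c2)"
| "denot (Branch b c1 c2) s = (if test_val b s then denot c1 s else denot c2 s)"
| "denot (While b c) s = return_pmf s"

lemma exec_denot: "loop_free c \<Longrightarrow> exec c s (steps c) (denot c s) (=)"
proof (induction c arbitrary: s)
  case (Seq c1 c2)
  then have "exec (Seq c1 c2) s (steps c1 + steps c2 + 1) (bind_pmf (denot c1 s) (denot c2)) (=)"
    by (intro exec_Seq[where S = "(=)"]) auto
  then show ?case by simp
next
  case (Branch b c1 c2)
  have 1: "exec c1 s (max (steps c1) (steps c2)) (denot c1 s) (=)"
    by (rule exec_mono[of _ _ "steps c1"]) (use Branch in auto)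
  have 2: "exec c2 s (max (steps c1) (steps c2)) (denot c2 s) (=)"
    by (rule exec_mono[of _ _ "steps c2"]) (use Branch in auto)
  have "exec (Branch b c1 c2) s (max (steps c1) (steps c2) + 1) (denot (Branch b c1 c2) s) (=)"
    by (rule exec_Branch) (use 1 2 in simp_all)
  then show ?case by simp
qed (auto simp: exec_def halts_def bind_return_pmf run_Suc_first pmf.rel_eq
       map_pmf_def[symmetric] pmf.map_comp o_def bind_assoc_pmf)

lemma exec_loop_free:
  assumes "loop_free c" "steps c \<le> t" "rel_pmf R \<mu> (denot c s)"
  shows "exec c s t \<mu> R"
proof -
  have "exec c s t (denot c s) (=)"
    using exec_denot[OF assms(1)] assms(2) by (rule exec_mono)
  then show ?thesis using assms(3) by (simp add: exec_def pmf.rel_eq)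
qed

lemma det_loop_free:
  assumes "loop_free c" "steps c \<le> t" "\<And>s'. s' \<in> set_pmf (denot c s) \<Longrightarrow> R a s'"
  shows "exec c s t (return_pmf a) R"
  using assms by (intro exec_loop_free) (auto simp: rel_pmf_return_pmf1)

text \<open>Register 4 is reserved for the constant 1.\<close>

definition For :: "nat \<Rightarrow> nat \<Rightarrow> com \<Rightarrow> com" where
  "For i n c = Seq (NConst i 0) (While (NLess i n) (Seq c (NOp NAdd i i 4)))"

lemma writes_For [simp]: "writes (For i n c) = insert (NR i) (writes c)"
  by (auto simp: For_def)

text \<open>The counter is increased after the body, so the body has to establish the invariant for
  the state with the counter already at \<open>Suc j\<close>. The \<open>agree_off\<close> premise
  gives the body every fact about locations that the loop does not write.\<close>

lemma exec_For:
  assumes i: "i \<noteq> n" "i \<noteq> 4" "NR i \<notin> writes c" "NR n \<notin> writes c" "NR 4 \<notin> writes c"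
    and s: "nreg s n = N" "nreg s 4 = 1"
    and init: "J 0 a (set_nreg i 0 s)"
    and body: "\<And>j a s'. j < N \<Longrightarrow> J j a s' \<Longrightarrow> nreg s' i = j \<Longrightarrow>
       agree_off (insert (NR i) (writes c)) s s' \<Longrightarrow>
       exec c s' tb (f j a) (\<lambda>a' s''. J (Suc j) a' (set_nreg i (Suc j) s''))"
    and t: "t = N * (tb + 4) + 3"
  shows "exec (For i n c) s t (itr f 0 N a) (J N)"
proof -
  let ?W = "insert (NR i) (writes c)"
  define J' where "J' j a s' \<longleftrightarrow> J j a s' \<and> nreg s' i = j \<and> agree_off ?W s s'" for j a s'
  have "exec (While (NLess i n) (Seq c (NOp NAdd i i 4))) (set_nreg i 0 s)
      (N * (tb + 4) + 1) (itr f 0 N a) (J' N)"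
  proof (rule exec_While[where tb = "tb + 2", unfolded add.assoc numeral_plus_numeral add_num_simps])
    show "J' 0 a (set_nreg i 0 s)"
      using init by (auto simp: J'_def agree_off_def set_defs)
    show "test_val (NLess i n) s' \<longleftrightarrow> j < N" if "J' j a s'" for j a s'
      using that i s by (auto simp: J'_def agree_off_def)
    show "exec (Seq c (NOp NAdd i i 4)) s' (tb + 2) (f j a) (J' (Suc j))"
      if J': "J' j a s'" and j: "j < N" for j a s'
    proof -
      have "exec c s' tb (f j a) (\<lambda>a' s''. J (Suc j) a' (set_nreg i (Suc j) s''))"
        using J' j body by (auto simp: J'_def)
      from exec_frame[OF this]
      have "exec (Seq c (NOp NAdd i i 4)) s' (tb + 1 + 1) (bind_pmf (f j a) return_pmf) (J' (Suc j))"
      proof (rule exec_Seq)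
        fix a' s''
        assume *: "J (Suc j) a' (set_nreg i (Suc j) s'') \<and> agree_off (writes c) s' s''"
        then have "agree_off ?W s' s''" by (auto elim: agree_off_mono)
        then have W: "agree_off ?W s s''" using J' by (auto simp: J'_def intro: agree_off_trans)
        have "nreg s'' i = j" "nreg s'' 4 = 1"
          using * J' i s by (auto simp: J'_def agree_off_def)
        then show "exec (NOp NAdd i i 4) s'' 1 (return_pmf a') (J' (Suc j))"
          using * W by (intro det_loop_free) (auto simp: J'_def, auto simp: agree_off_def set_defs)
      qed
      then show ?thesis by (simp add: bind_return_pmf')
    qed
  qed
  then have "exec (While (NLess i n) (Seq c (NOp NAdd i i 4))) (set_nreg i 0 s)
      (N * (tb + 4) + 1) (itr f 0 N a) (J N)"
    by (rule exec_conseq) (simp add: J'_def)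
  moreover have "det (NConst i 0) s 1 (\<lambda>s'. s' = set_nreg i 0 s)"
    by (rule det_loop_free) auto
  ultimately have "exec (For i n c) s (1 + (N * (tb + 4) + 1) + 1) (itr f 0 N a) (J N)"
    unfolding For_def by (intro det_Seq[where Q = "\<lambda>s'. s' = set_nreg i 0 s"]) auto
  moreover have "1 + (N * (tb + 4) + 1) + 1 = t" using t by simp
  ultimately show ?thesis by (simp only:)
qed

lemma det_For:
  assumes "i \<noteq> n" "i \<noteq> 4" "NR i \<notin> writes c" "NR n \<notin> writes c" "NR 4 \<notin> writes c"
    and "nreg s n = N" "nreg s 4 = 1"
    and "J 0 (set_nreg i 0 s)"
    and body: "\<And>j s'. j < N \<Longrightarrow> J j s' \<Longrightarrow> nreg s' i = j \<Longrightarrow>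
       agree_off (insert (NR i) (writes c)) s s' \<Longrightarrow>
       det c s' tb (\<lambda>s''. J (Suc j) (set_nreg i (Suc j) s''))"
    and "t = N * (tb + 4) + 3"
  shows "det (For i n c) s t (J N)"
proof -
  have "exec (For i n c) s t (itr (\<lambda>_. return_pmf) 0 N ()) (\<lambda>_. J N)"
    by (rule exec_For[where J = "\<lambda>j _. J j"]) (use assms in auto)
  then show ?thesis by simp
qed

section \<open>Renaming of registers and arrays\<close>

primrec rename :: "(nat \<Rightarrow> nat) \<Rightarrow> (nat \<Rightarrow> nat) \<Rightarrow> (nat \<Rightarrow> nat) \<Rightarrow> (nat \<Rightarrow> nat) \<Rightarrow> com \<Rightarrow> com" where
  "rename fn fr gn gr Skip = Skip"
| "rename fn fr gn gr (NConst r n) = NConst (fn r) n"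
| "rename fn fr gn gr (NOp f r i j) = NOp f (fn r) (fn i) (fn j)"
| "rename fn fr gn gr (NLoad r a i) = NLoad (fn r) (gn a) (fn i)"
| "rename fn fr gn gr (NStore a i r) = NStore (gn a) (fn i) (fn r)"
| "rename fn fr gn gr (ROfNat r i) = ROfNat (fr r) (fn i)"
| "rename fn fr gn gr (ROp f r i j) = ROp f (fr r) (fr i) (fr j)"
| "rename fn fr gn gr (RLoad r a i) = RLoad (fr r) (gr a) (fn i)"
| "rename fn fr gn gr (RStore a i r) = RStore (gr a) (fn i) (fr r)"
| "rename fn fr gn gr (Toss r p) = Toss (fn r) (fr p)"
| "rename fn fr gn gr (Seq c1 c2) = Seq (rename fn fr gn gr c1) (rename fn fr gn gr c2)"
| "rename fn fr gn gr (Branch b c1 c2) =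
     Branch (case b of NLess i j \<Rightarrow> NLess (fn i) (fn j) | RLess i j \<Rightarrow> RLess (fr i) (fr j))
       (rename fn fr gn gr c1) (rename fn fr gn gr c2)"
| "rename fn fr gn gr (While b c) =
     While (case b of NLess i j \<Rightarrow> NLess (fn i) (fn j) | RLess i j \<Rightarrow> RLess (fr i) (fr j))
       (rename fn fr gn gr c)"

text \<open>The part of the memory that a renamed program can reach, under the names that the
  original program uses.\<close>

definition view ::
    "(nat \<Rightarrow> nat) \<Rightarrow> (nat \<Rightarrow> nat) \<Rightarrow> (nat \<Rightarrow> nat) \<Rightarrow> (nat \<Rightarrow> nat) \<Rightarrow> state \<Rightarrow> state" where
  "view fn fr gn gr s =
     \<lparr>nreg = nreg s \<circ> fn, rreg = rreg s \<circ> fr, narr = narr s \<circ> gn, rarr = rarr s \<circ> gr\<rparr>"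

context
  fixes fn fr gn gr :: "nat \<Rightarrow> nat"
  assumes inj: "inj fn" "inj fr" "inj gn" "inj gr"
begin

lemma view_simps:
  "nreg (view fn fr gn gr s) r = nreg s (fn r)" "rreg (view fn fr gn gr s) r = rreg s (fr r)"
  "narr (view fn fr gn gr s) a = narr s (gn a)" "rarr (view fn fr gn gr s) a = rarr s (gr a)"
  by (simp_all add: view_def)

lemma view_set:
  "view fn fr gn gr (set_nreg (fn r) m s) = set_nreg r m (view fn fr gn gr s)"
  "view fn fr gn gr (set_rreg (fr r) v s) = set_rreg r v (view fn fr gn gr s)"
  "view fn fr gn gr (set_narr (gn a) i m s) = set_narr a i m (view fn fr gn gr s)"
  "view fn fr gn gr (set_rarr (gr a) i v s) = set_rarr a i v (view fn fr gn gr s)"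
  using inj by (auto simp: view_def set_defs fun_eq_iff inj_eq)

lemma rename_eq_Skip [simp]: "rename fn fr gn gr c = Skip \<longleftrightarrow> c = Skip"
  by (cases c) auto

text \<open>Renaming pushes programs forward but pulls states back, so the simulation equates two
  images: states are mapped on one side, programs on the other. Injectivity makes
  \<open>view\<close> commute with updates.\<close>

lemma step_rename:
  "map_pmf (map_prod id (view fn fr gn gr)) (step (rename fn fr gn gr c) s)
     = map_pmf (map_prod (rename fn fr gn gr) id) (step c (view fn fr gn gr s))"
proof (induction c)
  case (Seq c1 c2)
  show ?case
  proof (cases "c1 = Skip")
    case False
    have "map_pmf (map_prod id (view fn fr gn gr)) (step (rename fn fr gn gr (Seq c1 c2)) s)
        = map_pmf (\<lambda>(c, s'). (Seq c (rename fn fr gn gr c2), s'))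
            (map_pmf (map_prod id (view fn fr gn gr)) (step (rename fn fr gn gr c1) s))"
      using False by (simp add: pmf.map_comp o_def case_prod_unfold map_prod_def)
    also have "\<dots> = map_pmf (map_prod (rename fn fr gn gr) id) (step (Seq c1 c2) (view fn fr gn gr s))"
      unfolding Seq.IH(1) using False by (simp add: pmf.map_comp o_def case_prod_unfold map_prod_def)
    finally show ?thesis .
  qed (use Seq in simp)
next
  case (Branch b c1 c2)
  then show ?case by (cases b) (auto simp: view_simps)
next
  case (While b c)
  then show ?case by (cases b) (auto simp: view_simps)
qed (simp_all add: view_set view_simps pmf.map_comp o_def)

lemma run_rename:
  "rel_pmf (\<lambda>(c1, s1) (c2, s2). c1 = rename fn fr gn gr c2 \<and> view fn fr gn gr s1 = s2)
     (run t (rename fn fr gn gr c) s) (run t c (view fn fr gn gr s))"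
    (is "rel_pmf ?R _ _")
proof (induction t)
  case (Suc t)
  have *: "rel_pmf ?R (step (rename fn fr gn gr c) s) (step c (view fn fr gn gr s))" for c s
    using step_rename[of c s] unfolding pmf.rel_eq[symmetric] pmf.rel_map
    by (rule pmf.rel_mono_strong) auto
  show ?case
    unfolding run.simps by (rule rel_pmf_bindI[OF Suc.IH]) (use * in auto)
qed simp

lemma det_rename:
  assumes "\<And>c' s'. (c', s') \<in> set_pmf (run t c (view fn fr gn gr s)) \<Longrightarrow> c' = Skip \<and> Q s'"
  shows "det (rename fn fr gn gr c) s t (\<lambda>s'. Q (view fn fr gn gr s'))"
proof -
  have "c1 = Skip \<and> Q (view fn fr gn gr s1)"
    if "(c1, s1) \<in> set_pmf (run t (rename fn fr gn gr c) s)" for c1 s1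
    using rel_setD1[OF rel_pmf_imp_rel_set[OF run_rename] that] assms by fastforce
  then show ?thesis by (auto simp: exec_def halts_def rel_pmf_return_pmf1)
qed

end

section \<open>Truncated distance sampling\<close>

lemma prob_bind_pmf:
  "measure_pmf.prob (bind_pmf M f) A = measure_pmf.expectation M (\<lambda>x. measure_pmf.prob (f x) A)"
  unfolding measure_pmf_bind
  by (subst measure_pmf.measure_bind[where N = "count_space UNIV"])
    (auto simp: space_subprob_algebra measure_pmf.subprob_space_axioms)

lemma integrable_prob_pmf [simp]:
  "integrable (measure_pmf M) (\<lambda>x. measure_pmf.prob (f x) A)"
  by (rule measure_pmf.integrable_const_bound[where B = 1]) auto

lemma integrable_indicator_pmf [simp]: "integrable (measure_pmf M) (indicat_real S)"
  by (rule measure_pmf.integrable_const_bound[where B = 1]) auto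

lemma prob_bind_pmf_ge:
  assumes "\<And>x. x \<in> set_pmf M \<Longrightarrow> x \<in> S \<Longrightarrow> c \<le> measure_pmf.prob (f x) A"
  shows "measure_pmf.prob M S * c \<le> measure_pmf.prob (bind_pmf M f) A"
proof -
  have "measure_pmf.prob M S * c = measure_pmf.expectation M (\<lambda>x. indicator S x * c)"
    by simp
  also have "\<dots> \<le> measure_pmf.prob (bind_pmf M f) A"
    unfolding prob_bind_pmf using assms
    by (intro integral_mono_AE integrable_mult_left)
      (auto simp: AE_measure_pmf_iff split: split_indicator)
  finally show ?thesis .
qed

lemma prob_itr_stuck:
  assumes "\<And>a a'. ok a \<Longrightarrow> a' \<in> set_pmf (f a) \<Longrightarrow> ok a'" "ok a"
  shows "set_pmf (itr (\<lambda>_. f) j m a) \<subseteq> Collect ok"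
  using assms(2)
proof (induction m arbitrary: j a)
  case (Suc m)
  then have "set_pmf (itr (\<lambda>_. f) (Suc j) m a') \<subseteq> Collect ok" if "a' \<in> set_pmf (f a)" for a'
    using assms(1) that by blast
  then show ?case by auto
qed simp

text \<open>The potential \<open>2 ^ b a\<close>, counted as 0 once \<open>ok\<close> holds, shrinks
  in expectation by the factor \<open>1 - q / 2\<close> per round: \<open>b\<close> never grows, and
  each drop, which has probability at least \<open>q\<close>, at least halves the potential. This
  takes the place of a tail bound for the number of successful rounds.\<close>

lemma prob_itr_fail:
  fixes f :: "'a \<Rightarrow> 'a pmf" and b :: "'a \<Rightarrow> nat" and q :: real
  assumes q: "0 \<le> q" "q \<le> 1"
    and stuck: "\<And>a a'. ok a \<Longrightarrow> a' \<in> set_pmf (f a) \<Longrightarrow> ok a'"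
    and mono: "\<And>a a'. a' \<in> set_pmf (f a) \<Longrightarrow> b a' \<le> b a"
    and prog: "\<And>a. \<not> ok a \<Longrightarrow> q \<le> measure_pmf.prob (f a) {a'. b a' < b a}"
  shows "measure_pmf.prob (itr (\<lambda>_. f) j m a) {a. \<not> ok a} \<le> 2 ^ b a * (1 - q / 2) ^ m"
proof (induction m arbitrary: j a)
  case 0
  show ?case by (rule order_trans[OF measure_pmf.prob_le_1]) simp
next
  case (Suc m)
  show ?case
  proof (cases "ok a")
    case True
    have "measure_pmf.prob (itr (\<lambda>_. f) j (Suc m) a) {a. \<not> ok a} = 0"
      using prob_itr_stuck[of ok f a j "Suc m"] stuck True
      by (subst measure_pmf_zero_iff) blast
    then show ?thesis using q by simp
  next
    case False
    let ?K = "2 ^ b a * (1 - q / 2) ^ m"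
    have "measure_pmf.prob (itr (\<lambda>_. f) j (Suc m) a) {a. \<not> ok a}
        = measure_pmf.expectation (f a) (\<lambda>x. measure_pmf.prob (itr (\<lambda>_. f) (Suc j) m x) {a. \<not> ok a})"
      by (simp add: prob_bind_pmf)
    also have "\<dots> \<le> measure_pmf.expectation (f a) (\<lambda>x. ?K - ?K / 2 * indicator {a'. b a' < b a} x)"
    proof (rule integral_mono_AE)
      show "AE x in f a. measure_pmf.prob (itr (\<lambda>_. f) (Suc j) m x) {a. \<not> ok a}
          \<le> ?K - ?K / 2 * indicator {a'. b a' < b a} x"
      proof (simp only: AE_measure_pmf_iff, intro ballI)
        fix x assume x: "x \<in> set_pmf (f a)"
        have "measure_pmf.prob (itr (\<lambda>_. f) (Suc j) m x) {a. \<not> ok a} \<le> 2 ^ b x * (1 - q / 2) ^ m"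
          by (rule Suc.IH)
        also have "\<dots> \<le> ?K - ?K / 2 * indicator {a'. b a' < b a} x"
        proof (cases "b x < b a")
          case True
          then have "(2::real) ^ Suc (b x) \<le> 2 ^ b a" by (intro power_increasing) auto
          then have "2 ^ Suc (b x) * (1 - q / 2) ^ m \<le> ?K" using q by (intro mult_right_mono) auto
          then show ?thesis using True by simp
        next
          case False
          then have "b x = b a" using mono[OF x] by simp
          then show ?thesis by simp
        qed
        finally show "measure_pmf.prob (itr (\<lambda>_. f) (Suc j) m x) {a. \<not> ok a}
          \<le> ?K - ?K / 2 * indicator {a'. b a' < b a} x" .
      qed
    qed auto
    also have "\<dots> = ?K - ?K / 2 * measure_pmf.prob (f a) {a'. b a' < b a}"
      by (subst Bochner_Integration.integral_diff) auto
    also have "\<dots> \<le> ?K - ?K / 2 * q"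
      using prog[OF False] q by (intro diff_left_mono mult_left_mono) auto
    also have "\<dots> = 2 ^ b a * (1 - q / 2) ^ Suc m" by (simp add: algebra_simps)
    finally show ?thesis .
  qed
qed

text \<open>Only the runs in which each round makes progress until \<open>ok\<close> holds are
  counted; \<open>b a\<close> such rounds suffice.\<close>

lemma prob_itr_success:
  fixes f :: "'a \<Rightarrow> 'a pmf" and b :: "'a \<Rightarrow> nat" and q :: real
  assumes q: "0 \<le> q" "q \<le> 1"
    and stuck: "\<And>a a'. ok a \<Longrightarrow> a' \<in> set_pmf (f a) \<Longrightarrow> ok a'"
    and zero: "\<And>a. b a = 0 \<Longrightarrow> ok a"
    and prog: "\<And>a. \<not> ok a \<Longrightarrow> q \<le> measure_pmf.prob (f a) {a'. b a' < b a}"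
    and "b a \<le> m"
  shows "q ^ b a \<le> measure_pmf.prob (itr (\<lambda>_. f) j m a) {a. ok a}"
  using \<open>b a \<le> m\<close>
proof (induction m arbitrary: j a)
  case 0
  then show ?case using zero[of a] by simp
next
  case (Suc m)
  show ?case
  proof (cases "ok a")
    case True
    have "measure_pmf.prob (itr (\<lambda>_. f) j (Suc m) a) {a. ok a} = 1"
      using prob_itr_stuck[of ok f a j "Suc m"] stuck True
      by (subst measure_pmf.prob_eq_1) (auto simp: AE_measure_pmf_iff)
    then show ?thesis using q by (simp add: power_le_one del: itr.simps)
  next
    case False
    then obtain r where r: "b a = Suc r" using zero[of a] by (cases "b a") auto
    have "q ^ b a \<le> measure_pmf.prob (f a) {a'. b a' < b a} * q ^ r"
      unfolding r using prog[OF False] q r by (auto intro: mult_right_mono)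
    also have "\<dots> \<le> measure_pmf.prob (itr (\<lambda>_. f) j (Suc m) a) {a. ok a}"
      unfolding itr.simps
    proof (rule prob_bind_pmf_ge)
      fix x assume "x \<in> {a'. b a' < b a}"
      then have bx: "b x \<le> r" by (simp add: r)
      have "q ^ r \<le> q ^ b x" using bx q by (intro power_decreasing) auto
      also have "\<dots> \<le> measure_pmf.prob (itr (\<lambda>_. f) (Suc j) m x) {a. ok a}"
        using bx Suc.prems r by (intro Suc.IH) auto
      finally show "q ^ r \<le> measure_pmf.prob (itr (\<lambda>_. f) (Suc j) m x) {a. ok a}" .
    qed
    finally show ?thesis .
  qed
qed

section \<open>Random truncation level and weighted sampling in one pass\<close>

definition max_step :: "real \<Rightarrow> (nat \<Rightarrow> real) \<Rightarrow> nat \<Rightarrow> real \<Rightarrow> real pmf" where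
  "max_step r D i \<tau> =
     bind_pmf (bernoulli_pmf r) (\<lambda>b. return_pmf (if b \<and> \<tau> < D i then D i else \<tau>))"

text \<open>\<open>S\<close> is closed downwards and contains the start value 0, so the running
  maximum stays in \<open>S\<close> exactly if no index with a value outside \<open>S\<close> is
  sampled. These exclusions are independent.\<close>

lemma prob_itr_max_step:
  fixes r :: real and S :: "real set"
  assumes r: "0 \<le> r" "r \<le> 1" and S: "\<And>x y. y \<in> S \<Longrightarrow> x \<le> y \<Longrightarrow> x \<in> S" "0 \<in> S"
  shows "measure_pmf.prob (itr (max_step r D) 0 m 0) S = (1 - r) ^ card {j. j < m \<and> D j \<notin> S}"
proof (induction m)
  case 0
  show ?case using S(2) by simp
next
  case (Suc m)
  let ?p = "\<lambda>\<tau>. measure_pmf.prob (max_step r D m \<tau>) S"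
  have p: "?p \<tau> = (if D m \<in> S then 1 else 1 - r) * indicator S \<tau>" for \<tau>
  proof -
    have "?p \<tau> = indicator S (if \<tau> < D m then D m else \<tau>) * r + indicator S \<tau> * (1 - r)"
      using r by (simp add: max_step_def prob_bind_pmf)
    also have "\<dots> = (if D m \<in> S then 1 else 1 - r) * indicator S \<tau>"
      using S(1)[of "D m" \<tau>] S(1)[of \<tau> "D m"] by (auto simp: indicator_def)
    finally show ?thesis .
  qed
  have "measure_pmf.prob (itr (max_step r D) 0 (Suc m) 0) S
      = (if D m \<in> S then 1 else 1 - r) * measure_pmf.prob (itr (max_step r D) 0 m 0) S"
    unfolding itr_Suc_last prob_bind_pmf add_0 p by simp
  also have "\<dots> = (1 - r) ^ card {j. j < Suc m \<and> D j \<notin> S}"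
  proof -
    have "{j. j < Suc m \<and> D j \<notin> S} =
        (if D m \<in> S then {j. j < m \<and> D j \<notin> S} else insert m {j. j < m \<and> D j \<notin> S})"
      by (auto simp: less_Suc_eq)
    then show ?thesis unfolding Suc.IH by simp
  qed
  finally show ?case .
qed

text \<open>\<open>D i\<close> is the \<open>(m + 1)\<close>-th largest value: the largest one that
  more than \<open>m\<close> indices reach. If more than \<open>m\<close> indices exceeded it, the
  smallest value among them would be a larger candidate.\<close>

lemma ex_quantile:
  fixes D :: "nat \<Rightarrow> real"
  assumes "m < n"
  shows "\<exists>i<n. card {j. j < n \<and> D i < D j} \<le> m \<and> m < card {j. j < n \<and> D i \<le> D j}"
proof -
  define T where "T = {v \<in> D ` {..<n}. m < card {j. j < n \<and> v \<le> D j}}"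
  have fin: "finite T" by (simp add: T_def)
  have "Min (D ` {..<n}) \<in> T"
  proof -
    have "{j. j < n \<and> Min (D ` {..<n}) \<le> D j} = {..<n}" by auto
    moreover have "Min (D ` {..<n}) \<in> D ` {..<n}" using assms by (intro Min_in) (auto simp: lessThan_empty_iff)
    ultimately show ?thesis using assms by (simp add: T_def)
  qed
  then have "Max T \<in> T" using fin by (intro Max_in) auto
  then obtain i where i: "i < n" "Max T = D i" "m < card {j. j < n \<and> D i \<le> D j}"
    by (auto simp: T_def)
  have "card {j. j < n \<and> D i < D j} \<le> m"
  proof (rule ccontr)
    let ?U = "{j. j < n \<and> D i < D j}"
    assume c: "\<not> card ?U \<le> m"
    then have "?U \<noteq> {}" by (intro notI) simp
    then have "Min (D ` ?U) \<in> D ` ?U" by (intro Min_in) auto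
    then obtain l where l: "l < n" "D i < D l" "D l = Min (D ` ?U)" by auto
    have "?U \<subseteq> {j. j < n \<and> D l \<le> D j}" unfolding l(3) by auto
    then have "card ?U \<le> card {j. j < n \<and> D l \<le> D j}" by (intro card_mono) auto
    then have "D l \<in> T" using c l(1) by (auto simp: T_def)
    then have "D l \<le> Max T" using fin by simp
    then show False using l i by simp
  qed
  then show ?thesis using i by blast
qed

text \<open>Weighted reservoir sampling with a single slot: the current item replaces the kept one
  with its share of the prefix sum, so the total weight need not be known beforehand. While the
  prefix sum is 0, the quotient \<open>0 / 0 = 0\<close> means no replacement.\<close>

definition reservoir_step :: "(nat \<Rightarrow> real) \<Rightarrow> nat \<Rightarrow> nat \<Rightarrow> nat pmf" where
  "reservoir_step u i c =
     bind_pmf (bernoulli_pmf (u i / (\<Sum>j<Suc i. u j))) (\<lambda>b. return_pmf (if b then i else c))"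

text \<open>An earlier item survives item \<open>m\<close> with probability
  \<open>?W m / ?W (Suc m)\<close>, and these factors telescope. The start value
  \<open>c \<ge> m\<close> cannot be confused with an item.\<close>

lemma pmf_itr_reservoir_step:
  assumes u: "\<And>i. 0 \<le> u i" and "0 < (\<Sum>j<m. u j)" "m \<le> c" "i < m"
  shows "pmf (itr (reservoir_step u) 0 m c) i = u i / (\<Sum>j<m. u j)"
  using assms(2-)
proof (induction m arbitrary: i)
  case 0
  then show ?case by simp
next
  case (Suc m)
  let ?W = "\<lambda>m. \<Sum>j<m. u j"
  have W: "0 \<le> ?W m" using u by (simp add: sum_nonneg)
  have q: "0 \<le> u m / ?W (Suc m)" "u m / ?W (Suc m) \<le> 1"
    using W u[of m] by (auto simp: divide_simps)
  have supp: "set_pmf (itr (reservoir_step u) 0 l c) \<subseteq> insert c {..<l}" for l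
  proof (induction l)
    case (Suc l)
    have "set_pmf (reservoir_step u l x) \<subseteq> {l, x}" for x
      by (auto simp: reservoir_step_def simp del: sum.lessThan_Suc)
    then show ?case unfolding itr_Suc_last set_bind_pmf using Suc by fastforce
  qed simp
  have zero: "pmf (itr (reservoir_step u) 0 m c) m = 0"
    using supp[of m] Suc.prems(2) by (subst pmf_eq_0_set_pmf) auto
  have step: "pmf (reservoir_step u m x) i
      = of_bool (i = m) * (u m / ?W (Suc m)) + indicator {i} x * (1 - u m / ?W (Suc m))" for x
    unfolding reservoir_step_def pmf_bind integral_bernoulli_pmf[OF q]
    by (auto simp: indicator_def)
  have rec: "pmf (itr (reservoir_step u) 0 (Suc m) c) i
      = of_bool (i = m) * (u m / ?W (Suc m)) +
          pmf (itr (reservoir_step u) 0 m c) i * (1 - u m / ?W (Suc m))"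
    unfolding itr_Suc_last pmf_bind[of "itr _ _ _ _"] add_0 step
    by (subst Bochner_Integration.integral_add) (auto simp: measure_pmf_single simp del: sum.lessThan_Suc)
  show ?case
  proof (cases "i = m")
    case True
    then show ?thesis using rec zero by (simp del: sum.lessThan_Suc itr.simps)
  next
    case False
    then have i: "i < m" using Suc.prems by simp
    show ?thesis
    \<comment> \<open>The induction hypothesis requires a positive prefix sum. If it is 0, all
      earlier items have weight 0 and item \<open>m\<close> is taken with certainty.\<close>
    proof (cases "?W m = 0")
      case True
      then have "u i = 0" using u i by (subst (asm) sum_nonneg_eq_0_iff) auto
      moreover have "u m / ?W (Suc m) = 1" using True Suc.prems(1) by simp
      ultimately show ?thesis using rec False by (simp del: sum.lessThan_Suc itr.simps)
    next
      case nz: False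
      then have "pmf (itr (reservoir_step u) 0 m c) i = u i / ?W m"
        using Suc.IH[of i] W Suc.prems i by simp
      moreover have "1 - u m / ?W (Suc m) = ?W m / ?W (Suc m)"
        using Suc.prems(1) by (simp add: divide_simps)
      ultimately show ?thesis using rec False nz by (simp del: sum.lessThan_Suc itr.simps)
    qed
  qed
qed

lemma prob_itr_reservoir_step:
  assumes "\<And>i. 0 \<le> u i" "0 < (\<Sum>j<m. u j)" "m \<le> c" "G \<subseteq> {..<m}"
  shows "measure_pmf.prob (itr (reservoir_step u) 0 m c) G = (\<Sum>i\<in>G. u i) / (\<Sum>j<m. u j)"
proof -
  have "measure_pmf.prob (itr (reservoir_step u) 0 m c) G = sum (pmf (itr (reservoir_step u) 0 m c)) G"
    using assms(4) by (intro measure_measure_pmf_finite) (auto intro: finite_subset)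
  also have "\<dots> = (\<Sum>i\<in>G. u i / (\<Sum>j<m. u j))"
    using assms by (intro sum.cong pmf_itr_reservoir_step) auto
  finally show ?thesis by (simp add: sum_divide_distrib)
qed

lemma power2_sum_le:
  fixes a b :: real
  shows "(a + b)\<^sup>2 \<le> 2 * a\<^sup>2 + 2 * b\<^sup>2"
  using sum_squares_bound[of a b] by (simp add: power2_sum)

text \<open>Here \<open>v\<close> and \<open>\<rho> i\<close> are the (truncated) distances of the
  cluster center and of point \<open>i\<close> to the seeds, and \<open>e i\<close> is the distance
  from \<open>i\<close> to the center. Since 34 = 2 * 16 + 2, an expensive cluster of
  \<open>N\<close> points satisfies \<open>16 \<Gamma> < N v^2\<close>. By Markov's inequality at
  least 3/4 of its points are within twice the root mean square distance, hence within
  \<open>v / 2\<close>, of the center, so each has \<open>\<rho> i \<ge> v / 2\<close>. They carry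
  at least \<open>3/16 N v^2\<close> of a total of at most \<open>17/8 N v^2\<close>.\<close>

lemma core_share:
  fixes \<rho> e :: "'a \<Rightarrow> real" and v :: real
  assumes A: "finite A"
    and nonneg: "\<And>i. i \<in> A \<Longrightarrow> 0 \<le> \<rho> i" "\<And>i. i \<in> A \<Longrightarrow> 0 \<le> e i" "0 \<le> v"
    and lip: "\<And>i. i \<in> A \<Longrightarrow> \<rho> i \<le> v + e i" "\<And>i. i \<in> A \<Longrightarrow> v \<le> \<rho> i + e i"
    and bad: "34 * (\<Sum>i\<in>A. (e i)\<^sup>2) < (\<Sum>i\<in>A. (\<rho> i)\<^sup>2)"
  shows "3 / 34 * (\<Sum>i\<in>A. (\<rho> i)\<^sup>2)
    \<le> (\<Sum>i | i \<in> A \<and> (e i)\<^sup>2 * real (card A) \<le> 4 * (\<Sum>i\<in>A. (e i)\<^sup>2). (\<rho> i)\<^sup>2)"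
proof -
  define \<Gamma> where "\<Gamma> = (\<Sum>i\<in>A. (e i)\<^sup>2)"
  define N where "N = real (card A)"
  define B where "B = {i \<in> A. (e i)\<^sup>2 * N \<le> 4 * \<Gamma>}"
  have \<Gamma>0: "0 \<le> \<Gamma>" by (simp add: \<Gamma>_def sum_nonneg)
  have fin: "finite B" "B \<subseteq> A" using A by (auto simp: B_def)
  have "A \<noteq> {}" using bad by auto
  then have N: "0 < N" using A by (simp add: N_def card_gt_0_iff)
  have tot: "(\<Sum>i\<in>A. (\<rho> i)\<^sup>2) \<le> 2 * N * v\<^sup>2 + 2 * \<Gamma>"
  proof -
    have "(\<rho> i)\<^sup>2 \<le> 2 * v\<^sup>2 + 2 * (e i)\<^sup>2" if "i \<in> A" for i
      using power_mono[OF lip(1)[OF that] nonneg(1)[OF that], of 2] power2_sum_le[of v "e i"] by simp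
    then have "(\<Sum>i\<in>A. (\<rho> i)\<^sup>2) \<le> (\<Sum>i\<in>A. 2 * v\<^sup>2 + 2 * (e i)\<^sup>2)" by (intro sum_mono) auto
    then show ?thesis by (simp add: sum.distrib sum_distrib_left[symmetric] \<Gamma>_def N_def algebra_simps)
  qed
  have far: "16 * \<Gamma> < N * v\<^sup>2" using bad tot by (simp add: \<Gamma>_def[symmetric])
  have B_half: "(\<rho> i)\<^sup>2 \<ge> v\<^sup>2 / 4" if i: "i \<in> B" for i
  proof -
    have "(e i)\<^sup>2 * N \<le> N * v\<^sup>2 / 4" using i far by (simp add: B_def)
    then have "(2 * e i)\<^sup>2 * N \<le> v\<^sup>2 * N" by (simp add: power_mult_distrib field_simps)
    then have "(2 * e i)\<^sup>2 \<le> v\<^sup>2" using N by simp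
    then have "2 * e i \<le> v" using nonneg(3) by (rule power2_le_imp_le)
    then have "v / 2 \<le> \<rho> i" using lip(2)[of i] i by (simp add: B_def)
    then have "(v / 2)\<^sup>2 \<le> (\<rho> i)\<^sup>2" using nonneg(3) by (intro power_mono) auto
    then show ?thesis by (simp add: power_divide)
  qed
  have cardB: "3 / 4 * N \<le> real (card B)"
  \<comment> \<open>Markov's inequality is divided by \<open>\<Gamma>\<close>. If
    \<open>\<Gamma> = 0\<close>, every point is at distance 0 from the center and belongs to
    \<open>B\<close>.\<close>
  proof (cases "\<Gamma> = 0")
    case True
    then have "\<forall>i\<in>A. (e i)\<^sup>2 = 0" unfolding \<Gamma>_def using A by (subst (asm) sum_nonneg_eq_0_iff) auto
    then have "B = A" using \<Gamma>0 by (auto simp: B_def)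
    then show ?thesis using N by (simp add: N_def)
  next
    case False
    then have \<Gamma>: "0 < \<Gamma>" using \<Gamma>0 by simp
    have "real (card (A - B)) * (4 * \<Gamma>) \<le> (\<Sum>i\<in>A - B. (e i)\<^sup>2 * N)"
      unfolding sum_constant[symmetric] by (intro sum_mono) (auto simp: B_def)
    also have "\<dots> \<le> (\<Sum>i\<in>A. (e i)\<^sup>2 * N)" using A N by (intro sum_mono2) auto
    also have "\<dots> = N * \<Gamma>" by (simp add: \<Gamma>_def sum_distrib_left mult.commute)
    finally have "real (card (A - B)) * 4 \<le> N" using \<Gamma> by simp
    moreover have "real (card (A - B)) = N - real (card B)"
      using fin A by (simp add: N_def card_Diff_subset of_nat_diff card_mono)
    ultimately show ?thesis by simp
  qed
  have "3 / 34 * (\<Sum>i\<in>A. (\<rho> i)\<^sup>2) \<le> 3 / 34 * (17 / 8 * (N * v\<^sup>2))"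
    using tot far by (intro mult_left_mono) auto
  also have "\<dots> = 3 / 4 * N * (v\<^sup>2 / 4)" by simp
  also have "\<dots> \<le> real (card B) * (v\<^sup>2 / 4)" using cardB by (intro mult_right_mono) auto
  also have "\<dots> \<le> (\<Sum>i\<in>B. (\<rho> i)\<^sup>2)"
    unfolding sum_constant[symmetric] using B_half by (intro sum_mono) auto
  finally show ?thesis by (simp add: B_def \<Gamma>_def N_def)
qed

text \<open>The list of chosen centers is built up by prepending. The cap \<open>V\<close> stands for an infinite
  distance while there is no center yet.\<close>

primrec center_sqdist :: "(nat \<Rightarrow> nat \<Rightarrow> real) \<Rightarrow> real \<Rightarrow> nat list \<Rightarrow> nat \<Rightarrow> real" where
  "center_sqdist \<delta> V [] i = V"
| "center_sqdist \<delta> V (c # cs) i = min (center_sqdist \<delta> V cs i) ((\<delta> i c)\<^sup>2)"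

text \<open>The reservoir starts with the sentinel \<open>n\<close>, which survives only if all
  truncated distances vanish; then the round adds no seed.\<close>

definition seed_round :: "nat \<Rightarrow> nat \<Rightarrow> (nat \<Rightarrow> nat \<Rightarrow> real) \<Rightarrow> real \<Rightarrow> nat list \<Rightarrow> nat list pmf" where
  "seed_round n z \<delta> V cs =
     bind_pmf (itr (max_step (1 / real (8 * z + 1)) (center_sqdist \<delta> V cs)) 0 n 0) (\<lambda>\<tau>.
     bind_pmf (itr (reservoir_step (\<lambda>i. min (center_sqdist \<delta> V cs i) \<tau>)) 0 n n) (\<lambda>c.
     return_pmf (if c < n then c # cs else cs)))"

text \<open>The reference solution against which seeds are judged: \<open>I\<close> are the inliers,
  and \<open>g\<close> sends each of them to a center that is itself an input point.\<close>

locale clustering =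
  fixes n z :: nat and \<delta> :: "nat \<Rightarrow> nat \<Rightarrow> real" and V :: real and I :: "nat set" and g :: "nat \<Rightarrow> nat"
  assumes \<delta>_nonneg: "0 \<le> \<delta> i j" and \<delta>_sym: "i < n \<Longrightarrow> j < n \<Longrightarrow> \<delta> i j = \<delta> j i"
    and \<delta>_triangle: "i < n \<Longrightarrow> j < n \<Longrightarrow> l < n \<Longrightarrow> \<delta> i l \<le> \<delta> i j + \<delta> j l"
    and V_nonneg: "0 \<le> V"
    and inliers: "I \<subseteq> {..<n}" "card ({..<n} - I) \<le> z"
    and g_less: "i \<in> I \<Longrightarrow> g i < n"
begin

abbreviation "D \<equiv> center_sqdist \<delta> V"

definition cluster :: "nat \<Rightarrow> nat set" where
  "cluster v = {i \<in> I. g i = v}"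

definition cluster_cost :: "nat \<Rightarrow> real" where
  "cluster_cost v = (\<Sum>i\<in>cluster v. (\<delta> i v)\<^sup>2)"

definition total_cost :: real where
  "total_cost = (\<Sum>i\<in>I. (\<delta> i (g i))\<^sup>2)"

definition bad :: "nat list \<Rightarrow> nat set" where
  "bad cs = {v \<in> g ` I. 34 * cluster_cost v < (\<Sum>i\<in>cluster v. D cs i)}"

text \<open>While this fails, the distances truncated at or above the \<open>(12 z + 1)\<close>-th
  largest one sum to more than \<open>136 * total_cost\<close>. Clusters within the threshold 34
  then hold less than a quarter of that sum.\<close>

definition covered :: "nat list \<Rightarrow> bool" where
  "covered cs \<longleftrightarrow> (\<exists>E\<subseteq>{..<n}. card E \<le> 12 * z \<and> (\<Sum>i\<in>{..<n} - E. D cs i) \<le> 136 * total_cost)"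

lemma finite_I [simp]: "finite I"
  using inliers(1) finite_subset by blast

lemma finite_cluster [simp]: "finite (cluster v)"
  by (simp add: cluster_def)

lemma finite_bad [simp]: "finite (bad cs)"
  by (simp add: bad_def)

lemma sum_clusters: "(\<Sum>v\<in>g ` I. \<Sum>i\<in>cluster v. h i) = (\<Sum>i\<in>I. h i)"
  unfolding cluster_def by (rule sum.image_gen[symmetric]) simp

lemma sum_cluster_cost: "(\<Sum>v\<in>g ` I. cluster_cost v) = total_cost"
proof -
  have "(\<Sum>v\<in>g ` I. cluster_cost v) = (\<Sum>v\<in>g ` I. \<Sum>i\<in>cluster v. (\<delta> i (g i))\<^sup>2)"
    unfolding cluster_cost_def by (intro sum.cong) (auto simp: cluster_def)
  then show ?thesis by (simp add: sum_clusters total_cost_def)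
qed

lemma cluster_cost_nonneg: "0 \<le> cluster_cost v"
  by (simp add: cluster_cost_def sum_nonneg)

lemma total_cost_nonneg: "0 \<le> total_cost"
  by (simp add: total_cost_def sum_nonneg)

lemma D_nonneg: "0 \<le> D cs i"
  by (induction cs) (auto simp: V_nonneg)

text \<open>The root of \<open>D\<close> is the minimum of a constant and of distances to fixed
  points, all of them 1-Lipschitz.\<close>

lemma D_lipschitz:
  assumes "set cs \<subseteq> {..<n}" "i < n" "j < n"
  shows "sqrt (D cs i) \<le> sqrt (D cs j) + \<delta> i j"
  using assms(1)
proof (induction cs)
  case Nil
  then show ?case by (simp add: \<delta>_nonneg)
next
  case (Cons c cs)
  have min: "sqrt (min a b) = min (sqrt a) (sqrt b)" for a b by (simp add: min_def)
  show ?case using Cons \<delta>_triangle[of i j c] assms by (auto simp: min \<delta>_nonneg)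
qed

lemma bad_antimono: "bad (c # cs) \<subseteq> bad cs"
proof -
  have "(\<Sum>i\<in>cluster v. D (c # cs) i) \<le> (\<Sum>i\<in>cluster v. D cs i)" for v
    by (intro sum_mono) auto
  then show ?thesis unfolding bad_def using order_less_le_trans by blast
qed

lemma covered_Cons:
  assumes "covered cs"
  shows "covered (c # cs)"
proof -
  obtain E where E: "E \<subseteq> {..<n}" "card E \<le> 12 * z" "(\<Sum>i\<in>{..<n} - E. D cs i) \<le> 136 * total_cost"
    using assms by (auto simp: covered_def)
  have "(\<Sum>i\<in>{..<n} - E. D (c # cs) i) \<le> (\<Sum>i\<in>{..<n} - E. D cs i)" by (intro sum_mono) auto
  then show ?thesis using E unfolding covered_def by (meson order_trans)
qed

lemma covered_if_no_bad:
  assumes "bad cs = {}"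
  shows "covered cs"
proof -
  have "(\<Sum>i\<in>I. D cs i) = (\<Sum>v\<in>g ` I. \<Sum>i\<in>cluster v. D cs i)" by (simp add: sum_clusters)
  also have "\<dots> \<le> (\<Sum>v\<in>g ` I. 34 * cluster_cost v)"
    using assms by (intro sum_mono) (force simp: bad_def)
  also have "\<dots> = 34 * total_cost" by (simp add: sum_distrib_left[symmetric] sum_cluster_cost)
  also have "\<dots> \<le> 136 * total_cost" using total_cost_nonneg by simp
  moreover have "{..<n} - ({..<n} - I) = I" using inliers by auto
  ultimately show ?thesis unfolding covered_def using inliers
    by (intro exI[of _ "{..<n} - I"]) auto
qed

text \<open>Going through the center \<open>v\<close>, a core point \<open>c\<close> serves its
  cluster at cost at most 2 + 2 * 4 = 10 times \<open>cluster_cost v\<close>, well below the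
  threshold 34. No other cluster can become bad.\<close>

lemma card_bad_less:
  assumes v: "v \<in> bad cs" and c: "c \<in> cluster v"
    and core: "(\<delta> c v)\<^sup>2 * real (card (cluster v)) \<le> 4 * cluster_cost v"
  shows "card (bad (c # cs)) < card (bad cs)"
proof -
  have less: "i < n" if "i \<in> cluster v" for i using that inliers by (auto simp: cluster_def)
  have "v < n" using v g_less by (auto simp: bad_def)
  have "D (c # cs) i \<le> 2 * (\<delta> i v)\<^sup>2 + 2 * (\<delta> c v)\<^sup>2" if "i \<in> cluster v" for i
  proof -
    have "\<delta> i c \<le> \<delta> i v + \<delta> c v"
      using \<delta>_triangle[of i v c] less that c \<open>v < n\<close> \<delta>_sym[of v c] by auto
    then have "(\<delta> i c)\<^sup>2 \<le> (\<delta> i v + \<delta> c v)\<^sup>2" by (intro power_mono \<delta>_nonneg)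
    then show ?thesis using power2_sum_le[of "\<delta> i v" "\<delta> c v"] by simp
  qed
  then have "(\<Sum>i\<in>cluster v. D (c # cs) i) \<le> (\<Sum>i\<in>cluster v. 2 * (\<delta> i v)\<^sup>2 + 2 * (\<delta> c v)\<^sup>2)"
    by (intro sum_mono)
  also have "\<dots> = 2 * cluster_cost v + 2 * ((\<delta> c v)\<^sup>2 * real (card (cluster v)))"
    by (simp add: sum.distrib sum_distrib_left[symmetric] cluster_cost_def)
  also have "\<dots> \<le> 34 * cluster_cost v" using core cluster_cost_nonneg[of v] by linarith
  finally have "v \<notin> bad (c # cs)" by (simp add: bad_def)
  then show ?thesis using v bad_antimono[of c cs] by (intro psubset_card_mono) auto
qed

text \<open>\<open>lo \<le> \<tau>\<close> leaves all but \<open>12 z\<close> points untruncated,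
  which bounds the mass from below by the cost. \<open>\<tau> \<le> hi\<close> makes more than
  \<open>4 z\<close> points reach the level, which bounds the outliers' share. Half of the mass
  remains for expensive clusters, and 3/34 of it lies in their cores.\<close>

lemma reservoir_hits_core:
  assumes cs: "set cs \<subseteq> {..<n}" and nc: "\<not> covered cs"
    and lo: "0 \<le> lo" "card {j. j < n \<and> lo < D cs j} \<le> 12 * z"
    and hi: "4 * z < card {j. j < n \<and> hi \<le> D cs j}"
    and \<tau>: "lo \<le> \<tau>" "\<tau> \<le> hi"
  shows "3 / 68 \<le> measure_pmf.prob (itr (reservoir_step (\<lambda>i. min (D cs i) \<tau>)) 0 n n)
                     {c. c < n \<and> card (bad (c # cs)) < card (bad cs)}"
proof -
  define u where "u i = min (D cs i) \<tau>" for i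
  define W where "W = (\<Sum>i<n. u i)"
  have u0: "0 \<le> u i" for i using D_nonneg lo \<tau> by (simp add: u_def)
  have "136 * total_cost < (\<Sum>i\<in>{..<n} - {j. j < n \<and> lo < D cs j}. D cs i)"
  proof (rule ccontr)
    assume "\<not> ?thesis"
    then have "covered cs" unfolding covered_def using lo(2)
      by (intro exI[of _ "{j. j < n \<and> lo < D cs j}"]) auto
    then show False using nc by simp
  qed
  also have "\<dots> = (\<Sum>i\<in>{..<n} - {j. j < n \<and> lo < D cs j}. u i)"
    using \<tau> by (intro sum.cong) (auto simp: u_def)
  also have "\<dots> \<le> W" unfolding W_def using u0 by (intro sum_mono2) auto
  finally have W_cost: "136 * total_cost < W" .
  then have W0: "0 < W" using total_cost_nonneg by linarith
  have "real (4 * z) * \<tau> \<le> real (card {j. j < n \<and> hi \<le> D cs j}) * \<tau>"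
    using hi lo \<tau> by (intro mult_right_mono) auto
  also have "\<dots> \<le> (\<Sum>i | i < n \<and> hi \<le> D cs i. u i)"
    unfolding sum_constant[symmetric] using \<tau> by (intro sum_mono) (auto simp: u_def)
  also have "\<dots> \<le> W" unfolding W_def using u0 by (intro sum_mono2) auto
  finally have W_z: "4 * (real z * \<tau>) \<le> W" by simp
  have "(\<Sum>i\<in>{..<n} - I. u i) \<le> real (card ({..<n} - I)) * \<tau>"
    unfolding sum_constant[symmetric] by (intro sum_mono) (simp add: u_def)
  also have "\<dots> \<le> real z * \<tau>" using inliers lo \<tau> by (intro mult_right_mono) auto
  finally have out: "(\<Sum>i\<in>{..<n} - I. u i) \<le> W / 4" using W_z by simp
  have "W = (\<Sum>i\<in>I. u i) + (\<Sum>i\<in>{..<n} - I. u i)"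
    unfolding W_def using inliers by (subst sum.subset_diff[of I]) auto
  with out have inl: "3 / 4 * W \<le> (\<Sum>i\<in>I. u i)" by simp
  \<comment> \<open>Expensive is measured in truncated distances here, so that the shares of the
    sampled mass can be compared. As truncation only lowers distances, \<open>H\<close> consists of
    bad clusters.\<close>
  define H where "H = {v \<in> g ` I. 34 * cluster_cost v < (\<Sum>i\<in>cluster v. u i)}"
  have H: "H \<subseteq> g ` I" "finite H" by (auto simp: H_def)
  have "(\<Sum>v\<in>g ` I - H. \<Sum>i\<in>cluster v. u i) \<le> (\<Sum>v\<in>g ` I - H. 34 * cluster_cost v)"
    by (intro sum_mono) (auto simp: H_def)
  also have "\<dots> \<le> (\<Sum>v\<in>g ` I. 34 * cluster_cost v)"
    using cluster_cost_nonneg by (intro sum_mono2) auto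
  also have "\<dots> = 34 * total_cost" by (simp add: sum_distrib_left[symmetric] sum_cluster_cost)
  finally have "(\<Sum>v\<in>g ` I - H. \<Sum>i\<in>cluster v. u i) \<le> W / 4" using W_cost by simp
  moreover have "(\<Sum>i\<in>I. u i) = (\<Sum>v\<in>H. \<Sum>i\<in>cluster v. u i) + (\<Sum>v\<in>g ` I - H. \<Sum>i\<in>cluster v. u i)"
    unfolding sum_clusters[symmetric] using H by (subst sum.subset_diff[of H]) auto
  ultimately have H_half: "W / 2 \<le> (\<Sum>v\<in>H. \<Sum>i\<in>cluster v. u i)" using inl by simp
  define core where "core v = {i \<in> cluster v. (\<delta> i v)\<^sup>2 * real (card (cluster v)) \<le> 4 * cluster_cost v}" for v
  have share: "3 / 34 * (\<Sum>i\<in>cluster v. u i) \<le> (\<Sum>i\<in>core v. u i)" if v: "v \<in> H" for v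
  proof -
    have vn: "v < n" using v g_less by (auto simp: H_def)
    have less: "i < n" if "i \<in> cluster v" for i using that inliers by (auto simp: cluster_def)
    have sq: "(sqrt (u i))\<^sup>2 = u i" for i using u0 by simp
    have min: "sqrt (min a b) = min (sqrt a) (sqrt b)" for a b by (simp add: min_def)
    \<comment> \<open>Truncation at a constant preserves the Lipschitz property, so
      \<open>core_share\<close> applies to \<open>u\<close> in place of \<open>D cs\<close>.\<close>
    have lip: "sqrt (u i) \<le> sqrt (u j) + \<delta> i j" if "i < n" "j < n" for i j
      using D_lipschitz[OF cs that] \<delta>_nonneg[of i j] by (auto simp: u_def min)
    have "3 / 34 * (\<Sum>i\<in>cluster v. (sqrt (u i))\<^sup>2)
       \<le> (\<Sum>i | i \<in> cluster v \<and> (\<delta> i v)\<^sup>2 * real (card (cluster v)) \<le> 4 * (\<Sum>i\<in>cluster v. (\<delta> i v)\<^sup>2).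
            (sqrt (u i))\<^sup>2)"
    proof (rule core_share[where v = "sqrt (u v)"])
      show "34 * (\<Sum>i\<in>cluster v. (\<delta> i v)\<^sup>2) < (\<Sum>i\<in>cluster v. (sqrt (u i))\<^sup>2)"
        using v by (simp add: sq H_def cluster_cost_def)
      show "sqrt (u v) \<le> sqrt (u i) + \<delta> i v" if "i \<in> cluster v" for i
        using lip[of v i] vn less that \<delta>_sym[of i v] by simp
    qed (use lip vn less u0 \<delta>_nonneg in auto)
    then show ?thesis by (simp add: sq core_def cluster_cost_def)
  qed
  define G where "G = (\<Union>v\<in>H. core v)"
  have "3 / 68 * W \<le> 3 / 34 * (\<Sum>v\<in>H. \<Sum>i\<in>cluster v. u i)" using H_half by simp
  also have "\<dots> \<le> (\<Sum>v\<in>H. \<Sum>i\<in>core v. u i)"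
    unfolding sum_distrib_left[of _ _ H] using share by (intro sum_mono)
  also have "\<dots> = (\<Sum>i\<in>G. u i)"
    unfolding G_def using H(2)
    by (intro sum.UNION_disjoint[symmetric]) (auto simp: core_def cluster_def)
  finally have G_W: "3 / 68 * W \<le> (\<Sum>i\<in>G. u i)" .
  have Gn: "G \<subseteq> {..<n}" using inliers by (auto simp: G_def core_def cluster_def)
  have G_sub: "G \<subseteq> {c. c < n \<and> card (bad (c # cs)) < card (bad cs)}"
  proof
    fix c assume c: "c \<in> G"
    then obtain v where v: "v \<in> H" "c \<in> core v" by (auto simp: G_def)
    have "(\<Sum>i\<in>cluster v. u i) \<le> (\<Sum>i\<in>cluster v. D cs i)" by (intro sum_mono) (simp add: u_def)
    then have "v \<in> bad cs" using v by (auto simp: H_def bad_def)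
    then show "c \<in> {c. c < n \<and> card (bad (c # cs)) < card (bad cs)}"
      using v c Gn card_bad_less by (auto simp: core_def)
  qed
  have "3 / 68 \<le> (\<Sum>i\<in>G. u i) / W" using G_W W0 by (simp add: field_simps)
  also have "\<dots> = measure_pmf.prob (itr (reservoir_step u) 0 n n) G"
    unfolding W_def using u0 W0 Gn by (subst prob_itr_reservoir_step) (auto simp: W_def)
  also have "\<dots> \<le> measure_pmf.prob (itr (reservoir_step u) 0 n n)
      {c. c < n \<and> card (bad (c # cs)) < card (bad cs)}"
    using G_sub by (intro measure_pmf.finite_measure_mono) auto
  finally show ?thesis by (simp add: u_def[abs_def])
qed

text \<open>\<open>D cs i\<close> and \<open>D cs l\<close> are the \<open>(4 z + 1)\<close>-th and
  \<open>(12 z + 1)\<close>-th largest distances. The level falls between them if the sample misses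
  the at most \<open>4 z\<close> points above the first but hits one of the more than
  \<open>12 z\<close> points from the second upwards. With \<open>r = 1 / (8 z + 1)\<close> this has
  probability at least \<open>(1 - r)^(4 z) * (1 - (1 - r)^(8 z + 1))\<close>, which is at least
  1/4.\<close>

lemma seed_round_progress:
  assumes cs: "set cs \<subseteq> {..<n}" and nc: "\<not> covered cs"
  shows "3 / 272 \<le> measure_pmf.prob (seed_round n z \<delta> V cs) {cs'. card (bad cs') < card (bad cs)}"
proof -
  define r where "r = 1 / real (8 * z + 1)"
  have r: "0 \<le> r" "r \<le> 1" by (auto simp: r_def)
  \<comment> \<open>With at most \<open>12 z\<close> points, discarding all of them would already be
    a covering; hence both quantiles exist.\<close>
  have n: "12 * z < n"
  proof (rule ccontr)
    assume "\<not> 12 * z < n"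
    then have "covered cs" unfolding covered_def using total_cost_nonneg
      by (intro exI[of _ "{..<n}"]) auto
    then show False using nc by simp
  qed
  obtain i where i: "card {j. j < n \<and> D cs i < D cs j} \<le> 4 * z" "4 * z < card {j. j < n \<and> D cs i \<le> D cs j}"
    using ex_quantile[of "4 * z" n "D cs"] n by auto
  obtain l where l: "card {j. j < n \<and> D cs l < D cs j} \<le> 12 * z" "12 * z < card {j. j < n \<and> D cs l \<le> D cs j}"
    using ex_quantile[of "12 * z" n "D cs"] n by auto
  let ?T = "itr (max_step r (D cs)) 0 n 0"
  have "(1 - r) ^ (4 * z) \<le> measure_pmf.prob ?T {..D cs i}"
  proof -
    have "(1 - r) ^ (4 * z) \<le> (1 - r) ^ card {j. j < n \<and> D cs j \<notin> {..D cs i}}"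
      using r i by (intro power_decreasing) (auto simp: not_le)
    also have "\<dots> = measure_pmf.prob ?T {..D cs i}"
      using r D_nonneg by (intro prob_itr_max_step[symmetric]) auto
    finally show ?thesis .
  qed
  moreover have "measure_pmf.prob ?T {..<D cs l} \<le> (1 - r) ^ (12 * z + 1)"
  \<comment> \<open>For \<open>D cs l = 0\<close> the start value 0 is outside the set, so
    \<open>prob_itr_max_step\<close> does not apply; the level is never negative, and the
    probability is 0.\<close>
  proof (cases "D cs l = 0")
    case True
    have "measure_pmf.prob ?T {..<D cs l} \<le> measure_pmf.prob ?T {}"
    proof (rule measure_pmf.finite_measure_mono_AE)
      have "set_pmf (itr (max_step r (D cs)) 0 m 0) \<subseteq> {0..}" for m
      proof (induction m)
        case (Suc m)
        have "set_pmf (max_step r (D cs) m x) \<subseteq> {D cs m, x}" for x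
          by (auto simp: max_step_def)
        then show ?case unfolding itr_Suc_last set_bind_pmf using Suc D_nonneg[of cs m] by fastforce
      qed simp
      then show "AE x in ?T. x \<in> {..<D cs l} \<longrightarrow> x \<in> {}"
        using True by (auto simp: AE_measure_pmf_iff subset_iff not_less)
    qed simp
    also have "\<dots> \<le> (1 - r) ^ (12 * z + 1)" using r by (simp only: measure_empty) (rule zero_le_power, simp)
    finally show ?thesis .
  next
    case False
    then have "0 < D cs l" using D_nonneg[of cs l] by simp
    then have "measure_pmf.prob ?T {..<D cs l} = (1 - r) ^ card {j. j < n \<and> D cs j \<notin> {..<D cs l}}"
      using r by (intro prob_itr_max_step) auto
    also have "\<dots> \<le> (1 - r) ^ (12 * z + 1)"
      using r l by (intro power_decreasing) (auto simp: not_less)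
    finally show ?thesis .
  qed
  moreover have "measure_pmf.prob ?T {..D cs i} \<le> measure_pmf.prob ?T {D cs l..D cs i} + measure_pmf.prob ?T {..<D cs l}"
    by (rule order_trans[OF _ measure_Un_le]) (auto intro!: measure_pmf.finite_measure_mono)
  ultimately have "(1 - r) ^ (4 * z) - (1 - r) ^ (12 * z + 1) \<le> measure_pmf.prob ?T {D cs l..D cs i}"
    by linarith
  moreover have "1 / 4 \<le> (1 - r) ^ (4 * z) - (1 - r) ^ (12 * z + 1)"
  proof -
    have "1 / 2 \<le> 1 + real (4 * z) * (- r)" by (simp add: r_def field_simps)
    also have "\<dots> \<le> (1 + (- r)) ^ (4 * z)" using r by (intro Bernoulli_inequality) auto
    finally have a: "1 / 2 \<le> (1 - r) ^ (4 * z)" by simp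
    \<comment> \<open>Bernoulli's inequality only bounds powers from below. Since
      \<open>(1 - r) * (1 + r) \<le> 1\<close>, a lower bound for the power of \<open>1 + r\<close>
      yields an upper bound for that of \<open>1 - r\<close>.\<close>
    have "1 + real (8 * z + 1) * r \<le> (1 + r) ^ (8 * z + 1)"
      using r by (intro Bernoulli_inequality) auto
    then have "2 \<le> (1 + r) ^ (8 * z + 1)" by (simp add: r_def field_simps)
    then have "(1 - r) ^ (8 * z + 1) * 2 \<le> (1 - r) ^ (8 * z + 1) * (1 + r) ^ (8 * z + 1)"
      using r by (intro mult_left_mono) auto
    also have "\<dots> = (1 - r\<^sup>2) ^ (8 * z + 1)"
      by (simp only: power_mult_distrib[symmetric]) (simp add: algebra_simps power2_eq_square)
    also have "\<dots> \<le> 1" using r by (intro power_le_one) (auto simp: power_le_one)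
    finally have b: "(1 - r) ^ (8 * z + 1) \<le> 1 / 2" by simp
    have "(1 / 2) * (1 / 2) \<le> (1 - r) ^ (4 * z) * (1 - (1 - r) ^ (8 * z + 1))"
      using a b by (intro mult_mono) auto
    also have "\<dots> = (1 - r) ^ (4 * z) - (1 - r) ^ (12 * z + 1)"
      by (simp add: right_diff_distrib flip: power_add)
    finally show ?thesis by simp
  qed
  ultimately have "1 / 4 \<le> measure_pmf.prob ?T {D cs l..D cs i}" by linarith
  then have "3 / 272 \<le> measure_pmf.prob ?T {D cs l..D cs i} * (3 / 68)" by simp
  also have "\<dots> \<le> measure_pmf.prob (seed_round n z \<delta> V cs) {cs'. card (bad cs') < card (bad cs)}"
    unfolding seed_round_def r_def[symmetric]
  proof (rule prob_bind_pmf_ge)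
    fix \<tau> assume \<tau>: "\<tau> \<in> {D cs l..D cs i}"
    let ?G = "{c. c < n \<and> card (bad (c # cs)) < card (bad cs)}"
    have "3 / 68 \<le> measure_pmf.prob (itr (reservoir_step (\<lambda>i. min (D cs i) \<tau>)) 0 n n) ?G * 1"
      using reservoir_hits_core[OF cs nc D_nonneg l(1) i(2)] \<tau> by simp
    also have "\<dots> \<le> measure_pmf.prob (bind_pmf (itr (reservoir_step (\<lambda>i. min (D cs i) \<tau>)) 0 n n)
        (\<lambda>c. return_pmf (if c < n then c # cs else cs))) {cs'. card (bad cs') < card (bad cs)}"
      by (rule prob_bind_pmf_ge) (auto simp: indicator_def)
    finally show "3 / 68 \<le> measure_pmf.prob (bind_pmf (itr (reservoir_step (\<lambda>i. min (D cs i) \<tau>)) 0 n n)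
        (\<lambda>c. return_pmf (if c < n then c # cs else cs))) {cs'. card (bad cs') < card (bad cs)}" .
  qed
  finally show ?thesis .
qed

lemma seed_round_support:
  assumes "cs' \<in> set_pmf (seed_round n z \<delta> V cs)"
  obtains "cs' = cs" | c where "c < n" "cs' = c # cs"
  using assms by (auto simp: seed_round_def split: if_splits)

lemma prob_seeding:
  defines "M \<equiv> \<lambda>R. itr (\<lambda>_. seed_round n z \<delta> V) 0 R []"
  shows prob_seeding_long: "544 * card (g ` I) \<le> R \<Longrightarrow> 1 / 2 \<le> measure_pmf.prob (M R) {cs. covered cs}"
    and prob_seeding_short: "card (g ` I) \<le> R \<Longrightarrow>
      (3 / 272) ^ card (g ` I) \<le> measure_pmf.prob (M R) {cs. covered cs}"
proof -
  \<comment> \<open>Lists with invalid indices count as \<open>ok\<close>, so that progress holds at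
    every other list without a side invariant. They are never reached, so the probability is
    unaffected.\<close>
  define ok where "ok cs \<longleftrightarrow> covered cs \<or> \<not> set cs \<subseteq> {..<n}" for cs
  let ?f = "seed_round n z \<delta> V" and ?b = "\<lambda>cs. card (bad cs)"
  have stuck: "ok cs'" if "ok cs" "cs' \<in> set_pmf (?f cs)" for cs cs'
    using that(2) by (cases rule: seed_round_support) (use that(1) covered_Cons in \<open>auto simp: ok_def\<close>)
  have mono: "?b cs' \<le> ?b cs" if "cs' \<in> set_pmf (?f cs)" for cs cs'
    using that by (cases rule: seed_round_support) (auto intro: card_mono[OF finite_bad bad_antimono])
  have zero: "ok cs" if "?b cs = 0" for cs
    using that covered_if_no_bad by (auto simp: ok_def)
  have prog: "3 / 272 \<le> measure_pmf.prob (?f cs) {cs'. ?b cs' < ?b cs}" if "\<not> ok cs" for cs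
    using that seed_round_progress by (auto simp: ok_def)
  have "set_pmf (M R) \<subseteq> {cs. set cs \<subseteq> {..<n}}" for R
    unfolding M_def
    by (rule prob_itr_stuck) (auto elim!: seed_round_support)
  then have ok: "measure_pmf.prob (M R) {cs. covered cs} = measure_pmf.prob (M R) {cs. ok cs}" for R
    by (intro measure_pmf.finite_measure_eq_AE) (auto simp: AE_measure_pmf_iff ok_def)
  have short: "(3 / 272) ^ ?b [] \<le> measure_pmf.prob (M R) {cs. covered cs}" if "?b [] \<le> R" for R
    unfolding ok unfolding M_def by (rule prob_itr_success) (use stuck zero prog that in simp_all)
  have b_le: "?b [] \<le> card (g ` I)" by (intro card_mono) (auto simp: bad_def)
  show "(3 / 272) ^ card (g ` I) \<le> measure_pmf.prob (M R) {cs. covered cs}" if "card (g ` I) \<le> R"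
  proof -
    have "(3 / 272 :: real) ^ card (g ` I) \<le> (3 / 272) ^ ?b []" using b_le by (intro power_decreasing) auto
    also have "\<dots> \<le> measure_pmf.prob (M R) {cs. covered cs}" using b_le that by (intro short) simp
    finally show ?thesis .
  qed
  show "1 / 2 \<le> measure_pmf.prob (M R) {cs. covered cs}" if R: "544 * card (g ` I) \<le> R"
  proof (cases "?b [] = 0")
    case True
    then show ?thesis using short[of R] by simp
  next
    case False
    \<comment> \<open>\<open>x = 1 - 3 / 544\<close>, with half of the progress probability 3/272.
      As \<open>(1 + 3 / 544) ^ 544 \<ge> 4\<close>, a batch of 544 rounds beats the factor 2 per
      bad cluster in the potential.\<close>
    define x :: real where "x = 541 / 544"
    have x: "0 \<le> x" "x \<le> 1" by (auto simp: x_def)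
    have "x ^ 544 * 4 \<le> x ^ 544 * (1 + 3 / 544) ^ 544"
      using Bernoulli_inequality[of "3 / 544" 544] x by (intro mult_left_mono) auto
    also have "\<dots> = (x * (1 + 3 / 544)) ^ 544" by (simp only: power_mult_distrib)
    also have "\<dots> \<le> 1" by (intro power_le_one) (auto simp: x_def)
    finally have x4: "x ^ 544 \<le> 1 / 4" by simp
    have "measure_pmf.prob (M R) {cs. \<not> ok cs} \<le> 2 ^ ?b [] * (1 - 3 / 272 / 2) ^ R"
      unfolding M_def by (rule prob_itr_fail) (use stuck mono prog in simp_all)
    also have "\<dots> = 2 ^ ?b [] * x ^ R" by (simp add: x_def)
    also have "\<dots> \<le> 2 ^ ?b [] * x ^ (544 * ?b [])"
      using x b_le R by (intro mult_left_mono power_decreasing) auto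
    also have "\<dots> = (2 * x ^ 544) ^ ?b []" by (simp only: power_mult power_mult_distrib)
    also have "\<dots> \<le> (1 / 2) ^ ?b []" using x4 x by (intro power_mono) auto
    also have "\<dots> \<le> (1 / 2) ^ 1" using False by (intro power_decreasing) linarith+
    finally have "measure_pmf.prob (M R) {cs. \<not> ok cs} \<le> 1 / 2" by simp
    moreover have "measure_pmf.prob (M R) {cs. \<not> ok cs} = 1 - measure_pmf.prob (M R) {cs. ok cs}"
      using measure_pmf.prob_compl[of "{cs. ok cs}" "M R"] by (simp add: Compl_eq_Diff_UNIV[symmetric] Collect_neg_eq)
    ultimately show ?thesis using ok[of R] by simp
  qed
qed

end

section \<open>Clustering costs\<close>

lemma pdist_power2: "length x = d \<Longrightarrow> (pdist x y)\<^sup>2 = (\<Sum>l<d. (x ! l - y ! l)\<^sup>2)"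
  by (simp add: pdist_def L2_set_def sum_nonneg)

lemma pdist_nonneg [simp]: "0 \<le> pdist x y"
  by (simp add: pdist_def L2_set_nonneg)

lemma pdist_commute: "length x = length y \<Longrightarrow> pdist x y = pdist y x"
  by (simp add: pdist_def L2_set_def power2_commute)

lemma pdist_triangle:
  assumes "length x = d" "length y = d" "length v = d"
  shows "pdist x v \<le> pdist x y + pdist y v"
  using L2_set_triangle_ineq[of "\<lambda>i. x ! i - y ! i" "\<lambda>i. y ! i - v ! i" "{..<d}"] assms
  by (simp add: pdist_def)

lemma sdist_le: "finite C \<Longrightarrow> c \<in> C \<Longrightarrow> sdist x C \<le> pdist x c"
  by (simp add: sdist_def)

lemma sdist_attained:
  assumes "finite C" "C \<noteq> {}"
  obtains c where "c \<in> C" "sdist x C = pdist x c"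
proof -
  have "Min (pdist x ` C) \<in> pdist x ` C" using assms by (intro Min_in) auto
  then show ?thesis using that by (auto simp: sdist_def)
qed

lemma sdist_nonneg: "finite C \<Longrightarrow> C \<noteq> {} \<Longrightarrow> 0 \<le> sdist x C"
  by (metis sdist_attained pdist_nonneg)

lemma sdist_triangle:
  assumes "finite C" "C \<noteq> {}" "C \<subseteq> points d" "length x = d" "length y = d"
  shows "sdist x C \<le> pdist x y + sdist y C"
proof -
  obtain c where c: "c \<in> C" "sdist y C = pdist y c" using sdist_attained assms by blast
  have "sdist x C \<le> pdist x c" using assms c by (intro sdist_le)
  also have "\<dots> \<le> pdist x y + pdist y c"
    using assms c by (intro pdist_triangle) (auto simp: points_def)
  finally show ?thesis using c by simp
qed

lemma center_setsD:
  assumes "C \<in> center_sets d k" "1 \<le> k"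
  shows "finite C" "C \<noteq> {}" "C \<subseteq> points d"
  using assms by (auto simp: center_sets_def)

lemma ex_smallest_subset:
  fixes h :: "'a \<Rightarrow> real"
  assumes "finite X" "m \<le> card X"
  shows "\<exists>Y\<subseteq>X. card Y = m \<and> (\<forall>y\<in>Y. \<forall>x\<in>X - Y. h y \<le> h x)"
  using assms(2)
proof (induction m)
  case 0
  show ?case by (rule exI[of _ "{}"]) simp
next
  case (Suc m)
  then obtain Y where Y: "Y \<subseteq> X" "card Y = m" "\<forall>y\<in>Y. \<forall>x\<in>X - Y. h y \<le> h x" by auto
  have fin: "finite Y" using Y(1) assms(1) finite_subset by blast
  have "X - Y \<noteq> {}" using Suc.prems Y fin by (metis Diff_eq_empty_iff card_mono not_less_eq_eq)
  then obtain a where a: "a \<in> X - Y" "\<forall>x\<in>X - Y. h a \<le> h x"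
    using assms(1) ex_min_if_finite[of "h ` (X - Y)"] by (auto simp: not_less)
  show ?case
    by (rule exI[of _ "insert a Y"]) (use Y a fin in auto)
qed

lemma nearest_props:
  assumes "finite X"
  shows "nearest X t C \<subseteq> X" "card (nearest X t C) = card X - t"
    "\<And>y x. y \<in> nearest X t C \<Longrightarrow> x \<in> X - nearest X t C \<Longrightarrow> sdist y C \<le> sdist x C"
proof -
  have "\<exists>Y. Y \<subseteq> X \<and> card Y = card X - t \<and> (\<forall>y\<in>Y. \<forall>x\<in>X - Y. sdist y C \<le> sdist x C)"
    using ex_smallest_subset[OF assms, of "card X - t" "\<lambda>x. sdist x C"] by auto
  from someI_ex[OF this] show "nearest X t C \<subseteq> X" "card (nearest X t C) = card X - t"
    "\<And>y x. y \<in> nearest X t C \<Longrightarrow> x \<in> X - nearest X t C \<Longrightarrow> sdist y C \<le> sdist x C"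
    unfolding nearest_def by blast+
qed

text \<open>An exchange argument: \<open>F\<close> is at least as large as the set \<open>Y\<close>
  of nearest points, so \<open>Y - F\<close> injects into \<open>F - Y\<close>, and points outside
  \<open>Y\<close> are at least as far from \<open>C\<close> as those inside.\<close>

lemma kcost_le:
  assumes X: "finite X" and C: "finite C" "C \<noteq> {}" and E: "card (X - F) \<le> t" "F \<subseteq> X"
  shows "kcost X t C \<le> (\<Sum>x\<in>F. (sdist x C)\<^sup>2)"
proof -
  define Y where "Y = nearest X t C"
  note Y = nearest_props[OF X, where t = t and C = C, folded Y_def]
  have fin: "finite Y" "finite F" using Y(1) E(2) X finite_subset by blast+
  have "card F = card X - card (X - F)" using E(2) X by (simp add: card_Diff_subset fin card_mono)
  then have "card Y \<le> card F" using Y(2) E by simp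
  then have "card (Y - F) \<le> card (F - Y)"
    using fin by (metis card_le_sym_Diff)
  then obtain f where f: "f ` (Y - F) \<subseteq> F - Y" "inj_on f (Y - F)"
    using card_le_inj[of "Y - F" "F - Y"] fin by auto
  have "(\<Sum>x\<in>Y - F. (sdist x C)\<^sup>2) \<le> (\<Sum>x\<in>Y - F. (sdist (f x) C)\<^sup>2)"
  proof (intro sum_mono power_mono)
    fix x assume x: "x \<in> Y - F"
    then have "f x \<in> X - Y" using f(1) E(2) by blast
    then show "sdist x C \<le> sdist (f x) C" using x Y(3) by blast
  qed (rule sdist_nonneg[OF C])
  also have "\<dots> = (\<Sum>x\<in>f ` (Y - F). (sdist x C)\<^sup>2)" using f(2) by (simp add: sum.reindex)
  also have "\<dots> \<le> (\<Sum>x\<in>F - Y. (sdist x C)\<^sup>2)" using f(1) fin by (intro sum_mono2) auto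
  finally have "(\<Sum>x\<in>Y - F. (sdist x C)\<^sup>2) \<le> (\<Sum>x\<in>F - Y. (sdist x C)\<^sup>2)" .
  moreover have "(\<Sum>x\<in>Y. (sdist x C)\<^sup>2) = (\<Sum>x\<in>Y \<inter> F. (sdist x C)\<^sup>2) + (\<Sum>x\<in>Y - F. (sdist x C)\<^sup>2)"
    using fin by (metis sum.Int_Diff)
  moreover have "(\<Sum>x\<in>F. (sdist x C)\<^sup>2) = (\<Sum>x\<in>Y \<inter> F. (sdist x C)\<^sup>2) + (\<Sum>x\<in>F - Y. (sdist x C)\<^sup>2)"
    using fin by (metis sum.Int_Diff Int_commute)
  ultimately show ?thesis by (simp add: kcost_def Y_def)
qed

text \<open>Exactly \<open>k\<close> distinct centers are required while a clustering may use fewer;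
  in positive dimension there are always points left to fill up.\<close>

lemma ex_center_superset:
  assumes "1 \<le> d" "finite C0" "C0 \<subseteq> points d" "card C0 \<le> k"
  obtains C where "C \<in> center_sets d k" "C0 \<subseteq> C"
proof -
  have "infinite (points d)"
  proof
    assume "finite (points d)"
    moreover have "range (\<lambda>a::real. a # replicate (d - 1) 0) \<subseteq> points d"
      using assms(1) by (auto simp: points_def)
    ultimately have "finite (range (\<lambda>a::real. a # replicate (d - 1) 0))" using finite_subset by blast
    then have "finite (UNIV :: real set)" by (rule finite_imageD) (simp add: inj_on_def)
    then show False using infinite_UNIV_char_0 by blast
  qed
  then have "infinite (points d - C0)" using assms(2) by simp
  then obtain T where T: "T \<subseteq> points d - C0" "finite T" "card T = k - card C0"
    using infinite_arbitrarily_large by metis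
  have "card (C0 \<union> T) = k" using T assms by (subst card_Un_disjoint) auto
  then have "C0 \<union> T \<in> center_sets d k" using T assms by (auto simp: center_sets_def)
  then show ?thesis using that by blast
qed

lemma wOpt_le:
  assumes "C \<in> center_sets d k" "\<And>x. x \<in> P \<Longrightarrow> 0 \<le> w x"
  shows "wOpt d w P k \<le> wcost w P C"
  unfolding wOpt_def using assms
  by (intro cINF_lower bdd_belowI2[where m = 0]) (auto simp: wcost_def intro!: sum_nonneg)

lemma wOpt_nonneg:
  assumes "1 \<le> d" "\<And>x. x \<in> P \<Longrightarrow> 0 \<le> w x"
  shows "0 \<le> wOpt d w P k"
proof -
  obtain C where "C \<in> center_sets d k" using ex_center_superset[OF assms(1), of "{}" k] by auto
  then show ?thesis unfolding wOpt_def using assms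
    by (intro cINF_greatest) (auto simp: wcost_def intro!: sum_nonneg)
qed

text \<open>Each center is moved to the nearest inlier of its own cluster. This at most doubles
  every distance, hence the factor 4. The extensional function space makes the possible pairs
  \<open>(I, g)\<close> finite in number.\<close>

lemma ex_discrete_clustering_of_centers:
  fixes xs :: "point list"
  defines "n \<equiv> length xs"
  assumes xs: "distinct xs" "set xs \<subseteq> points d" and C: "C \<in> center_sets d k" "1 \<le> k"
  shows "\<exists>I g. I \<subseteq> {..<n} \<and> g \<in> I \<rightarrow>\<^sub>E {..<n} \<and> card ({..<n} - I) \<le> z \<and> card (g ` I) \<le> k \<and>
    (\<Sum>i\<in>I. (pdist (xs ! i) (xs ! g i))\<^sup>2) \<le> 4 * kcost (set xs) z C"
proof -
  note CD = center_setsD[OF C]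
  define Y where "Y = nearest (set xs) z C"
  define I where "I = {i. i < n \<and> xs ! i \<in> Y}"
  note Y = nearest_props[where X = "set xs", OF finite_set, where t = z and C = C, folded Y_def]
  have fin: "finite I" by (simp add: I_def)
  have bij: "bij_betw ((!) xs) {..<n} (set xs)"
    using xs(1) by (intro bij_betw_nth) (auto simp: n_def)
  have img: "(!) xs ` I = Y"
    using Y(1) by (auto simp: I_def n_def in_set_conv_nth subset_iff image_iff)
  have inj: "inj_on ((!) xs) I"
    using bij by (auto simp: bij_betw_def I_def intro: inj_on_subset)
  have "card I = card Y" using card_image[OF inj] img by simp
  then have cardI: "card ({..<n} - I) \<le> z"
    using Y(2) xs(1) fin by (subst card_Diff_subset) (auto simp: I_def n_def distinct_card)
  define \<phi> where "\<phi> i = (SOME c. c \<in> C \<and> sdist (xs ! i) C = pdist (xs ! i) c)" for i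
  have \<phi>: "\<phi> i \<in> C" "sdist (xs ! i) C = pdist (xs ! i) (\<phi> i)" for i
  proof -
    have "\<exists>c. c \<in> C \<and> sdist (xs ! i) C = pdist (xs ! i) c"
      using sdist_attained[OF CD(1,2), of "xs ! i"] by metis
    from someI_ex[OF this] show "\<phi> i \<in> C" "sdist (xs ! i) C = pdist (xs ! i) (\<phi> i)"
      by (auto simp: \<phi>_def)
  qed
  define rep where "rep c = (SOME j. j \<in> I \<and> \<phi> j = c \<and> (\<forall>i\<in>I. \<phi> i = c \<longrightarrow> pdist (xs ! j) c \<le> pdist (xs ! i) c))" for c
  have rep: "rep (\<phi> i) \<in> I \<and> \<phi> (rep (\<phi> i)) = \<phi> i \<and> pdist (xs ! rep (\<phi> i)) (\<phi> i) \<le> pdist (xs ! i) (\<phi> i)"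
    if i: "i \<in> I" for i
  proof -
    have "\<exists>j. j \<in> I \<and> \<phi> j = \<phi> i \<and> (\<forall>i'\<in>I. \<phi> i' = \<phi> i \<longrightarrow> pdist (xs ! j) (\<phi> i) \<le> pdist (xs ! i') (\<phi> i))"
    proof -
      let ?S = "{j \<in> I. \<phi> j = \<phi> i}"
      have "finite ((\<lambda>j. pdist (xs ! j) (\<phi> i)) ` ?S)" "(\<lambda>j. pdist (xs ! j) (\<phi> i)) ` ?S \<noteq> {}"
        using i fin by auto
      from ex_min_if_finite[OF this] show ?thesis by (force simp: not_less)
    qed
    from someI_ex[OF this] show ?thesis using i unfolding rep_def by blast
  qed
  define g where "g = restrict (\<lambda>i. rep (\<phi> i)) I"
  have "g ` I \<subseteq> rep ` C" using \<phi> by (auto simp: g_def)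
  then have "card (g ` I) \<le> card (rep ` C)" using CD by (intro card_mono) auto
  also have "\<dots> \<le> k" using C CD card_image_le[of C rep] by (auto simp: center_sets_def)
  finally have "card (g ` I) \<le> k" .
  moreover have "g \<in> I \<rightarrow>\<^sub>E {..<n}" using rep by (auto simp: g_def I_def)
  moreover have "(\<Sum>i\<in>I. (pdist (xs ! i) (xs ! g i))\<^sup>2) \<le> (\<Sum>i\<in>I. 4 * (sdist (xs ! i) C)\<^sup>2)"
  proof (intro sum_mono)
    fix i assume i: "i \<in> I"
    have len: "length (xs ! j) = d" if "j \<in> I" for j
      using subsetD[OF xs(2) nth_mem[of j]] that by (simp add: I_def n_def points_def)
    have lc: "length (\<phi> i) = d" using \<phi>(1) CD(3) by (auto simp: points_def)
    have g: "g i \<in> I" using rep i by (simp add: g_def)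
    have "pdist (xs ! i) (xs ! g i) \<le> pdist (xs ! i) (\<phi> i) + pdist (\<phi> i) (xs ! g i)"
      using len i g lc by (intro pdist_triangle) auto
    also have "pdist (\<phi> i) (xs ! g i) = pdist (xs ! g i) (\<phi> i)"
      using len g lc by (intro pdist_commute) auto
    also have "\<dots> \<le> pdist (xs ! i) (\<phi> i)" using rep i by (simp add: g_def)
    finally have "pdist (xs ! i) (xs ! g i) \<le> 2 * sdist (xs ! i) C" using \<phi>(2) by simp
    then have "(pdist (xs ! i) (xs ! g i))\<^sup>2 \<le> (2 * sdist (xs ! i) C)\<^sup>2" by (intro power_mono) auto
    then show "(pdist (xs ! i) (xs ! g i))\<^sup>2 \<le> 4 * (sdist (xs ! i) C)\<^sup>2" by (simp add: power_mult_distrib)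
  qed
  then have "(\<Sum>i\<in>I. (pdist (xs ! i) (xs ! g i))\<^sup>2) \<le> 4 * kcost (set xs) z C"
    unfolding kcost_def Y_def[symmetric] img[symmetric] sum.reindex[OF inj]
    by (simp add: sum_distrib_left)
  moreover have "I \<subseteq> {..<n}" by (auto simp: I_def)
  ultimately show ?thesis using cardI by blast
qed

text \<open>\<open>Opt\<close> is an infimum over infinitely many center sets, but there are only
  finitely many discrete clusterings. The cheapest one is within the factor 4 of every center set,
  hence of the infimum.\<close>

lemma ex_discrete_clustering:
  fixes xs :: "point list"
  defines "n \<equiv> length xs"
  assumes xs: "distinct xs" "set xs \<subseteq> points d" and k: "1 \<le> k" and d: "1 \<le> d"
  shows "\<exists>I g. I \<subseteq> {..<n} \<and> g \<in> I \<rightarrow> {..<n} \<and> card ({..<n} - I) \<le> z \<and> card (g ` I) \<le> k \<and>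
    (\<Sum>i\<in>I. (pdist (xs ! i) (xs ! g i))\<^sup>2) \<le> 4 * Opt d (set xs) k z"
proof -
  define cost where "cost = (\<lambda>(I, g). \<Sum>i\<in>I. (pdist (xs ! i) (xs ! g i))\<^sup>2)"
  define F where "F = {(I, g). I \<subseteq> {..<n} \<and> g \<in> I \<rightarrow>\<^sub>E {..<n} \<and> card ({..<n} - I) \<le> z \<and> card (g ` I) \<le> k}"
  have "F \<subseteq> Sigma (Pow {..<n}) (\<lambda>I. I \<rightarrow>\<^sub>E {..<n})" by (auto simp: F_def)
  then have finF: "finite F"
    by (rule finite_subset) (auto intro!: finite_SigmaI finite_PiE intro: finite_subset)
  have le: "\<exists>a\<in>F. cost a \<le> 4 * kcost (set xs) z C" if "C \<in> center_sets d k" for C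
    using ex_discrete_clustering_of_centers[OF xs that k, of z]
    by (auto simp: F_def cost_def n_def)
  obtain C where C: "C \<in> center_sets d k" using ex_center_superset[OF d, of "{}" k] by auto
  then have "F \<noteq> {}" using le by blast
  then obtain a where a: "a \<in> F" "\<And>b. b \<in> F \<Longrightarrow> cost a \<le> cost b"
    using finF ex_min_if_finite[of "cost ` F"] by (auto simp: not_less)
  have "cost a / 4 \<le> Opt d (set xs) k z"
    unfolding Opt_def
  proof (rule cINF_greatest)
    show "center_sets d k \<noteq> {}" using C by auto
    fix C' assume "C' \<in> center_sets d k"
    then obtain b where "b \<in> F" "cost b \<le> 4 * kcost (set xs) z C'" using le by blast
    then show "cost a / 4 \<le> kcost (set xs) z C'" using a(2)[of b] by simp
  qed
  then show ?thesis using a(1)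
    by (cases a, intro exI[of _ "fst a"] exI[of _ "snd a"]) (auto simp: F_def cost_def)
qed

text \<open>\<open>s i\<close> is the seed that point \<open>i\<close> is assigned to. A seed with more than \<open>32 z\<close> points has
  at most \<open>13 z\<close> of them in \<open>E\<close> or among the outliers, so at least half of its weight is paid for by the
  others.\<close>

lemma weighted_seeds_cost:
  fixes xs :: "point list" and s :: "nat \<Rightarrow> point"
  defines "n \<equiv> length xs"
  assumes d: "1 \<le> d" and k: "1 \<le> k" and xs: "distinct xs" "set xs \<subseteq> points d"
    and I: "I \<subseteq> {..<n}" "g \<in> I \<rightarrow> {..<n}" "card ({..<n} - I) \<le> z" "card (g ` I) \<le> k"
    and E: "E \<subseteq> {..<n}" "card E \<le> 12 * z"
      "(\<Sum>i\<in>{..<n} - E. (pdist (xs ! i) (s i))\<^sup>2) \<le> 136 * \<Gamma>"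
    and \<Gamma>: "\<Gamma> = (\<Sum>i\<in>I. (pdist (xs ! i) (xs ! g i))\<^sup>2)"
    and S: "s ` {..<n} \<subseteq> S" "finite S" "card S \<le> m" "S \<subseteq> P"
    and P: "finite P" "P \<subseteq> points d"
    and w: "\<And>p. p \<in> P \<Longrightarrow> w p = (if 32 * z < card {i. i < n \<and> s i = p} then real (card {i. i < n \<and> s i = p}) else 0)"
    and C: "C \<in> center_sets d k" "wcost w P C \<le> \<alpha> * wOpt d w P k"
  shows "kcost (set xs) (12 * z + m * (32 * z)) C \<le> (272 + 1096 * max \<alpha> 0) * \<Gamma>"
proof -
  define A where "A p = {i. i < n \<and> s i = p}" for p
  define heavy where "heavy p \<longleftrightarrow> 32 * z < card (A p)" for p
  have finA: "finite (A p)" for p by (simp add: A_def)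
  have len_x: "length (xs ! i) = d" if "i < n" for i
    using subsetD[OF xs(2) nth_mem[of i]] that by (simp add: n_def points_def)
  have len_s: "length (s i) = d" if "i < n" for i using that S P by (auto simp: points_def subset_iff image_iff)
  have w0: "0 \<le> w p" if "p \<in> P" for p using w[OF that] by simp
  have \<Gamma>0: "0 \<le> \<Gamma>" by (simp add: \<Gamma> sum_nonneg)
  have finI: "finite I" using I(1) finite_subset by blast
  note CD = center_setsD[OF C(1) k]
  have "card ((!) xs ` g ` I) \<le> k" using I(4) card_image_le[of "g ` I" "(!) xs"] finI by simp
  moreover have "(!) xs ` g ` I \<subseteq> points d" using I(2) xs(2) by (auto simp: n_def Pi_def subset_iff)
  \<comment> \<open>The competitor in the weighted instance: the reference centers, filled up to
    \<open>k\<close> points.\<close>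
  ultimately obtain C1 where C1: "C1 \<in> center_sets d k" "(!) xs ` g ` I \<subseteq> C1"
    using ex_center_superset[OF d, of "(!) xs ` g ` I" k] finI by blast
  note C1D = center_setsD[OF C1(1) k]
  define J where "J = I - E"
  have J: "J \<subseteq> {..<n}" "finite J" using I(1) finI by (auto simp: J_def)
  have seed_cost: "w p * (sdist p C1)\<^sup>2
      \<le> (\<Sum>i\<in>J \<inter> A p. 4 * ((pdist (xs ! i) (s i))\<^sup>2 + (pdist (xs ! i) (xs ! g i))\<^sup>2))" if p: "p \<in> P" for p
  proof (cases "heavy p")
    case False
    then show ?thesis using w[OF p] by (simp add: heavy_def A_def sum_nonneg)
  next
    case True
    have "A p \<subseteq> (J \<inter> A p) \<union> (E \<union> ({..<n} - I))" using I(1) by (auto simp: J_def A_def)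
    then have "card (A p) \<le> card ((J \<inter> A p) \<union> (E \<union> ({..<n} - I)))"
      using J E finite_subset[of E] by (intro card_mono) auto
    also have "\<dots> \<le> card (J \<inter> A p) + (card E + card ({..<n} - I))"
      by (meson add_left_mono card_Un_le le_trans)
    also have "\<dots> \<le> card (J \<inter> A p) + 13 * z" using E I by simp
    finally have half: "card (A p) \<le> 2 * card (J \<inter> A p)" using True by (simp add: heavy_def)
    have "w p * (sdist p C1)\<^sup>2 = real (card (A p)) * (sdist p C1)\<^sup>2"
      using True w[OF p] by (simp add: heavy_def A_def)
    also have "\<dots> \<le> real (2 * card (J \<inter> A p)) * (sdist p C1)\<^sup>2"
      using half by (intro mult_right_mono) auto
    also have "\<dots> = (\<Sum>i\<in>J \<inter> A p. 2 * (sdist p C1)\<^sup>2)" by simp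
    also have "\<dots> \<le> (\<Sum>i\<in>J \<inter> A p. 4 * ((pdist (xs ! i) (s i))\<^sup>2 + (pdist (xs ! i) (xs ! g i))\<^sup>2))"
    proof (intro sum_mono)
      fix i assume i: "i \<in> J \<inter> A p"
      then have in': "i < n" "s i = p" "i \<in> I" "g i < n" using I(2) by (auto simp: A_def J_def Pi_def)
      have "sdist p C1 \<le> pdist p (xs ! g i)" using C1 C1D in' by (intro sdist_le) auto
      also have "\<dots> \<le> pdist p (xs ! i) + pdist (xs ! i) (xs ! g i)"
        using len_x len_s in' by (intro pdist_triangle) auto
      also have "pdist p (xs ! i) = pdist (xs ! i) (s i)"
        using len_x len_s in' by (subst pdist_commute) auto
      finally have "(sdist p C1)\<^sup>2 \<le> (pdist (xs ! i) (s i) + pdist (xs ! i) (xs ! g i))\<^sup>2"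
        using sdist_nonneg C1D by (intro power_mono) auto
      also have "\<dots> \<le> 2 * (pdist (xs ! i) (s i))\<^sup>2 + 2 * (pdist (xs ! i) (xs ! g i))\<^sup>2" by (rule power2_sum_le)
      finally show "2 * (sdist p C1)\<^sup>2 \<le> 4 * ((pdist (xs ! i) (s i))\<^sup>2 + (pdist (xs ! i) (xs ! g i))\<^sup>2)" by simp
    qed
    finally show ?thesis .
  qed
  have "wOpt d w P k \<le> wcost w P C1" using C1 w0 by (intro wOpt_le)
  also have "\<dots> \<le> (\<Sum>p\<in>P. \<Sum>i\<in>J \<inter> A p. 4 * ((pdist (xs ! i) (s i))\<^sup>2 + (pdist (xs ! i) (xs ! g i))\<^sup>2))"
    unfolding wcost_def using seed_cost by (intro sum_mono)
  also have "\<dots> = (\<Sum>i\<in>J. 4 * ((pdist (xs ! i) (s i))\<^sup>2 + (pdist (xs ! i) (xs ! g i))\<^sup>2))"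
  proof -
    have eq: "J \<inter> A p = {i \<in> J. s i = p}" for p using J by (auto simp: A_def)
    have "s ` J \<subseteq> P" using J S by blast
    then show ?thesis unfolding eq by (rule sum.group[OF J(2) P(1)])
  qed
  also have "\<dots> = 4 * ((\<Sum>i\<in>J. (pdist (xs ! i) (s i))\<^sup>2) + (\<Sum>i\<in>J. (pdist (xs ! i) (xs ! g i))\<^sup>2))"
    by (simp add: sum_distrib_left[symmetric] sum.distrib)
  also have "\<dots> \<le> 4 * (136 * \<Gamma> + \<Gamma>)"
  proof -
    have "(\<Sum>i\<in>J. (pdist (xs ! i) (s i))\<^sup>2) \<le> (\<Sum>i\<in>{..<n} - E. (pdist (xs ! i) (s i))\<^sup>2)"
      using J by (intro sum_mono2) (auto simp: J_def)
    moreover have "(\<Sum>i\<in>J. (pdist (xs ! i) (xs ! g i))\<^sup>2) \<le> \<Gamma>"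
      unfolding \<Gamma> using finI by (intro sum_mono2) (auto simp: J_def)
    ultimately show ?thesis using E(3) by simp
  qed
  \<comment> \<open>548 = 4 * (136 + 1): the distances of the points to their seeds and to their
    reference centers.\<close>
  finally have wOpt: "wOpt d w P k \<le> 548 * \<Gamma>" by simp
  have "wcost w P C \<le> \<alpha> * wOpt d w P k" by (rule C)
  \<comment> \<open>\<open>\<alpha>\<close> is an arbitrary real; its positive part makes
    multiplication monotone.\<close>
  also have "\<dots> \<le> max \<alpha> 0 * wOpt d w P k"
    using wOpt_nonneg[OF d, of P w k] w0 by (intro mult_right_mono) auto
  also have "\<dots> \<le> max \<alpha> 0 * (548 * \<Gamma>)" using wOpt by (intro mult_left_mono) auto
  finally have wC: "wcost w P C \<le> max \<alpha> 0 * (548 * \<Gamma>)" .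
  \<comment> \<open>The points that are kept. Discarded are \<open>E\<close> and, for each of at
    most \<open>m\<close> light seeds, its at most \<open>32 z\<close> points.\<close>
  define H where "H = {i. i < n \<and> i \<notin> E \<and> heavy (s i)}"
  have H: "H \<subseteq> {..<n}" "finite H" by (auto simp: H_def)
  have inj: "inj_on ((!) xs) {..<n}" using xs(1) by (auto simp: n_def inj_on_def nth_eq_iff_index_eq)
  have injH: "inj_on ((!) xs) H" using inj H inj_on_subset by blast
  have cardL: "card ({..<n} - H) \<le> 12 * z + m * (32 * z)"
  proof -
    have "{..<n} - H \<subseteq> E \<union> (\<Union>p\<in>{p\<in>S. \<not> heavy p}. A p)"
      using S(1) by (auto simp: H_def A_def)
    then have "card ({..<n} - H) \<le> card (E \<union> (\<Union>p\<in>{p\<in>S. \<not> heavy p}. A p))"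
      using E(1) S finA finite_subset[of E] by (intro card_mono) auto
    also have "\<dots> \<le> card E + card (\<Union>p\<in>{p\<in>S. \<not> heavy p}. A p)" by (rule card_Un_le)
    also have "card (\<Union>p\<in>{p\<in>S. \<not> heavy p}. A p) \<le> (\<Sum>p\<in>{p\<in>S. \<not> heavy p}. card (A p))"
      using S by (intro card_UN_le) auto
    also have "\<dots> \<le> (\<Sum>p\<in>{p\<in>S. \<not> heavy p}. 32 * z)" by (intro sum_mono) (auto simp: heavy_def)
    also have "\<dots> \<le> m * (32 * z)"
    proof -
      have "card {p\<in>S. \<not> heavy p} \<le> card S" using S by (intro card_mono) auto
      then show ?thesis using S by (auto simp del: mult_is_0 intro!: mult_right_mono)
    qed
    finally show ?thesis using E(2) by simp
  qed
  have "kcost (set xs) (12 * z + m * (32 * z)) C \<le> (\<Sum>x\<in>(!) xs ` H. (sdist x C)\<^sup>2)"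
  proof (rule kcost_le)
    have "set xs = (!) xs ` {..<n}" by (auto simp: n_def set_conv_nth)
    then have "set xs - (!) xs ` H = (!) xs ` ({..<n} - H)"
      using inj_on_image_set_diff[OF inj, of "{..<n}" H] H by simp
    then have "card (set xs - (!) xs ` H) \<le> card ({..<n} - H)" by (simp add: card_image_le)
    then show "card (set xs - (!) xs ` H) \<le> 12 * z + m * (32 * z)" using cardL by simp
    show "(!) xs ` H \<subseteq> set xs" using H by (auto simp: n_def)
  qed (use CD in auto)
  also have "\<dots> = (\<Sum>i\<in>H. (sdist (xs ! i) C)\<^sup>2)" using injH by (simp add: sum.reindex)
  also have "\<dots> \<le> (\<Sum>i\<in>H. 2 * (pdist (xs ! i) (s i))\<^sup>2 + 2 * (sdist (s i) C)\<^sup>2)"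
  proof (intro sum_mono)
    fix i assume "i \<in> H"
    then have "sdist (xs ! i) C \<le> pdist (xs ! i) (s i) + sdist (s i) C"
      using H len_x len_s CD by (intro sdist_triangle) auto
    then have "(sdist (xs ! i) C)\<^sup>2 \<le> (pdist (xs ! i) (s i) + sdist (s i) C)\<^sup>2"
      using sdist_nonneg CD by (intro power_mono) auto
    then show "(sdist (xs ! i) C)\<^sup>2 \<le> 2 * (pdist (xs ! i) (s i))\<^sup>2 + 2 * (sdist (s i) C)\<^sup>2"
      using power2_sum_le order_trans by blast
  qed
  also have "\<dots> = 2 * (\<Sum>i\<in>H. (pdist (xs ! i) (s i))\<^sup>2) + 2 * (\<Sum>i\<in>H. (sdist (s i) C)\<^sup>2)"
    by (simp add: sum.distrib sum_distrib_left)
  also have "(\<Sum>i\<in>H. (pdist (xs ! i) (s i))\<^sup>2) \<le> (\<Sum>i\<in>{..<n} - E. (pdist (xs ! i) (s i))\<^sup>2)"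
    by (intro sum_mono2) (auto simp: H_def)
  also note E(3)
  also have "(\<Sum>i\<in>H. (sdist (s i) C)\<^sup>2) \<le> wcost w P C"
  proof -
    have "(\<Sum>i\<in>H. (sdist (s i) C)\<^sup>2) = (\<Sum>p\<in>P. \<Sum>i\<in>{i \<in> H. s i = p}. (sdist (s i) C)\<^sup>2)"
      using H S P by (intro sum.group[symmetric]) auto
    also have "\<dots> \<le> (\<Sum>p\<in>P. w p * (sdist p C)\<^sup>2)"
    proof (intro sum_mono)
      fix p assume p: "p \<in> P"
      have "(\<Sum>i\<in>{i \<in> H. s i = p}. (sdist (s i) C)\<^sup>2) = real (card {i \<in> H. s i = p}) * (sdist p C)\<^sup>2"
        by simp
      also have "\<dots> \<le> w p * (sdist p C)\<^sup>2"
      proof (cases "heavy p")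
        case True
        have "card {i \<in> H. s i = p} \<le> card (A p)" by (intro card_mono) (auto simp: H_def A_def)
        then show ?thesis using w[OF p] True by (intro mult_right_mono) (auto simp: heavy_def A_def)
      next
        case False
        then have empty: "{i \<in> H. s i = p} = {}" by (auto simp: H_def)
        show ?thesis unfolding empty using w0[OF p] by simp
      qed
      finally show "(\<Sum>i\<in>{i \<in> H. s i = p}. (sdist (s i) C)\<^sup>2) \<le> w p * (sdist p C)\<^sup>2" .
    qed
    finally show ?thesis by (simp add: wcost_def)
  qed
  also note wC
  finally show ?thesis by (simp add: algebra_simps)
qed

text \<open>Seeds are numbered in order of insertion, as they lie in memory, while the list grows at
  its head. So the newest seed has number \<open>length cs\<close>, and numbers are looked up in
  \<open>rev cs\<close>.\<close>

primrec nearest_seed :: "(nat \<Rightarrow> nat \<Rightarrow> real) \<Rightarrow> real \<Rightarrow> nat list \<Rightarrow> nat \<Rightarrow> nat" where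
  "nearest_seed \<delta> V [] i = 0"
| "nearest_seed \<delta> V (c # cs) i =
     (if (\<delta> i c)\<^sup>2 < center_sqdist \<delta> V cs i then length cs else nearest_seed \<delta> V cs i)"

text \<open>Distances below the cap \<open>V\<close> make the oldest seed win the strict comparison,
  so the answer always refers to an actual seed.\<close>

lemma nearest_seed:
  assumes "cs \<noteq> []" "\<And>c. c \<in> set cs \<Longrightarrow> (\<delta> i c)\<^sup>2 < V"
  shows "nearest_seed \<delta> V cs i < length cs
    \<and> (\<delta> i (rev cs ! nearest_seed \<delta> V cs i))\<^sup>2 = center_sqdist \<delta> V cs i"
  using assms
proof (induction cs)
  case (Cons c cs)
  show ?case
  proof (cases "cs = []")
    case True
    then show ?thesis using Cons.prems by auto
  next
    case False
    then show ?thesis using Cons by (auto simp: nth_append min_def)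
  qed
qed simp

section \<open>The program\<close>

fun block :: "com list \<Rightarrow> com" where
  "block [] = Skip"
| "block [c] = c"
| "block (c # cs) = Seq c (block cs)"

text \<open>Natural registers: 0 \<open>d\<close>, 1 \<open>n\<close>, 2 \<open>k\<close>, 3 \<open>z\<close>, 4 the constant 1, 5 the constant 0, 6 to 8 loop
  counters, 10 and 13 running addresses, 11 and 12 index and address of the sampled point, 14 and 15
  number of seeds and address of the next one, 16 size of the instance passed to \<open>A\<close>, 17 number of
  rounds, 18 weight threshold. Real registers: 0 \<open>V\<close>, 2 inclusion probability, 3 truncation level, 4 total
  weight, 10 the constant 1, 11 the constant 0. Real array 3 holds the truncated squared
  distances to the seeds, natural array 0 the nearest seeds, natural array 1 their numbers of
  points; the instance for \<open>A\<close> is built up in the real arrays 10 and 11.\<close>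

definition init_prog :: com where
  "init_prog = block
     [NConst 4 1, ROfNat 10 4, NOp NAdd 18 3 3, NOp NAdd 18 18 18, NOp NAdd 18 18 18,
      NOp NAdd 19 18 4, NOp NAdd 18 18 18, NOp NAdd 18 18 18, ROfNat 2 19, ROp RDiv 2 10 2]"

definition square_prog :: com where
  "square_prog = block [RLoad 8 0 10, ROp RMul 8 8 8, ROp RAdd 0 0 8, NOp NAdd 10 10 4]"

definition cap_prog :: com where
  "cap_prog = Seq (For 6 1 (For 7 0 square_prog))
     (block [ROp RAdd 0 0 10, NConst 21 544, ROfNat 8 21, ROp RMul 0 0 8, ROfNat 8 1, ROp RMul 0 0 8])"

definition power_prog :: com where
  "power_prog = block [ROp RMul 1 1 8, NOp NAdd 17 17 21]"

definition log_prog :: com where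
  "log_prog = block [ROp RAdd 9 9 9, NOp NAdd 16 16 4]"

definition size_prog :: com where
  "size_prog = block
     [ROp RAdd 1 10 11, For 6 2 power_prog, ROp RAdd 9 10 11, While (RLess 9 1) log_prog,
      Branch (NLess 16 17) (NOp NAdd 17 16 5) Skip]"

lemmas prog_defs = init_prog_def square_prog_def cap_prog_def power_prog_def log_prog_def size_prog_def

locale kmeans_input =
  fixes d k z :: nat and xs :: "point list"
  assumes d: "1 \<le> d" and k: "1 \<le> k" and n2: "2 \<le> length xs"
    and xs: "distinct xs" "set xs \<subseteq> points d"
begin

definition n :: nat where
  "n = length xs"

definition \<delta> :: "nat \<Rightarrow> nat \<Rightarrow> real" where
  "\<delta> i j = pdist (xs ! i) (xs ! j)"

definition Q :: real where
  "Q = (\<Sum>i<n. \<Sum>l<d. (xs ! i ! l)\<^sup>2)"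

text \<open>\<open>V\<close> exceeds all squared distances, which are at most \<open>4 * Q\<close>,
  and all first coordinates, so that the padding points are new. It also exceeds 136 times the cost
  of any discrete clustering, which is at most \<open>n * 4 * Q\<close>; hence 544 = 136 * 4. The
  number of rounds per center happens to be the same number and is read from the same
  register.\<close>

definition V :: real where
  "V = (Q + 1) * 544 * real n"

definition M :: nat where
  "M = nat \<lceil>real k * log 2 (real n)\<rceil>"

text \<open>Every round may add a seed, and all seeds must fit into the \<open>M\<close> points
  passed to \<open>A\<close>.\<close>

definition R :: nat where
  "R = min (544 * k) M"

abbreviation "D \<equiv> center_sqdist \<delta> V"

definition base :: "state \<Rightarrow> bool" where
  "base s \<longleftrightarrow> nreg s 0 = d \<and> nreg s 1 = n \<and> nreg s 2 = k \<and> nreg s 4 = 1 \<and> nreg s 5 = 0 \<and>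
     rreg s 10 = 1 \<and> rreg s 11 = 0 \<and> (\<forall>i<n. \<forall>l<d. rarr s 0 (i * d + l) = xs ! i ! l)"

lemma base_agree:
  assumes "agree_off W s s'" "base s" "{NR 0, NR 1, NR 2, NR 4, NR 5, RR 10, RR 11, RA 0} \<inter> W = {}"
  shows "base s'"
  using assms by (auto simp: base_def agree_off_def)

text \<open>This makes \<open>M\<close> computable without logarithms or rounding: it is the number
  of doublings of 1 needed to reach \<open>n ^ k\<close>.\<close>

lemma M_char: "j < M \<longleftrightarrow> 2 ^ j < real n ^ k"
proof -
  have n: "0 < real n" using n2 unfolding n_def by linarith
  have "j < M \<longleftrightarrow> real j < real k * log 2 (real n)"
    unfolding M_def by (simp add: less_ceiling_iff zless_nat_eq_int_zless)
  also have "real k * log 2 (real n) = log 2 (real n ^ k)"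
    using n by (simp add: log_nat_power)
  also have "real j < log 2 (real n ^ k) \<longleftrightarrow> 2 powr real j < real n ^ k"
    using n by (subst less_log_iff) auto
  finally show ?thesis by (simp add: powr_realpow)
qed

text \<open>Keeps the doubling and padding loops within time \<open>O(k n)\<close>.\<close>

lemma M_le: "M \<le> k * n"
proof (rule ccontr)
  assume "\<not> M \<le> k * n"
  then have "2 ^ (k * n) < real n ^ k" using M_char[of "k * n"] by simp
  also have "\<dots> \<le> (2 ^ n) ^ k" using of_nat_less_two_power[of n] by (intro power_mono) auto
  finally show False by (simp add: mult.commute flip: power_mult)
qed

text \<open>Holds because \<open>n \<ge> 2\<close>; there is always room for at least
  \<open>k\<close> rounds.\<close>

lemma k_le_M: "k \<le> M"
proof (rule ccontr)
  assume "\<not> k \<le> M"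
  then have "\<not> M < M \<Longrightarrow> real n ^ k \<le> 2 ^ M" using M_char[of M] by simp
  moreover have "(2::real) ^ k \<le> real n ^ k" using n2 by (intro power_mono) (auto simp: n_def)
  moreover have "(2::real) ^ M < 2 ^ k" using \<open>\<not> k \<le> M\<close> by (intro power_strict_increasing) auto
  ultimately show False by simp
qed

lemma init_prog:
  "det init_prog (input_state d k z xs w) 19
     (\<lambda>s'. base s' \<and> nreg s' 18 = 32 * z \<and> rreg s' 2 = 1 / real (8 * z + 1))"
proof (rule det_loop_free)
  have *: "(i * d + l) div d = i" "(i * d + l) mod d = l" "i * d + l < length xs * d"
    if "i < length xs" "l < d" for i l
  proof -
    show "(i * d + l) div d = i" "(i * d + l) mod d = l" using that by auto
    have "i * d + l < Suc i * d" using that by simp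
    also have "\<dots> \<le> length xs * d" using that by (intro mult_le_mono1) simp
    finally show "i * d + l < length xs * d" .
  qed
  show "base s' \<and> nreg s' 18 = 32 * z \<and> rreg s' 2 = 1 / real (8 * z + 1)"
    if "s' \<in> set_pmf (denot init_prog (input_state d k z xs w))" for s'
    using that
    by (auto simp: init_prog_def base_def input_state_def set_defs bind_return_pmf n_def *)
qed (auto simp: init_prog_def)

lemma square_loop:
  assumes s: "base s" "nreg s 10 = i * d" "i < n"
  shows "det (For 7 0 square_prog) s (d * 11 + 3)
    (\<lambda>s'. nreg s' 10 = Suc i * d \<and> rreg s' 0 = rreg s 0 + (\<Sum>l<d. (xs ! i ! l)\<^sup>2))"
proof -
  have "det (For 7 0 square_prog) s (d * 11 + 3)
      (\<lambda>s'. nreg s' 10 = i * d + d \<and> rreg s' 0 = rreg s 0 + (\<Sum>l'<d. (xs ! i ! l')\<^sup>2))"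
  proof (rule det_For[where tb = 7 and
        J = "\<lambda>l s'. nreg s' 10 = i * d + l \<and> rreg s' 0 = rreg s 0 + (\<Sum>l'<l. (xs ! i ! l')\<^sup>2)"])
    fix l s'
    assume l: "l < d" and J: "nreg s' 10 = i * d + l \<and> rreg s' 0 = rreg s 0 + (\<Sum>l'<l. (xs ! i ! l')\<^sup>2)"
      and fr: "agree_off (insert (NR 7) (writes square_prog)) s s'"
    have "base s'" using fr s(1) by (rule base_agree) (simp add: square_prog_def)
    then show "det square_prog s' 7 (\<lambda>s''. nreg (set_nreg 7 (Suc l) s'') 10 = i * d + Suc l \<and>
        rreg (set_nreg 7 (Suc l) s'') 0 = rreg s 0 + (\<Sum>l'<Suc l. (xs ! i ! l')\<^sup>2))"
      using J l s
      by (intro det_loop_free) (auto simp: square_prog_def set_defs base_def power2_eq_square bind_return_pmf)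
  qed (use s in \<open>auto simp: square_prog_def set_defs base_def\<close>)
  then show ?thesis by (simp add: add.commute)
qed

lemma cap_prog:
  assumes s: "base s" "nreg s 10 = 0" "rreg s 0 = 0"
  shows "det cap_prog s (n * (d * 11 + 7) + 15) (\<lambda>s'. rreg s' 0 = V \<and> rreg s' 8 = real n \<and> nreg s' 21 = 544)"
proof -
  have loop: "det (For 6 1 (For 7 0 square_prog)) s (n * (d * 11 + 7) + 3)
      (\<lambda>s'. nreg s' 10 = n * d \<and> rreg s' 0 = (\<Sum>i<n. \<Sum>l<d. (xs ! i ! l)\<^sup>2))"
  proof (rule det_For[where tb = "d * 11 + 3" and
        J = "\<lambda>i s'. nreg s' 10 = i * d \<and> rreg s' 0 = (\<Sum>i'<i. \<Sum>l<d. (xs ! i' ! l)\<^sup>2)"])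
    fix i s'
    assume i: "i < n" and J: "nreg s' 10 = i * d \<and> rreg s' 0 = (\<Sum>i'<i. \<Sum>l<d. (xs ! i' ! l)\<^sup>2)"
      and fr: "agree_off (insert (NR 6) (writes (For 7 0 square_prog))) s s'"
    have "base s'" using fr s(1) by (rule base_agree) (simp add: square_prog_def)
    then have "det (For 7 0 square_prog) s' (d * 11 + 3)
      (\<lambda>s''. nreg s'' 10 = Suc i * d \<and> rreg s'' 0 = rreg s' 0 + (\<Sum>l<d. (xs ! i ! l)\<^sup>2))"
      using J i by (intro square_loop) auto
    then show "det (For 7 0 square_prog) s' (d * 11 + 3)
        (\<lambda>s''. nreg (set_nreg 6 (Suc i) s'') 10 = Suc i * d \<and>
          rreg (set_nreg 6 (Suc i) s'') 0 = (\<Sum>i'<Suc i. \<Sum>l<d. (xs ! i' ! l)\<^sup>2))"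
      by (rule exec_conseq) (use J in \<open>auto simp: set_defs\<close>)
  qed (use s in \<open>auto simp: square_prog_def set_defs base_def\<close>)
  have "det cap_prog s ((n * (d * 11 + 7) + 3) + 11 + 1)
      (\<lambda>s'. rreg s' 0 = V \<and> rreg s' 8 = real n \<and> nreg s' 21 = 544)"
    unfolding cap_prog_def
  proof (rule det_Seq[OF exec_frame[OF loop]])
    fix s'
    assume *: "(nreg s' 10 = n * d \<and> rreg s' 0 = (\<Sum>i'<n. \<Sum>l<d. (xs ! i' ! l)\<^sup>2)) \<and>
      agree_off (writes (For 6 1 (For 7 0 square_prog))) s s'"
    then have "base s'" using s(1) by (auto intro: base_agree simp: square_prog_def)
    then show "det (block [ROp RAdd 0 0 10, NConst 21 544, ROfNat 8 21, ROp RMul 0 0 8, ROfNat 8 1,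
        ROp RMul 0 0 8]) s' 11 (\<lambda>s'. rreg s' 0 = V \<and> rreg s' 8 = real n \<and> nreg s' 21 = 544)"
      using * by (intro det_loop_free) (auto simp: set_defs base_def V_def Q_def bind_return_pmf)
  qed
  then show ?thesis by (simp add: add.commute)
qed

lemma size_prog:
  assumes s: "base s" "rreg s 8 = real n" "nreg s 21 = 544" "nreg s 16 = 0" "nreg s 17 = 0"
  shows "det size_prog s (k * 7 + M * 5 + 15) (\<lambda>s'. nreg s' 16 = M \<and> nreg s' 17 = R)"
proof -
  let ?c1 = "ROp RAdd 1 10 11" and ?c2 = "For 6 2 power_prog" and ?c3 = "ROp RAdd 9 10 11"
  let ?c4 = "While (RLess 9 1) log_prog" and ?c5 = "Branch (NLess 16 17) (NOp NAdd 17 16 5) Skip"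
  have 5: "det ?c5 s' 2 (\<lambda>s'. nreg s' 16 = M \<and> nreg s' 17 = R)"
    if "nreg s' 16 = M" "nreg s' 17 = 544 * k" "base s'" for s'
    using that by (intro det_loop_free) (auto simp: set_defs base_def R_def split: if_splits)
  have 4: "det ?c4 s' (M * 5 + 1) (\<lambda>s'. nreg s' 16 = M \<and> nreg s' 17 = 544 * k \<and> base s')"
    if "nreg s' 16 = 0" "nreg s' 17 = 544 * k" "base s'" "rreg s' 9 = 1" "rreg s' 1 = real n ^ k" for s'
  proof -
    define J where "J j (a::unit) s' \<longleftrightarrow> nreg s' 16 = j \<and> nreg s' 17 = 544 * k \<and> base s' \<and>
      rreg s' 9 = 2 ^ j \<and> rreg s' 1 = real n ^ k" for j a s'
    have "exec ?c4 s' (M * (3 + 2) + 1) (itr (\<lambda>_. return_pmf) 0 M ()) (J M)"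
    proof (rule exec_While)
      fix j a s' assume "J j a s'"
      then show "exec log_prog s' 3 (return_pmf a) (J (Suc j))"
        by (intro det_loop_free) (auto simp: J_def log_prog_def set_defs base_def bind_return_pmf)
    qed (use that in \<open>auto simp: J_def M_char\<close>)
    then have "det ?c4 s' (M * (3 + 2) + 1) (\<lambda>s'. nreg s' 16 = M \<and> nreg s' 17 = 544 * k \<and> base s')"
      unfolding itr_return by (rule exec_conseq) (simp add: J_def)
    then show ?thesis by simp
  qed
  have 2: "det ?c2 s' (k * 7 + 3) (\<lambda>s'. rreg s' 1 = real n ^ k \<and> nreg s' 17 = k * 544)"
    if "base s'" "rreg s' 1 = 1" "nreg s' 17 = 0" "rreg s' 8 = real n" "nreg s' 21 = 544" for s'
  proof (rule det_For[where tb = 3 and J = "\<lambda>j s'. rreg s' 1 = real n ^ j \<and> nreg s' 17 = j * 544"])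
    fix j s'' assume "rreg s'' 1 = real n ^ j \<and> nreg s'' 17 = j * 544"
      and fr: "agree_off (insert (NR 6) (writes power_prog)) s' s''"
    then show "det power_prog s'' 3 (\<lambda>s''. rreg (set_nreg 6 (Suc j) s'') 1 = real n ^ Suc j \<and>
       nreg (set_nreg 6 (Suc j) s'') 17 = Suc j * 544)"
      using that by (intro det_loop_free) (auto simp: power_prog_def agree_off_def set_defs bind_return_pmf)
  qed (use that in \<open>auto simp: power_prog_def set_defs base_def\<close>)
  have "det size_prog s (1 + ((k * 7 + 3) + (1 + ((M * 5 + 1) + 2 + 1) + 1) + 1) + 1)
     (\<lambda>s'. nreg s' 16 = M \<and> nreg s' 17 = R)"
    unfolding size_prog_def block.simps
  proof (rule det_Seq)
    show "det ?c1 s 1 (\<lambda>s'. rreg s' 1 = 1 \<and> agree_off {RR 1} s s')"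
      using s by (intro det_loop_free) (auto simp: set_defs base_def agree_off_def)
    fix s1 assume 1: "rreg s1 1 = 1 \<and> agree_off {RR 1} s s1"
    have b1: "base s1" using 1 s(1) by (auto intro: base_agree)
    have "det ?c2 s1 (k * 7 + 3) (\<lambda>s'. rreg s' 1 = real n ^ k \<and> nreg s' 17 = k * 544)"
      using 1 s b1 by (intro 2) (auto simp: agree_off_def)
    from exec_frame[OF this] show "det (Seq ?c2 (Seq ?c3 (Seq ?c4 ?c5))) s1
        ((k * 7 + 3) + (1 + ((M * 5 + 1) + 2 + 1) + 1) + 1) (\<lambda>s'. nreg s' 16 = M \<and> nreg s' 17 = R)"
    proof (rule det_Seq)
      fix s2 assume 2: "(rreg s2 1 = real n ^ k \<and> nreg s2 17 = k * 544) \<and> agree_off (writes ?c2) s1 s2"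
      have b2: "base s2" using 2 b1 by (auto intro: base_agree simp: power_prog_def)
      have n16: "nreg s2 16 = 0" using 1 2 s by (auto simp: agree_off_def power_prog_def)
      show "det (Seq ?c3 (Seq ?c4 ?c5)) s2 (1 + ((M * 5 + 1) + 2 + 1) + 1)
          (\<lambda>s'. nreg s' 16 = M \<and> nreg s' 17 = R)"
      proof (rule det_Seq)
        show "det ?c3 s2 1 (\<lambda>s'. rreg s' 9 = 1 \<and> agree_off {RR 9} s2 s')"
          using b2 by (intro det_loop_free) (auto simp: set_defs base_def agree_off_def)
        fix s3 assume 3: "rreg s3 9 = 1 \<and> agree_off {RR 9} s2 s3"
        have b3: "base s3" using 3 b2 by (auto intro: base_agree)
        show "det (Seq ?c4 ?c5) s3 ((M * 5 + 1) + 2 + 1) (\<lambda>s'. nreg s' 16 = M \<and> nreg s' 17 = R)"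
          by (rule det_Seq[OF 4]) (use 2 3 b3 n16 5 in \<open>auto simp: agree_off_def\<close>)
      qed
    qed
  qed
  then show ?thesis by (rule exec_mono) simp
qed

end

section \<open>Seeding rounds as programs\<close>

definition cap_loop_prog :: com where
  "cap_loop_prog = For 6 1 (RStore 3 6 0)"

definition trunc_body :: com where
  "trunc_body = Seq (Toss 9 2)
     (Branch (NLess 5 9) (Seq (RLoad 5 3 6) (Branch (RLess 3 5) (RLoad 3 3 6) Skip)) Skip)"

definition trunc_prog :: com where
  "trunc_prog = Seq (ROp RSub 3 3 3) (For 6 1 trunc_body)"

definition sample_body :: com where
  "sample_body = block
     [RLoad 5 3 6, Branch (RLess 3 5) (ROp RAdd 5 3 11) Skip, ROp RAdd 4 4 5, ROp RDiv 6 5 4, Toss 9 6,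
      Branch (NLess 5 9) (Seq (NOp NAdd 11 6 5) (NOp NAdd 12 10 5)) Skip, NOp NAdd 10 10 0]"

definition sample_prog :: com where
  "sample_prog = Seq (block [ROp RSub 4 4 4, NOp NAdd 11 1 5, NConst 10 0]) (For 6 1 sample_body)"

definition copy_body :: com where
  "copy_body = block [RLoad 8 0 13, RStore 10 15 8, NOp NAdd 13 13 4, NOp NAdd 15 15 4]"

definition dist_body :: com where
  "dist_body = block
     [RLoad 8 0 10, RLoad 9 0 13, ROp RSub 8 8 9, ROp RMul 8 8 8, ROp RAdd 7 7 8,
      NOp NAdd 10 10 4, NOp NAdd 13 13 4]"

definition update_body :: com where
  "update_body = Seq (block [ROp RSub 7 7 7, NOp NAdd 13 12 5]) (Seq (For 7 0 dist_body)
     (block [RLoad 5 3 6, Branch (RLess 7 5) (Seq (RStore 3 6 7) (NStore 0 6 14)) Skip]))"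

definition append_prog :: com where
  "append_prog = Seq (NOp NAdd 13 12 5) (Seq (For 7 0 copy_body) (Seq (NConst 10 0)
     (Seq (For 6 1 update_body) (NOp NAdd 14 14 4))))"

definition round_prog :: com where
  "round_prog = Seq trunc_prog (Seq sample_prog (Branch (NLess 11 1) append_prog Skip))"

lemmas body_defs = trunc_body_def sample_body_def copy_body_def dist_body_def update_body_def
lemmas round_defs = body_defs trunc_prog_def sample_prog_def append_prog_def round_prog_def

lemma rel_pmf_bind_same:
  assumes "\<And>b. b \<in> set_pmf p \<Longrightarrow> rel_pmf R (f b) (g b)"
  shows "rel_pmf R (bind_pmf p f) (bind_pmf p g)"
proof (rule rel_pmf_bindI)
  show "rel_pmf (\<lambda>x y. x = y \<and> x \<in> set_pmf p) p p" by (rule rel_pmf_reflI) simp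
qed (use assms in auto)

context kmeans_input
begin

lemma n_pos: "0 < n"
  using n2 unfolding n_def by linarith

lemma Q_nonneg: "0 \<le> Q"
  by (simp add: Q_def sum_nonneg)

lemma V_nonneg: "0 \<le> V"
  using Q_nonneg by (simp add: V_def)

lemma length_nth: "i < n \<Longrightarrow> length (xs ! i) = d"
  using subsetD[OF xs(2) nth_mem[of i]] by (simp add: n_def points_def)

lemma \<delta>_power2: "i < n \<Longrightarrow> (\<delta> i c)\<^sup>2 = (\<Sum>l<d. (xs ! i ! l - xs ! c ! l)\<^sup>2)"
  unfolding \<delta>_def by (rule pdist_power2) (rule length_nth)

lemma \<delta>_refl: "i < n \<Longrightarrow> \<delta> i i = 0"
  using \<delta>_power2[of i i] by simp

lemma cap_loop_prog:
  assumes s: "base s" "rreg s 0 = V"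
  shows "det cap_loop_prog s (n * 5 + 3) (\<lambda>s'. \<forall>i<n. rarr s' 3 i = V)"
  unfolding cap_loop_prog_def
proof (rule det_For[where tb = 1 and J = "\<lambda>j s'. \<forall>i<j. rarr s' 3 i = V"])
  fix j s' assume "\<forall>i<j. rarr s' 3 i = V" "nreg s' 6 = j"
    and fr: "agree_off (insert (NR 6) (writes (RStore 3 6 0))) s s'"
  then show "det (RStore 3 6 0) s' 1 (\<lambda>s''. \<forall>i<Suc j. rarr (set_nreg 6 (Suc j) s'') 3 i = V)"
    using s by (intro det_loop_free) (auto simp: agree_off_def set_defs less_Suc_eq)
qed (use s in \<open>auto simp: set_defs base_def\<close>)

lemma trunc_prog:
  assumes s: "base s" "rreg s 2 = r" "\<And>i. i < n \<Longrightarrow> rarr s 3 i = Ds i"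
  shows "exec trunc_prog s (n * 12 + 5) (itr (max_step r Ds) 0 n 0) (\<lambda>\<tau> s'. rreg s' 3 = \<tau>)"
proof -
  have loop: "exec (For 6 1 trunc_body) s' (n * 12 + 3) (itr (max_step r Ds) 0 n 0) (\<lambda>\<tau> s'. rreg s' 3 = \<tau>)"
    if s': "rreg s' 3 = 0" "agree_off {RR 3} s s'" for s'
  proof (rule exec_For[where tb = 8 and J = "\<lambda>j \<tau> s'. rreg s' 3 = \<tau>"])
    fix j \<tau> s'' assume j: "j < n" "rreg s'' 3 = \<tau>" "nreg s'' 6 = j"
      and fr: "agree_off (insert (NR 6) (writes trunc_body)) s' s''"
    have s'': "rreg s'' 2 = r" "rarr s'' 3 j = Ds j" "nreg s'' 5 = 0"
      using fr s' s j by (auto simp: agree_off_def trunc_body_def base_def)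
    show "exec trunc_body s'' 8 (max_step r Ds j \<tau>) (\<lambda>\<tau>' s3. rreg (set_nreg 6 (Suc j) s3) 3 = \<tau>')"
    proof (rule exec_loop_free)
      show "rel_pmf (\<lambda>\<tau>' s3. rreg (set_nreg 6 (Suc j) s3) 3 = \<tau>') (max_step r Ds j \<tau>) (denot trunc_body s'')"
        using s'' j
        by (auto simp: max_step_def trunc_body_def bind_assoc_pmf bind_return_pmf set_defs
              intro!: rel_pmf_bind_same)
    qed (simp_all add: trunc_body_def)
  qed (use s s' in \<open>auto simp: trunc_body_def set_defs base_def agree_off_def\<close>)
  have "exec trunc_prog s (1 + (n * 12 + 3) + 1) (itr (max_step r Ds) 0 n 0) (\<lambda>\<tau> s'. rreg s' 3 = \<tau>)"
    unfolding trunc_prog_def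
  proof (rule det_Seq)
    show "det (ROp RSub 3 3 3) s 1 (\<lambda>s'. rreg s' 3 = 0 \<and> agree_off {RR 3} s s')"
      by (intro det_loop_free) (auto simp: set_defs agree_off_def)
  qed (use loop in auto)
  then show ?thesis by (simp add: add.commute)
qed

text \<open>Positivity of \<open>u c\<close> is recorded because it keeps seeds distinct: an earlier
  seed is at distance 0 from itself. It holds since an item of weight 0 has toss probability
  0.\<close>

lemma sample_prog:
  assumes s: "base s" "rreg s 3 = \<tau>" "\<And>i. i < n \<Longrightarrow> rarr s 3 i = Ds i"
  defines "u \<equiv> \<lambda>i. min (Ds i) \<tau>"
  assumes u: "\<And>i. i < n \<Longrightarrow> 0 \<le> u i"
  shows "exec sample_prog s (n * 21 + 9) (itr (reservoir_step u) 0 n n)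
    (\<lambda>c s'. nreg s' 11 = c \<and> (c < n \<longrightarrow> nreg s' 12 = c * d \<and> 0 < u c))"
proof -
  let ?J = "\<lambda>j c s'. rreg s' 4 = (\<Sum>i<j. u i) \<and> nreg s' 10 = j * d \<and> nreg s' 11 = c \<and>
    (c < n \<longrightarrow> nreg s' 12 = c * d \<and> 0 < u c)"
  have loop: "exec (For 6 1 sample_body) s' (n * 21 + 3) (itr (reservoir_step u) 0 n n) (?J n)"
    if s': "rreg s' 4 = 0" "nreg s' 11 = n" "nreg s' 10 = 0" "agree_off {RR 4, NR 11, NR 10} s s'" for s'
  proof (rule exec_For[where tb = 17 and J = "?J"])
    fix j c s'' assume j: "j < n" "?J j c s''" "nreg s'' 6 = j"
      and fr: "agree_off (insert (NR 6) (writes sample_body)) s' s''"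
    have s'': "rreg s'' 3 = \<tau>" "rarr s'' 3 j = Ds j" "nreg s'' 5 = 0" "rreg s'' 11 = 0" "nreg s'' 0 = d"
      using fr s' s j by (auto simp: agree_off_def sample_body_def base_def)
    have pos: "0 < u j" if "True \<in> set_pmf (bernoulli_pmf (u j / (\<Sum>i<Suc j. u i)))"
    proof (rule ccontr)
      assume "\<not> 0 < u j"
      then have "u j = 0" using u j by force
      then have "pmf (bernoulli_pmf (u j / (\<Sum>i<Suc j. u i))) True = 0" by simp
      then show False using that by (simp add: set_pmf_iff)
    qed
    show "exec sample_body s'' 17 (reservoir_step u j c) (\<lambda>c' s3. ?J (Suc j) c' (set_nreg 6 (Suc j) s3))"
    proof (rule exec_loop_free)
      show "rel_pmf (\<lambda>c' s3. ?J (Suc j) c' (set_nreg 6 (Suc j) s3)) (reservoir_step u j c) (denot sample_body s'')"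
      proof (cases "\<tau> < Ds j")
        case True
        then have uj: "u j = \<tau>" by (simp add: u_def)
        then have uj': "u (nreg s'' 6) = rreg s'' 3" using j s'' by simp
        show ?thesis
          using s'' j True pos unfolding reservoir_step_def uj
          by (auto simp: sample_body_def bind_assoc_pmf bind_return_pmf set_defs uj uj' add.commute
              intro!: rel_pmf_bind_same)
      next
        case False
        then have uj: "u j = Ds j" by (simp add: u_def)
        then have uj': "u (nreg s'' 6) = Ds (nreg s'' 6)" using j by simp
        show ?thesis
          using s'' j False pos unfolding reservoir_step_def uj
          by (auto simp: sample_body_def bind_assoc_pmf bind_return_pmf set_defs uj uj' add.commute
              intro!: rel_pmf_bind_same)
      qed
    qed (simp_all add: sample_body_def)
  qed (use s s' in \<open>auto simp: sample_body_def set_defs base_def agree_off_def\<close>)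
  have "exec sample_prog s (5 + (n * 21 + 3) + 1) (itr (reservoir_step u) 0 n n) (?J n)"
    unfolding sample_prog_def
  proof (rule det_Seq)
    show "det (block [ROp RSub 4 4 4, NOp NAdd 11 1 5, NConst 10 0]) s 5
      (\<lambda>s'. rreg s' 4 = 0 \<and> nreg s' 11 = n \<and> nreg s' 10 = 0 \<and> agree_off {RR 4, NR 11, NR 10} s s')"
      using s by (intro det_loop_free) (auto simp: set_defs agree_off_def base_def bind_return_pmf)
  qed (use loop in auto)
  then have "exec sample_prog s (n * 21 + 9) (itr (reservoir_step u) 0 n n) (?J n)" by (simp add: add.commute)
  then show ?thesis by (rule exec_conseq) auto
qed

lemma copy_loop:
  assumes s: "base s" "nreg s 13 = c * d" "nreg s 15 = m * d" "c < n"
  shows "det (For 7 0 copy_body) s (d * 11 + 3) (\<lambda>s'. nreg s' 15 = m * d + d \<and>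
    rarr s' 10 = (\<lambda>i. if m * d \<le> i \<and> i < m * d + d then xs ! c ! (i - m * d) else rarr s 10 i))"
proof -
  let ?J = "\<lambda>l s'. nreg s' 13 = c * d + l \<and> nreg s' 15 = m * d + l \<and>
    rarr s' 10 = (\<lambda>i. if m * d \<le> i \<and> i < m * d + l then xs ! c ! (i - m * d) else rarr s 10 i)"
  have "det (For 7 0 copy_body) s (d * 11 + 3) (?J d)"
  proof (rule det_For[where tb = 7 and J = ?J])
    fix l s' assume l: "l < d" and J: "?J l s'" and fr: "agree_off (insert (NR 7) (writes copy_body)) s s'"
    have "base s'" using fr s(1) by (rule base_agree) (simp add: copy_body_def)
    then show "det copy_body s' 7 (\<lambda>s''. ?J (Suc l) (set_nreg 7 (Suc l) s''))"
      using J l s by (intro det_loop_free) (auto simp: copy_body_def set_defs base_def bind_return_pmf fun_eq_iff)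
  qed (use s in \<open>auto simp: copy_body_def set_defs base_def\<close>)
  then show ?thesis by (rule exec_conseq) auto
qed

lemma dist_loop:
  assumes s: "base s" "nreg s 10 = i * d" "nreg s 13 = c * d" "rreg s 7 = 0" "i < n" "c < n"
  shows "det (For 7 0 dist_body) s (d * 17 + 3) (\<lambda>s'. nreg s' 10 = i * d + d \<and> rreg s' 7 = (\<delta> i c)\<^sup>2)"
proof -
  let ?J = "\<lambda>l s'. nreg s' 10 = i * d + l \<and> nreg s' 13 = c * d + l \<and>
    rreg s' 7 = (\<Sum>l'<l. (xs ! i ! l' - xs ! c ! l')\<^sup>2)"
  have "det (For 7 0 dist_body) s (d * 17 + 3) (?J d)"
  proof (rule det_For[where tb = 13 and J = ?J])
    fix l s' assume l: "l < d" and J: "?J l s'" and fr: "agree_off (insert (NR 7) (writes dist_body)) s s'"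
    have "base s'" using fr s(1) by (rule base_agree) (simp add: dist_body_def)
    then show "det dist_body s' 13 (\<lambda>s''. ?J (Suc l) (set_nreg 7 (Suc l) s''))"
      using J l s by (intro det_loop_free)
        (auto simp: dist_body_def set_defs base_def bind_return_pmf power2_eq_square)
  qed (use s in \<open>auto simp: dist_body_def set_defs base_def\<close>)
  then show ?thesis by (rule exec_conseq) (use s \<delta>_power2 in auto)
qed

text \<open>Distinctness of seeds and the zero tail of array 10 are kept because \<open>A\<close>
  expects distinct points in an array that is zero beyond them.\<close>

definition seeded :: "nat list \<Rightarrow> state \<Rightarrow> bool" where
  "seeded cs s \<longleftrightarrow> nreg s 14 = length cs \<and> nreg s 15 = length cs * d \<and>
     (\<forall>i<n. rarr s 3 i = D cs i \<and> narr s 0 i = nearest_seed \<delta> V cs i) \<and>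
     (\<forall>j<length cs. \<forall>l<d. rarr s 10 (j * d + l) = xs ! (rev cs ! j) ! l) \<and>
     (\<forall>i\<ge>length cs * d. rarr s 10 i = 0) \<and> distinct cs \<and> set cs \<subseteq> {..<n}"

text \<open>Register 14 still holds the number of the earlier seeds, which is the number of the new
  one.\<close>

lemma update_loop:
  assumes s: "base s" "nreg s 10 = 0" "nreg s 12 = c * d" "nreg s 14 = length cs" "c < n"
    "\<And>i. i < n \<Longrightarrow> rarr s 3 i = D cs i \<and> narr s 0 i = nearest_seed \<delta> V cs i"
  shows "det (For 6 1 update_body) s (n * (d * 17 + 18) + 3)
    (\<lambda>s'. \<forall>i<n. rarr s' 3 i = D (c # cs) i \<and> narr s' 0 i = nearest_seed \<delta> V (c # cs) i)"
proof -
  let ?J = "\<lambda>j s'. nreg s' 10 = j * d \<and> (\<forall>i<n. rarr s' 3 i = (if i < j then D (c # cs) i else D cs i) \<and>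
    narr s' 0 i = (if i < j then nearest_seed \<delta> V (c # cs) i else nearest_seed \<delta> V cs i))"
  have "det (For 6 1 update_body) s (n * (d * 17 + 18) + 3) (?J n)"
  proof (rule det_For[where tb = "d * 17 + 14" and J = ?J])
    fix j s' assume j: "j < n" and J: "?J j s'" and j6: "nreg s' 6 = j"
      and fr: "agree_off (insert (NR 6) (writes update_body)) s s'"
    have b: "base s'" using fr s(1) by (rule base_agree) (simp add: body_defs)
    have r: "nreg s' 12 = c * d" "nreg s' 14 = length cs" using fr s by (auto simp: agree_off_def body_defs)
    have "det update_body s' (3 + ((d * 17 + 3) + 6 + 1) + 1) (\<lambda>s''. ?J (Suc j) (set_nreg 6 (Suc j) s''))"
      unfolding update_body_def
    proof (rule det_Seq)
      show "det (block [ROp RSub 7 7 7, NOp NAdd 13 12 5]) s' 3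
          (\<lambda>s1. rreg s1 7 = 0 \<and> nreg s1 13 = c * d \<and> agree_off {RR 7, NR 13} s' s1)"
        using b r by (intro det_loop_free) (auto simp: set_defs base_def agree_off_def bind_return_pmf)
      fix s1 assume s1: "rreg s1 7 = 0 \<and> nreg s1 13 = c * d \<and> agree_off {RR 7, NR 13} s' s1"
      have b1: "base s1" using s1 b by (auto intro: base_agree)
      have "det (For 7 0 dist_body) s1 (d * 17 + 3) (\<lambda>s'. nreg s' 10 = j * d + d \<and> rreg s' 7 = (\<delta> j c)\<^sup>2)"
        using s1 b1 J j s by (intro dist_loop) (auto simp: agree_off_def)
      from exec_frame[OF this]
      show "det (Seq (For 7 0 dist_body) (block [RLoad 5 3 6, Branch (RLess 7 5) (Seq (RStore 3 6 7) (NStore 0 6 14)) Skip]))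
          s1 ((d * 17 + 3) + 6 + 1) (\<lambda>s''. ?J (Suc j) (set_nreg 6 (Suc j) s''))"
      proof (rule det_Seq)
        fix s2 assume s2: "(nreg s2 10 = j * d + d \<and> rreg s2 7 = (\<delta> j c)\<^sup>2) \<and> agree_off (writes (For 7 0 dist_body)) s1 s2"
        have same: "rarr s2 3 = rarr s' 3" "narr s2 0 = narr s' 0" "nreg s2 6 = j" "nreg s2 14 = length cs"
          using s1 s2 j6 r by (auto simp: agree_off_def dist_body_def)
        have old: "rarr s' 3 j = D cs j" "narr s' 0 j = nearest_seed \<delta> V cs j" using J j by auto
        show "det (block [RLoad 5 3 6, Branch (RLess 7 5) (Seq (RStore 3 6 7) (NStore 0 6 14)) Skip]) s2 6
            (\<lambda>s''. ?J (Suc j) (set_nreg 6 (Suc j) s''))"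
        proof (rule det_loop_free)
          fix s3
          assume s3: "s3 \<in> set_pmf (denot (block [RLoad 5 3 6,
            Branch (RLess 7 5) (Seq (RStore 3 6 7) (NStore 0 6 14)) Skip]) s2)"
          have "nreg s3 10 = Suc j * d \<and> rarr s3 3 = (rarr s' 3)(j := D (c # cs) j) \<and>
            narr s3 0 = (narr s' 0)(j := nearest_seed \<delta> V (c # cs) j)"
          proof (cases "(\<delta> j c)\<^sup>2 < D cs j")
            case True
            then show ?thesis using s3 s2 same old by (simp add: set_defs bind_return_pmf min_def)
          next
            case False
            then have "D (c # cs) j = rarr s' 3 j" "nearest_seed \<delta> V (c # cs) j = narr s' 0 j"
              using old by (simp_all add: min_def)
            then show ?thesis using False s3 s2 same old
              by (simp add: set_defs bind_return_pmf fun_eq_iff del: center_sqdist.simps nearest_seed.simps)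
          qed
          then show "?J (Suc j) (set_nreg 6 (Suc j) s3)" using J
            by (simp add: set_nreg_def less_Suc_eq del: center_sqdist.simps nearest_seed.simps)
        qed simp_all
      qed
    qed
    then show "det update_body s' (d * 17 + 14) (\<lambda>s''. ?J (Suc j) (set_nreg 6 (Suc j) s''))"
      by (rule exec_mono) simp
  qed (use s in \<open>auto simp: body_defs set_defs base_def\<close>)
  then show ?thesis by (rule exec_conseq) auto
qed

lemma append_prog:
  assumes s: "base s" "seeded cs s" "nreg s 12 = c * d" "c < n" "c \<notin> set cs"
  shows "det append_prog s (n * (d * 17 + 18) + d * 11 + 13) (seeded (c # cs))"
proof -
  let ?m = "length cs"
  let ?c1 = "NOp NAdd 13 12 5" and ?c2 = "For 7 0 copy_body" and ?c3 = "NConst 10 0"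
  let ?c4 = "For 6 1 update_body" and ?c5 = "NOp NAdd 14 14 4"
  have "det append_prog s (1 + ((d * 11 + 3) + (1 + ((n * (d * 17 + 18) + 3) + 1 + 1) + 1) + 1) + 1) (seeded (c # cs))"
    unfolding append_prog_def
  proof (rule det_Seq)
    show "det ?c1 s 1 (\<lambda>s1. nreg s1 13 = c * d \<and> agree_off {NR 13} s s1)"
      using s by (intro det_loop_free) (auto simp: set_defs base_def agree_off_def)
    fix s1 assume s1: "nreg s1 13 = c * d \<and> agree_off {NR 13} s s1"
    have b1: "base s1" using s1 s(1) by (auto intro: base_agree)
    have "det ?c2 s1 (d * 11 + 3) (\<lambda>s'. nreg s' 15 = ?m * d + d \<and>
        rarr s' 10 = (\<lambda>i. if ?m * d \<le> i \<and> i < ?m * d + d then xs ! c ! (i - ?m * d) else rarr s1 10 i))"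
      using s1 b1 s by (intro copy_loop) (auto simp: agree_off_def seeded_def)
    from exec_frame[OF this]
    show "det (Seq ?c2 (Seq ?c3 (Seq ?c4 ?c5))) s1 ((d * 11 + 3) + (1 + ((n * (d * 17 + 18) + 3) + 1 + 1) + 1) + 1) (seeded (c # cs))"
    proof (rule det_Seq)
      fix s2 assume s2: "(nreg s2 15 = ?m * d + d \<and>
        rarr s2 10 = (\<lambda>i. if ?m * d \<le> i \<and> i < ?m * d + d then xs ! c ! (i - ?m * d) else rarr s1 10 i)) \<and>
        agree_off (writes ?c2) s1 s2"
      have b2: "base s2" using s2 b1 by (auto intro: base_agree simp: copy_body_def)
      have arr2: "rarr s2 10 = (\<lambda>i. if ?m * d \<le> i \<and> i < ?m * d + d then xs ! c ! (i - ?m * d) else rarr s 10 i)"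
        using s1 s2 by (auto simp: agree_off_def)
      have same2: "nreg s2 12 = c * d" "nreg s2 14 = ?m" "rarr s2 3 = rarr s 3" "narr s2 0 = narr s 0"
        using s1 s2 s by (auto simp: agree_off_def copy_body_def seeded_def)
      show "det (Seq ?c3 (Seq ?c4 ?c5)) s2 (1 + ((n * (d * 17 + 18) + 3) + 1 + 1) + 1) (seeded (c # cs))"
      proof (rule det_Seq)
        show "det ?c3 s2 1 (\<lambda>s3. nreg s3 10 = 0 \<and> agree_off {NR 10} s2 s3)"
          by (intro det_loop_free) (auto simp: set_defs agree_off_def)
        fix s3 assume s3: "nreg s3 10 = 0 \<and> agree_off {NR 10} s2 s3"
        have b3: "base s3" using s3 b2 by (auto intro: base_agree)
        have "det ?c4 s3 (n * (d * 17 + 18) + 3)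
            (\<lambda>s'. \<forall>i<n. rarr s' 3 i = D (c # cs) i \<and> narr s' 0 i = nearest_seed \<delta> V (c # cs) i)"
          using s3 b3 same2 s by (intro update_loop) (auto simp: agree_off_def seeded_def)
        from exec_frame[OF this]
        show "det (Seq ?c4 ?c5) s3 ((n * (d * 17 + 18) + 3) + 1 + 1) (seeded (c # cs))"
        proof (rule det_Seq)
          fix s4 assume s4: "(\<forall>i<n. rarr s4 3 i = D (c # cs) i \<and> narr s4 0 i = nearest_seed \<delta> V (c # cs) i) \<and>
            agree_off (writes ?c4) s3 s4"
          have same4: "nreg s4 14 = ?m" "nreg s4 15 = Suc ?m * d" "nreg s4 4 = 1"
              "rarr s4 10 = (\<lambda>i. if ?m * d \<le> i \<and> i < ?m * d + d then xs ! c ! (i - ?m * d) else rarr s 10 i)"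
            using s4 s3 s2 same2 arr2 b3 by (auto simp: agree_off_def body_defs base_def)
          have new: "rarr s4 10 (j * d + l) = xs ! ((rev cs @ [c]) ! j) ! l" if "j < Suc ?m" "l < d" for j l
          proof (cases "j < ?m")
            case True
            then have "Suc j * d \<le> ?m * d" by (intro mult_le_mono1) simp
            then have "j * d + l < ?m * d" using that by simp
            then show ?thesis using True that s(2) by (simp add: same4 nth_append seeded_def)
          next
            case False
            then have "j = ?m" using that by simp
            then show ?thesis using that by (simp add: same4 nth_append)
          qed
          have "rarr s4 10 i = 0" if "Suc ?m * d \<le> i" for i
            using that s(2) by (simp add: same4 seeded_def)
          then show "det ?c5 s4 1 (seeded (c # cs))"
            using new s4 same4 s by (intro det_loop_free) (auto simp: set_defs seeded_def)
        qed
      qed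
    qed
  qed
  then show ?thesis by (rule exec_mono) simp
qed

lemma round_prog:
  assumes s: "base s" "seeded cs s" "rreg s 2 = 1 / real (8 * z + 1)"
  shows "exec round_prog s (n * (d * 17 + 51) + d * 11 + 30) (seed_round n z \<delta> V cs)
    (\<lambda>cs' s'. seeded cs' s' \<and> length cs' \<le> Suc (length cs))"
proof -
  let ?r = "1 / real (8 * z + 1)"
  let ?T = "n * (d * 17 + 18) + d * 11 + 13"
  have D0: "0 \<le> D cs i" for i by (induction cs) (auto simp: V_nonneg)
  have max0: "set_pmf (itr (max_step r (D cs)) 0 m 0) \<subseteq> {0..}" for r m
  proof (induction m)
    case (Suc m)
    have "set_pmf (max_step r (D cs) m x) \<subseteq> {D cs m, x}" for x by (auto simp: max_step_def)
    then show ?case unfolding itr_Suc_last set_bind_pmf using Suc D0[of m] by fastforce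
  qed simp
  have "exec round_prog s ((n * 12 + 5) + ((n * 21 + 9) + (?T + 1) + 1) + 1) (seed_round n z \<delta> V cs)
    (\<lambda>cs' s'. seeded cs' s' \<and> length cs' \<le> Suc (length cs))"
    unfolding round_prog_def seed_round_def
  proof (rule exec_Seq[OF exec_frame])
    show "exec trunc_prog s (n * 12 + 5) (itr (max_step ?r (D cs)) 0 n 0) (\<lambda>\<tau> s'. rreg s' 3 = \<tau>)"
      using s by (intro trunc_prog) (auto simp: seeded_def)
    fix \<tau> s1 assume \<tau>: "\<tau> \<in> set_pmf (itr (max_step ?r (D cs)) 0 n 0)"
      and s1: "rreg s1 3 = \<tau> \<and> agree_off (writes trunc_prog) s s1"
    have \<tau>0: "0 \<le> \<tau>" using max0 \<tau> by auto
    have b1: "base s1" using s1 s(1) by (auto intro: base_agree simp: trunc_body_def trunc_prog_def)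
    have sd1: "seeded cs s1" using s1 s(2) by (auto simp: seeded_def agree_off_def trunc_body_def trunc_prog_def)
    show "exec (Seq sample_prog (Branch (NLess 11 1) append_prog Skip)) s1 ((n * 21 + 9) + (?T + 1) + 1)
       (bind_pmf (itr (reservoir_step (\<lambda>i. min (D cs i) \<tau>)) 0 n n) (\<lambda>c. return_pmf (if c < n then c # cs else cs)))
       (\<lambda>cs' s'. seeded cs' s' \<and> length cs' \<le> Suc (length cs))"
    proof (rule exec_Seq[OF exec_frame])
      show "exec sample_prog s1 (n * 21 + 9) (itr (reservoir_step (\<lambda>i. min (D cs i) \<tau>)) 0 n n)
        (\<lambda>c s'. nreg s' 11 = c \<and> (c < n \<longrightarrow> nreg s' 12 = c * d \<and> 0 < min (D cs c) \<tau>))"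
        using s1 sd1 b1 D0 \<tau>0 by (intro sample_prog) (auto simp: seeded_def)
      fix c s2 assume s2: "(nreg s2 11 = c \<and> (c < n \<longrightarrow> nreg s2 12 = c * d \<and> 0 < min (D cs c) \<tau>)) \<and>
         agree_off (writes sample_prog) s1 s2"
      have b2: "base s2" using s2 b1 by (auto intro: base_agree simp: sample_body_def sample_prog_def)
      have sd2: "seeded cs s2" using s2 sd1 by (auto simp: seeded_def agree_off_def sample_body_def sample_prog_def)
      \<comment> \<open>A seed has squared distance 0 to the seeds and is therefore never drawn
        again.\<close>
      have c_new: "c \<notin> set cs" if "c < n" "0 < D cs c"
      proof
        assume "c \<in> set cs"
        then have "D cs c \<le> (\<delta> c c)\<^sup>2" by (induction cs) auto
        then show False using that \<delta>_refl by simp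
      qed
      show "exec (Branch (NLess 11 1) append_prog Skip) s2 (?T + 1) (return_pmf (if c < n then c # cs else cs))
        (\<lambda>cs' s'. seeded cs' s' \<and> length cs' \<le> Suc (length cs))"
      proof (rule exec_Branch)
        assume "test_val (NLess 11 1) s2"
        then have c: "c < n" using s2 b2 by (simp add: base_def)
        then have "det append_prog s2 ?T (seeded (c # cs))"
          using s2 b2 sd2 c_new by (intro append_prog) auto
        then show "exec append_prog s2 ?T (return_pmf (if c < n then c # cs else cs))
          (\<lambda>cs' s'. seeded cs' s' \<and> length cs' \<le> Suc (length cs))"
          using c by (simp add: exec_def rel_pmf_return_pmf1)
      next
        assume "\<not> test_val (NLess 11 1) s2"
        then have c: "\<not> c < n" using s2 b2 by (simp add: base_def)
        then show "exec Skip s2 ?T (return_pmf (if c < n then c # cs else cs))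
          (\<lambda>cs' s'. seeded cs' s' \<and> length cs' \<le> Suc (length cs))"
          using sd2 by (intro det_loop_free) auto
      qed
    qed
  qed
  then show ?thesis by (rule exec_mono) (simp add: algebra_simps)
qed

lemma seeding_loop:
  assumes s: "base s" "seeded [] s" "rreg s 2 = 1 / real (8 * z + 1)" "nreg s 17 = R"
  shows "exec (For 8 17 round_prog) s (R * (n * (d * 17 + 51) + d * 11 + 34) + 3)
    (itr (\<lambda>_. seed_round n z \<delta> V) 0 R []) (\<lambda>cs s'. seeded cs s' \<and> length cs \<le> R)"
proof (rule exec_For[where tb = "n * (d * 17 + 51) + d * 11 + 30" and
      J = "\<lambda>j cs s'. seeded cs s' \<and> length cs \<le> j"])
  fix j cs s' assume "seeded cs s' \<and> length cs \<le> j"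
    and fr: "agree_off (insert (NR 8) (writes round_prog)) s s'"
  have b: "base s'" using fr s(1) by (rule base_agree) (simp add: round_defs)
  have "rreg s' 2 = 1 / real (8 * z + 1)" using fr s by (simp add: agree_off_def round_defs)
  then have "exec round_prog s' (n * (d * 17 + 51) + d * 11 + 30) (seed_round n z \<delta> V cs)
    (\<lambda>cs' s'. seeded cs' s' \<and> length cs' \<le> Suc (length cs))"
    using b \<open>seeded cs s' \<and> _\<close> by (intro round_prog) auto
  then show "exec round_prog s' (n * (d * 17 + 51) + d * 11 + 30) (seed_round n z \<delta> V cs)
    (\<lambda>cs' s''. seeded cs' (set_nreg 8 (Suc j) s'') \<and> length cs' \<le> Suc j)"
    by (rule exec_conseq) (use \<open>seeded cs s' \<and> _\<close> in \<open>auto simp: seeded_def set_defs\<close>)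
qed (use s in \<open>auto simp: round_defs set_defs base_def seeded_def algebra_simps\<close>)

end

section \<open>Weights, padding and the call of the given algorithm\<close>

definition count_body :: com where
  "count_body = block [NLoad 20 0 6, NLoad 9 1 20, NOp NAdd 9 9 4, NStore 1 20 9]"

definition weight_body :: com where
  "weight_body = block [NLoad 20 1 6, Branch (NLess 18 20) (Seq (ROfNat 8 20) (RStore 11 6 8)) Skip]"

definition pad_body :: com where
  "pad_body = block [RStore 10 15 0, ROp RAdd 0 0 10, NOp NAdd 15 15 0, NOp NAdd 14 14 4]"

definition call_prog :: com where
  "call_prog = block [NOp NAdd 100 0 5, NOp NAdd 101 16 5, NOp NAdd 102 2 5]"

definition finish_prog :: com where
  "finish_prog = Seq (For 6 1 count_body) (Seq (For 6 14 weight_body)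
     (Seq (While (NLess 14 16) pad_body) call_prog))"

definition prep_prog :: com where
  "prep_prog = Seq init_prog (Seq cap_prog (Seq size_prog (Seq cap_loop_prog
     (Seq (For 8 17 round_prog) finish_prog))))"

lemmas finish_defs = count_body_def weight_body_def pad_body_def call_prog_def finish_prog_def

text \<open>The offsets lie beyond all locations that the preparation works on, so \<open>A\<close>
  sees its arguments and otherwise zeros.\<close>

definition shift_reg :: "nat \<Rightarrow> nat" where
  "shift_reg r = r + 100"

definition shift_narr :: "nat \<Rightarrow> nat" where
  "shift_narr a = a + 10"

text \<open>Array 2 stays in place, so that \<open>A\<close> writes its output where it is expected.\<close>

definition shift_rarr :: "nat \<Rightarrow> nat" where
  "shift_rarr a = (if a = 2 then 2 else a + 10)"

lemma inj_shift: "inj shift_reg" "inj shift_narr" "inj shift_rarr"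
  by (auto simp: inj_def shift_reg_def shift_narr_def shift_rarr_def split: if_splits)

abbreviation shifted_view :: "state \<Rightarrow> state" where
  "shifted_view \<equiv> view shift_reg shift_reg shift_narr shift_rarr"

abbreviation shifted :: "com \<Rightarrow> com" where
  "shifted \<equiv> rename shift_reg shift_reg shift_narr shift_rarr"

lemma nat_cases_3:
  fixes r :: nat
  obtains "r = 0" | "r = 1" | "r = 2" | r' where "r = r' + 3"
proof (cases "r < 3")
  case True
  then have "r = 0 \<or> r = 1 \<or> r = 2" by linarith
  then show ?thesis using that by blast
next
  case False
  then show ?thesis using that(4)[of "r - 3"] by simp
qed

lemma exec_return_pmf: "exec c s t (return_pmf a) R \<longleftrightarrow> det c s t (R a)"
  by (simp add: exec_def rel_pmf_return_pmf1)

definition encodes :: "nat \<Rightarrow> point list \<Rightarrow> (nat \<Rightarrow> real) \<Rightarrow> bool" where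
  "encodes d ps a \<longleftrightarrow> (\<forall>j<length ps. \<forall>l<d. a (j * d + l) = ps ! j ! l) \<and> (\<forall>i\<ge>length ps * d. a i = 0)"

lemma encodes_append:
  assumes "encodes d ps a" "1 \<le> d"
  shows "encodes d (ps @ [v # replicate (d - 1) 0]) (a(length ps * d := v))"
proof -
  have "(a(length ps * d := v)) (j * d + l) = (ps @ [v # replicate (d - 1) 0]) ! j ! l"
    if "j < Suc (length ps)" "l < d" for j l
  proof (cases "j < length ps")
    case True
    then have "Suc j * d \<le> length ps * d" by (intro mult_le_mono1) simp
    then have "j * d + l < length ps * d" using that by simp
    then show ?thesis using assms that True by (auto simp: encodes_def nth_append)
  next
    case False
    then have "j = length ps" using that by simp
    then show ?thesis using assms that by (cases l) (auto simp: encodes_def)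
  qed
  then show ?thesis using assms by (auto simp: encodes_def)
qed

lemma encodes_eq:
  assumes "encodes d ps a" "1 \<le> d"
  shows "a = (\<lambda>i. if i < length ps * d then ps ! (i div d) ! (i mod d) else 0)"
proof
  fix i
  have "a (i div d * d + i mod d) = ps ! (i div d) ! (i mod d)" if "i < length ps * d"
  proof -
    have "i div d < length ps" using that assms(2) by (simp add: less_mult_imp_div_less)
    moreover have "i mod d < d" using assms(2) by simp
    ultimately show ?thesis using assms(1) unfolding encodes_def by blast
  qed
  then show "a i = (if i < length ps * d then ps ! (i div d) ! (i mod d) else 0)"
    using assms(1) by (auto simp: encodes_def)
qed

context kmeans_input
begin

text \<open>The seeds in memory order, then padding points on the first axis at coordinates from
  \<open>V\<close> upwards, beyond every input point.\<close>

definition seed_points :: "nat list \<Rightarrow> nat \<Rightarrow> point list" where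
  "seed_points cs j = map ((!) xs) (rev cs) @ map (\<lambda>i. (V + real i) # replicate (d - 1) 0) [0..<j]"

definition seed_of :: "nat list \<Rightarrow> nat \<Rightarrow> point" where
  "seed_of cs i = xs ! (rev cs ! nearest_seed \<delta> V cs i)"

text \<open>With no seeds, \<open>seed_of\<close> has no meaningful value; the guard then makes all
  weights 0, which is what the program stores.\<close>

definition seed_weight :: "nat list \<Rightarrow> point \<Rightarrow> real" where
  "seed_weight cs p =
     (if cs \<noteq> [] \<and> 32 * z < card {i. i < n \<and> seed_of cs i = p} then real (card {i. i < n \<and> seed_of cs i = p}) else 0)"

lemma row_le_Q:
  assumes "i < n"
  shows "(\<Sum>l<d. (xs ! i ! l)\<^sup>2) \<le> Q"
  unfolding Q_def using assms by (intro member_le_sum) (auto intro: sum_nonneg)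

lemma \<delta>_power2_le:
  assumes "i < n" "c < n"
  shows "(\<delta> i c)\<^sup>2 \<le> 4 * Q"
proof -
  have "(\<delta> i c)\<^sup>2 \<le> (\<Sum>l<d. 2 * (xs ! i ! l)\<^sup>2 + 2 * (xs ! c ! l)\<^sup>2)"
    unfolding \<delta>_power2[OF assms(1)]
  proof (rule sum_mono)
    fix l
    show "(xs ! i ! l - xs ! c ! l)\<^sup>2 \<le> 2 * (xs ! i ! l)\<^sup>2 + 2 * (xs ! c ! l)\<^sup>2"
      using power2_sum_le[of "xs ! i ! l" "- (xs ! c ! l)"] by simp
  qed
  also have "\<dots> = 2 * (\<Sum>l<d. (xs ! i ! l)\<^sup>2) + 2 * (\<Sum>l<d. (xs ! c ! l)\<^sup>2)"
    by (simp add: sum.distrib sum_distrib_left)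
  also have "\<dots> \<le> 4 * Q" using row_le_Q[OF assms(1)] row_le_Q[OF assms(2)] by simp
  finally show ?thesis .
qed

lemma V_ge: "544 * (Q + 1) \<le> V"
proof -
  have "544 * (Q + 1) * 1 \<le> 544 * (Q + 1) * real n"
    using Q_nonneg n_pos by (intro mult_left_mono) auto
  then show ?thesis by (simp add: V_def mult.commute)
qed

lemma \<delta>_less_V: "i < n \<Longrightarrow> c < n \<Longrightarrow> (\<delta> i c)\<^sup>2 < V"
  using \<delta>_power2_le[of i c] V_ge Q_nonneg by simp

lemma coordinate_less_V:
  assumes "i < n"
  shows "xs ! i ! 0 < V"
proof -
  have "(xs ! i ! 0)\<^sup>2 \<le> (\<Sum>l<d. (xs ! i ! l)\<^sup>2)" using d by (intro member_le_sum) auto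
  then have "(xs ! i ! 0)\<^sup>2 \<le> Q" using row_le_Q[OF assms] by simp
  \<comment> \<open>From \<open>(x - 1 / 2)^2 \<ge> 0\<close>; it turns a bound on squares into one
    on coordinates.\<close>
  moreover have "xs ! i ! 0 \<le> (xs ! i ! 0)\<^sup>2 + 1 / 4"
    using zero_le_power2[of "xs ! i ! 0 - 1 / 2"] by (simp add: power2_diff power_divide)
  ultimately have "xs ! i ! 0 < 544 * (Q + 1)" using Q_nonneg by simp
  then show ?thesis using V_ge by simp
qed

lemma pad_neq:
  assumes "i < n"
  shows "(V + real j) # replicate (d - 1) 0 \<noteq> xs ! i"
  using coordinate_less_V[OF assms] by (cases "xs ! i") auto

lemma distinct_seed_points:
  assumes "distinct cs" "set cs \<subseteq> {..<n}"
  shows "distinct (seed_points cs j)"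
proof -
  have "inj_on ((!) xs) (set cs)" using xs(1) assms(2)
    by (auto simp: inj_on_def nth_eq_iff_index_eq n_def subset_iff)
  then show ?thesis using assms pad_neq
    by (auto simp: seed_points_def distinct_map inj_on_def subset_iff) metis+
qed

lemma set_seed_points:
  assumes "set cs \<subseteq> {..<n}"
  shows "set (seed_points cs j) \<subseteq> points d"
  using assms d length_nth by (auto simp: seed_points_def points_def subset_iff)

text \<open>\<open>A\<close> is specified for weights attached to points, but the program counts by
  seed number. The two agree because seeds are distinct and no padding point is a seed.\<close>

lemma seed_weight_nth:
  assumes cs: "distinct cs" "set cs \<subseteq> {..<n}" and j: "j < length cs + m"
  shows "seed_weight cs (seed_points cs m ! j) =
    (if j < length cs \<and> 32 * z < card {i. i < n \<and> nearest_seed \<delta> V cs i = j}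
     then real (card {i. i < n \<and> nearest_seed \<delta> V cs i = j}) else 0)"
proof (cases "cs = []")
  case True
  then show ?thesis by (simp add: seed_weight_def)
next
  case False
  have less: "nearest_seed \<delta> V cs i < length cs" if "i < n" for i
    using nearest_seed[OF False, of \<delta> i V] \<delta>_less_V that cs(2) by (auto simp: subset_iff)
  have rev_less: "rev cs ! l < n" if "l < length cs" for l
    using cs(2) that nth_mem[of l "rev cs"] by auto
  show ?thesis
  proof (cases "j < length cs")
    case True
    have "seed_of cs i = seed_points cs m ! j \<longleftrightarrow> nearest_seed \<delta> V cs i = j" if "i < n" for i
      using True less[OF that] rev_less cs(1) xs(1)
      by (simp add: seed_of_def seed_points_def nth_append nth_eq_iff_index_eq flip: n_def)
    then have "{i. i < n \<and> seed_of cs i = seed_points cs m ! j} = {i. i < n \<and> nearest_seed \<delta> V cs i = j}"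
      by auto
    then show ?thesis using True False by (simp add: seed_weight_def)
  next
    case nj: False
    have "seed_of cs i \<noteq> seed_points cs m ! j" if "i < n" for i
      using nj j pad_neq[OF rev_less[OF less[OF that]], of "j - length cs"]
      by (auto simp: seed_of_def seed_points_def nth_append)
    then have "{i. i < n \<and> seed_of cs i = seed_points cs m ! j} = {}" by auto
    then show ?thesis using nj by (simp add: seed_weight_def)
  qed
qed

lemma count_loop:
  assumes s: "base s" "narr s 1 = (\<lambda>_. 0)" "\<And>i. i < n \<Longrightarrow> narr s 0 i = a i"
  shows "det (For 6 1 count_body) s (n * 11 + 3) (\<lambda>s'. narr s' 1 = (\<lambda>j. card {i. i < n \<and> a i = j}))"
proof (rule det_For[where tb = 7 and J = "\<lambda>m s'. narr s' 1 = (\<lambda>j. card {i. i < m \<and> a i = j})"])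
  fix m s' assume m: "m < n" "narr s' 1 = (\<lambda>j. card {i. i < m \<and> a i = j})" "nreg s' 6 = m"
    and fr: "agree_off (insert (NR 6) (writes count_body)) s s'"
  have b: "base s'" using fr s(1) by (rule base_agree) (simp add: count_body_def)
  have a: "narr s' 0 m = a m" using fr s m by (simp add: agree_off_def count_body_def)
  have "{i. i < Suc m \<and> a i = j} = (if j = a m then insert m {i. i < m \<and> a i = j} else {i. i < m \<and> a i = j})" for j
    by (auto simp: less_Suc_eq)
  then have "(\<lambda>j. card {i. i < Suc m \<and> a i = j}) = (\<lambda>j. card {i. i < m \<and> a i = j})(a m := Suc (card {i. i < m \<and> a i = a m}))"
    by (auto simp: fun_eq_iff)
  then show "det count_body s' 7 (\<lambda>s''. narr (set_nreg 6 (Suc m) s'') 1 = (\<lambda>j. card {i. i < Suc m \<and> a i = j}))"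
    using m a b by (intro det_loop_free) (auto simp: count_body_def set_defs bind_return_pmf base_def)
qed (use s in \<open>auto simp: count_body_def set_defs base_def\<close>)

lemma weight_loop:
  assumes s: "base s" "narr s 1 = cnt" "rarr s 11 = (\<lambda>_. 0)" "nreg s 14 = m" "nreg s 18 = 32 * z"
  shows "det (For 6 14 weight_body) s (m * 10 + 3)
    (\<lambda>s'. rarr s' 11 = (\<lambda>j. if j < m \<and> 32 * z < cnt j then real (cnt j) else 0))"
proof (rule det_For[where tb = 6 and
      J = "\<lambda>l s'. rarr s' 11 = (\<lambda>j. if j < l \<and> 32 * z < cnt j then real (cnt j) else 0)"])
  fix l s' assume l: "l < m" "rarr s' 11 = (\<lambda>j. if j < l \<and> 32 * z < cnt j then real (cnt j) else 0)" "nreg s' 6 = l"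
    and fr: "agree_off (insert (NR 6) (writes weight_body)) s s'"
  have "narr s' 1 = cnt" "nreg s' 18 = 32 * z" using fr s by (auto simp: agree_off_def weight_body_def)
  then show "det weight_body s' 6 (\<lambda>s''. rarr (set_nreg 6 (Suc l) s'') 11 =
      (\<lambda>j. if j < Suc l \<and> 32 * z < cnt j then real (cnt j) else 0))"
    using l by (intro det_loop_free)
      (auto simp: weight_body_def set_defs bind_return_pmf fun_eq_iff less_Suc_eq split: if_splits)
qed (use s in \<open>auto simp: weight_body_def set_defs base_def\<close>)

lemma pad_loop:
  assumes s: "base s" "nreg s 14 = length cs" "nreg s 15 = length cs * d" "nreg s 16 = M" "rreg s 0 = V"
    "encodes d (seed_points cs 0) (rarr s 10)" "length cs \<le> M"
  shows "det (While (NLess 14 16) pad_body) s (M * 9 + 1)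
    (\<lambda>s'. encodes d (seed_points cs (M - length cs)) (rarr s' 10))"
proof -
  define J where "J j (a::unit) s' \<longleftrightarrow> base s' \<and> nreg s' 14 = length cs + j \<and> nreg s' 15 = (length cs + j) * d \<and>
    nreg s' 16 = M \<and> rreg s' 0 = V + real j \<and> encodes d (seed_points cs j) (rarr s' 10)" for j a s'
  have "exec (While (NLess 14 16) pad_body) s ((M - length cs) * (7 + 2) + 1)
    (itr (\<lambda>_. return_pmf) 0 (M - length cs) ()) (J (M - length cs))"
  proof (rule exec_While)
    fix j a s' assume J: "J j a s'"
    have "encodes d (seed_points cs (Suc j)) ((rarr s' 10)((length cs + j) * d := V + real j))"
      using encodes_append[of d "seed_points cs j" "rarr s' 10" "V + real j"] J d
      by (simp add: J_def seed_points_def)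
    then show "exec pad_body s' 7 (return_pmf a) (J (Suc j))"
      using J by (intro det_loop_free) (auto simp: J_def pad_body_def set_defs base_def bind_return_pmf)
  qed (use s in \<open>auto simp: J_def\<close>)
  then have "det (While (NLess 14 16) pad_body) s ((M - length cs) * (7 + 2) + 1)
    (\<lambda>s'. encodes d (seed_points cs (M - length cs)) (rarr s' 10))"
    unfolding itr_return by (rule exec_conseq) (simp add: J_def)
  then show ?thesis by (rule exec_mono) simp
qed

lemma finish_prog:
  assumes s: "base s" "seeded cs s" "length cs \<le> M" "narr s 1 = (\<lambda>_. 0)" "rarr s 11 = (\<lambda>_. 0)"
    "nreg s 18 = 32 * z" "nreg s 16 = M" "rreg s 0 = V"
  shows "det finish_prog s (n * 11 + M * 19 + 15) (\<lambda>s'.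
    encodes d (seed_points cs (M - length cs)) (rarr s' 10) \<and>
    rarr s' 11 = (\<lambda>i. if i < M then seed_weight cs (seed_points cs (M - length cs) ! i) else 0) \<and>
    nreg s' 100 = d \<and> nreg s' 101 = M \<and> nreg s' 102 = k)"
    (is "det _ _ _ ?Q")
proof -
  let ?c1 = "For 6 1 count_body" and ?c2 = "For 6 14 weight_body" and ?c3 = "While (NLess 14 16) pad_body"
  let ?cnt = "\<lambda>j. card {i. i < n \<and> nearest_seed \<delta> V cs i = j}"
  have "det ?c1 s (n * 11 + 3) (\<lambda>s'. narr s' 1 = ?cnt)"
    using s by (intro count_loop) (auto simp: seeded_def)
  note c1 = exec_frame[OF this]
  have "det finish_prog s ((n * 11 + 3) + ((length cs * 10 + 3) + ((M * 9 + 1) + 5 + 1) + 1) + 1) ?Q"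
    unfolding finish_prog_def
  proof (rule det_Seq[OF c1])
    fix s1 assume s1: "narr s1 1 = ?cnt \<and> agree_off (writes ?c1) s s1"
    have b1: "base s1" using s1 s(1) by (auto intro: base_agree simp: count_body_def)
    have "det ?c2 s1 (length cs * 10 + 3)
        (\<lambda>s'. rarr s' 11 = (\<lambda>j. if j < length cs \<and> 32 * z < ?cnt j then real (?cnt j) else 0))"
      using s s1 b1 by (intro weight_loop) (auto simp: agree_off_def count_body_def seeded_def)
    from exec_frame[OF this]
    show "det (Seq ?c2 (Seq ?c3 call_prog)) s1 ((length cs * 10 + 3) + ((M * 9 + 1) + 5 + 1) + 1) ?Q"
    proof (rule det_Seq)
      fix s2 assume s2: "rarr s2 11 = (\<lambda>j. if j < length cs \<and> 32 * z < ?cnt j then real (?cnt j) else 0) \<and>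
        agree_off (writes ?c2) s1 s2"
      have b2: "base s2" using s2 b1 by (auto intro: base_agree simp: weight_body_def)
      have same: "nreg s2 14 = nreg s 14" "nreg s2 15 = nreg s 15" "nreg s2 16 = nreg s 16" "rreg s2 0 = rreg s 0"
          "rarr s2 10 = rarr s 10"
        using s1 s2 by (auto simp: agree_off_def count_body_def weight_body_def)
      have "det ?c3 s2 (M * 9 + 1) (\<lambda>s'. encodes d (seed_points cs (M - length cs)) (rarr s' 10))"
        using s same b2 by (intro pad_loop) (auto simp: seeded_def encodes_def seed_points_def)
      from exec_frame[OF this] show "det (Seq ?c3 call_prog) s2 ((M * 9 + 1) + 5 + 1) ?Q"
      proof (rule det_Seq)
        fix s3 assume s3: "encodes d (seed_points cs (M - length cs)) (rarr s3 10) \<and> agree_off (writes ?c3) s2 s3"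
        have b3: "base s3" using s3 b2 by (auto intro: base_agree simp: pad_body_def)
        have "nreg s3 16 = M" "rarr s3 11 = rarr s2 11"
          using s3 same s by (auto simp: agree_off_def pad_body_def)
        moreover have "rarr s2 11 = (\<lambda>i. if i < M then seed_weight cs (seed_points cs (M - length cs) ! i) else 0)"
        proof
          fix i
          show "rarr s2 11 i = (if i < M then seed_weight cs (seed_points cs (M - length cs) ! i) else 0)"
            using s2 s seed_weight_nth[of cs i "M - length cs"] by (auto simp: seeded_def)
        qed
        ultimately show "det call_prog s3 5 ?Q"
          using s3 b3 by (intro det_loop_free) (auto simp: call_prog_def set_defs base_def bind_return_pmf)
      qed
    qed
  qed
  then show ?thesis by (rule exec_mono) (use s in simp)
qed

lemma R_le: "R \<le> M" "R \<le> 544 * k"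
  by (auto simp: R_def)

definition prep_time :: nat where
  "prep_time = 62000 * (k * d * n)"

text \<open>The guarantee for \<open>A\<close> is about runs from an \<open>input_state\<close>, so
  the renamed memory must equal such a state in every cell, zeros included.\<close>

lemma prep_prog:
  fixes w :: "point \<Rightarrow> real"
  defines "s0 \<equiv> input_state d k z xs w"
  shows "exec prep_prog s0 prep_time (itr (\<lambda>_. seed_round n z \<delta> V) 0 R []) (\<lambda>cs s'.
    distinct cs \<and> set cs \<subseteq> {..<n} \<and> length cs \<le> R \<and>
    shifted_view s' = input_state d k 0 (seed_points cs (M - length cs)) (seed_weight cs))"
    (is "exec _ _ _ ?\<mu> ?Q")
proof -
  let ?T1 = "n * (d * 11 + 7) + 15" and ?T2 = "k * 7 + M * 5 + 15" and ?T3 = "n * 5 + 3"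
  let ?T4 = "R * (n * (d * 17 + 51) + d * 11 + 34) + 3" and ?T5 = "n * 11 + M * 19 + 15"
  let ?c5 = "For 8 17 round_prog"
  define Q' where "Q' cs s' \<longleftrightarrow> distinct cs \<and> set cs \<subseteq> {..<n} \<and> length cs \<le> R \<and>
    encodes d (seed_points cs (M - length cs)) (rarr s' 10) \<and>
    rarr s' 11 = (\<lambda>i. if i < M then seed_weight cs (seed_points cs (M - length cs) ! i) else 0) \<and>
    nreg s' 100 = d \<and> nreg s' 101 = M \<and> nreg s' 102 = k" for cs and s' :: state
  have s0: "3 < r \<Longrightarrow> nreg s0 r = 0" "rreg s0 r = 0" "narr s0 r = (\<lambda>_. 0)" "1 < r \<Longrightarrow> rarr s0 r = (\<lambda>_. 0)" for r
    by (auto simp: s0_def input_state_def)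
  have "exec prep_prog s0 (19 + (?T1 + (?T2 + (?T3 + (?T4 + ?T5 + 1) + 1) + 1) + 1) + 1) ?\<mu> Q'"
    unfolding prep_prog_def
  proof (rule det_Seq[OF exec_frame])
    show "det init_prog s0 19 (\<lambda>s'. base s' \<and> nreg s' 18 = 32 * z \<and> rreg s' 2 = 1 / real (8 * z + 1))"
      unfolding s0_def by (rule init_prog)
    fix s1 assume s1: "(base s1 \<and> nreg s1 18 = 32 * z \<and> rreg s1 2 = 1 / real (8 * z + 1)) \<and> agree_off (writes init_prog) s0 s1"
    show "exec (Seq cap_prog (Seq size_prog (Seq cap_loop_prog (Seq ?c5 finish_prog)))) s1
        (?T1 + (?T2 + (?T3 + (?T4 + ?T5 + 1) + 1) + 1) + 1) ?\<mu> Q'"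
    proof (rule det_Seq[OF exec_frame])
      show "det cap_prog s1 ?T1 (\<lambda>s'. rreg s' 0 = V \<and> rreg s' 8 = real n \<and> nreg s' 21 = 544)"
        using s1 s0 by (intro cap_prog) (auto simp: agree_off_def init_prog_def)
      fix s2 assume s2: "(rreg s2 0 = V \<and> rreg s2 8 = real n \<and> nreg s2 21 = 544) \<and> agree_off (writes cap_prog) s1 s2"
      have b2: "base s2" using s2 s1 by (auto intro: base_agree simp: prog_defs)
      show "exec (Seq size_prog (Seq cap_loop_prog (Seq ?c5 finish_prog))) s2
          (?T2 + (?T3 + (?T4 + ?T5 + 1) + 1) + 1) ?\<mu> Q'"
      proof (rule det_Seq[OF exec_frame])
        show "det size_prog s2 ?T2 (\<lambda>s'. nreg s' 16 = M \<and> nreg s' 17 = R)"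
          using s2 b2 s1 s0 by (intro size_prog) (auto simp: agree_off_def prog_defs)
        fix s3 assume s3: "(nreg s3 16 = M \<and> nreg s3 17 = R) \<and> agree_off (writes size_prog) s2 s3"
        have b3: "base s3" using s3 b2 by (auto intro: base_agree simp: prog_defs)
        have r3: "rreg s3 0 = V" using s3 s2 by (auto simp: agree_off_def prog_defs)
        show "exec (Seq cap_loop_prog (Seq ?c5 finish_prog)) s3 (?T3 + (?T4 + ?T5 + 1) + 1) ?\<mu> Q'"
        proof (rule det_Seq[OF exec_frame])
          show "det cap_loop_prog s3 ?T3 (\<lambda>s'. \<forall>i<n. rarr s' 3 i = V)" using b3 r3 by (rule cap_loop_prog)
          fix s4 assume s4: "(\<forall>i<n. rarr s4 3 i = V) \<and> agree_off (writes cap_loop_prog) s3 s4"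
          have b4: "base s4" using s4 b3 by (auto intro: base_agree simp: cap_loop_prog_def)
          have agree4: "agree_off (writes init_prog \<union> writes cap_prog \<union> writes size_prog \<union> writes cap_loop_prog) s0 s4"
            using s1 s2 s3 s4 by (auto simp: agree_off_def)
          have z4: "nreg s4 14 = 0" "nreg s4 15 = 0" "narr s4 0 = (\<lambda>_. 0)" "rarr s4 10 = (\<lambda>_. 0)"
              "narr s4 1 = (\<lambda>_. 0)" "rarr s4 11 = (\<lambda>_. 0)"
            using agree4 s0 by (auto simp: agree_off_def prog_defs cap_loop_prog_def)
          have r4: "rreg s4 2 = 1 / real (8 * z + 1)" "nreg s4 18 = 32 * z" "rreg s4 0 = V" "nreg s4 16 = M" "nreg s4 17 = R"
            using s1 s2 s3 s4 by (auto simp: agree_off_def prog_defs cap_loop_prog_def)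
          have "seeded [] s4" using s4 z4 by (auto simp: seeded_def)
          with b4 r4 have "exec ?c5 s4 ?T4 ?\<mu> (\<lambda>cs s'. seeded cs s' \<and> length cs \<le> R)"
            by (intro seeding_loop)
          from exec_frame[OF this]
          have "exec (Seq ?c5 finish_prog) s4 (?T4 + ?T5 + 1) (bind_pmf ?\<mu> return_pmf) Q'"
          proof (rule exec_Seq)
            fix cs s5 assume s5: "(seeded cs s5 \<and> length cs \<le> R) \<and> agree_off (writes ?c5) s4 s5"
            have b5: "base s5" using s5 b4 by (auto intro: base_agree simp: round_defs)
            have "det finish_prog s5 ?T5 (\<lambda>s'.
              encodes d (seed_points cs (M - length cs)) (rarr s' 10) \<and>
              rarr s' 11 = (\<lambda>i. if i < M then seed_weight cs (seed_points cs (M - length cs) ! i) else 0) \<and>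
              nreg s' 100 = d \<and> nreg s' 101 = M \<and> nreg s' 102 = k)"
              using s5 b5 r4 z4 R_le by (intro finish_prog) (auto simp: agree_off_def round_defs)
            then show "exec finish_prog s5 ?T5 (return_pmf cs) Q'"
              unfolding exec_return_pmf[of _ _ _ cs] by (rule exec_conseq) (use s5 in \<open>auto simp: Q'_def seeded_def\<close>)
          qed
          then show "exec (Seq ?c5 finish_prog) s4 (?T4 + ?T5 + 1) ?\<mu> Q'" by (simp add: bind_return_pmf')
        qed
      qed
    qed
  qed
  moreover have "19 + (?T1 + (?T2 + (?T3 + (?T4 + ?T5 + 1) + 1) + 1) + 1) + 1 \<le> prep_time"
  proof -
    define K where "K = k * d * n"
    have k1: "1 \<le> k" and d1: "1 \<le> d" and n1: "1 \<le> n" using k d n_pos by auto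
    have kn: "k * n \<le> K" and nd: "n * d \<le> K" and "k \<le> K" "n \<le> K" "1 \<le> K"
      using k1 d1 n1 by (simp_all add: K_def mult.commute mult.left_commute)
    have M: "M \<le> K" using M_le kn by simp
    \<comment> \<open>Each factor is padded to a multiple of \<open>n * d\<close>; 61472 = 544 * (68
      + 11 + 34) dominates the running time.\<close>
    have "R * (n * (d * 17 + 51) + d * 11 + 34) \<le> (544 * k) * (n * (d * 68) + (n * d) * 11 + (n * d) * 34)"
      using R_le(2) d1 n1 by (intro mult_le_mono add_mono) auto
    also have "\<dots> = 61472 * K" by (simp add: K_def algebra_simps)
    finally have "R * (n * (d * 17 + 51) + d * 11 + 34) \<le> 61472 * K" .
    moreover have "n * (d * 11 + 7) \<le> 18 * K" using nd \<open>n \<le> K\<close> by (simp add: algebra_simps)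
    ultimately show ?thesis using M \<open>k \<le> K\<close> \<open>n \<le> K\<close> \<open>1 \<le> K\<close>
      unfolding prep_time_def K_def[symmetric] by linarith
  qed
  ultimately have "exec prep_prog s0 prep_time ?\<mu> Q'" by (rule exec_mono)
  from exec_frame[OF this] show ?thesis
  proof (rule exec_conseq)
    fix cs s' assume *: "Q' cs s' \<and> agree_off (writes prep_prog) s0 s'"
    let ?ps = "seed_points cs (M - length cs)"
    have len: "length ?ps = M" using * R_le(1) by (auto simp: Q'_def seed_points_def)
    \<comment> \<open>Registers 100 to 102 hold the arguments and real arrays 10 and 11 the
      instance. Array 2 appears separately because the renaming fixes it. Register 103, the
      parameter \<open>z\<close> of \<open>A\<close>, stays 0.\<close>
    have "NR (r + 103) \<notin> writes prep_prog" "RR (r + 100) \<notin> writes prep_prog"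
      "NA (r + 10) \<notin> writes prep_prog" "RA (r + 12) \<notin> writes prep_prog" "RA 2 \<notin> writes prep_prog" for r
      by (simp_all add: prep_prog_def prog_defs cap_loop_prog_def round_defs finish_defs)
    then have "nreg s' (r + 103) = 0" "rreg s' (r + 100) = 0" "narr s' (r + 10) = (\<lambda>_. 0)"
      "rarr s' (r + 12) = (\<lambda>_. 0)" "rarr s' 2 = (\<lambda>_. 0)" for r
      using * s0 by (simp_all add: agree_off_def)
    note zero = this
    have "shifted_view s' = input_state d k 0 ?ps (seed_weight cs)"
    proof -
      have "nreg s' (shift_reg r) = nreg (input_state d k 0 ?ps (seed_weight cs)) r" for r
      proof -
        show ?thesis
        proof (cases r rule: nat_cases_3)
          case (4 r')
          then show ?thesis using zero(1)[of r'] by (auto simp: shift_reg_def input_state_def add.assoc)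
        qed (use * len in \<open>auto simp: Q'_def shift_reg_def input_state_def\<close>)
      qed
      moreover have "rarr s' (shift_rarr a) = rarr (input_state d k 0 ?ps (seed_weight cs)) a" for a
      proof -
        have enc: "rarr s' 10 = (\<lambda>i. if i < length ?ps * d then ?ps ! (i div d) ! (i mod d) else 0)"
          using * d by (intro encodes_eq) (auto simp: Q'_def)
        show ?thesis
        proof (cases a rule: nat_cases_3)
          case 1
          then show ?thesis using enc by (simp add: shift_rarr_def input_state_def)
        next
          case (4 a')
          then show ?thesis using zero(4)[of "a' + 1"] by (simp add: shift_rarr_def input_state_def add.commute)
        qed (use * len zero in \<open>auto simp: Q'_def shift_rarr_def input_state_def\<close>)
      qed
      ultimately show ?thesis using zero
        by (auto simp: view_def input_state_def shift_reg_def shift_narr_def fun_eq_iff)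
    qed
    then show "?Q cs s'" using * by (simp add: Q'_def)
  qed
qed

end

section \<open>Correctness\<close>

lemma kcost_antimono:
  assumes "finite X" "finite C" "C \<noteq> {}" "t \<le> t'"
  shows "kcost X t' C \<le> kcost X t C"
proof -
  have "card (X - nearest X t C) = card X - card (nearest X t C)"
    using nearest_props(1)[OF assms(1)] assms(1) by (intro card_Diff_subset) (auto intro: finite_subset)
  then have "card (X - nearest X t C) \<le> t'"
    using nearest_props(2)[OF assms(1), of t C] assms(4) by simp
  then have "kcost X t' C \<le> (\<Sum>x\<in>nearest X t C. (sdist x C)\<^sup>2)"
    using assms nearest_props(1)[OF assms(1)] by (intro kcost_le) auto
  then show ?thesis by (simp add: kcost_def)
qed

text \<open>All runs halt within \<open>t\<close> steps, so only the first \<open>t\<close> charges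
  can be nonzero and each is at most 1.\<close>

lemma expected_time_le:
  assumes "halts c s t"
  shows "expected_time c s \<le> of_nat t"
proof -
  have zero: "emeasure (measure_pmf (run u c s)) {(c', s'). c' \<noteq> Skip} = 0" if "t \<le> u" for u
    using assms run_after_halt_le[OF assms that]
    by (subst measure_pmf.emeasure_eq_measure) (auto simp: measure_pmf_zero_iff halts_def)
  have "expected_time c s = (\<Sum>u<t. emeasure (measure_pmf (run u c s)) {(c', s'). c' \<noteq> Skip})"
    unfolding expected_time_def using zero by (intro suminf_finite) (auto simp: not_less)
  also have "\<dots> \<le> (\<Sum>u<t. 1)" by (intro sum_mono measure_pmf.emeasure_le_1)
  finally show ?thesis by simp
qed

text \<open>A coupling sends the event \<open>G\<close> into the states related to it, so the
  probability cannot decrease; the runs counted have all halted by time \<open>t\<close>.\<close>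

lemma result_prob_ge:
  assumes exec: "exec c s t \<mu> S" and "\<And>a s'. a \<in> G \<Longrightarrow> S a s' \<Longrightarrow> Q s'"
  shows "measure_pmf.prob \<mu> G \<le> result_prob c s Q"
proof -
  have "measure_pmf.prob \<mu> G \<le> measure_pmf.prob (map_pmf snd (run t c s)) {s'. \<exists>a\<in>G. S a s'}"
    using exec by (intro rel_pmf_measureD) (simp add: exec_def)
  also have "\<dots> = measure_pmf.prob (run t c s) (snd -` {s'. \<exists>a\<in>G. S a s'})" by simp
  also have "\<dots> \<le> measure_pmf.prob (run t c s) {(c', s'). c' = Skip \<and> Q s'}"
    using exec assms(2)
    by (intro measure_pmf.finite_measure_mono_AE) (auto simp: AE_measure_pmf_iff exec_def halts_def)
  also have "\<dots> \<le> result_prob c s Q"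
    unfolding result_prob_def by (intro cSUP_upper) (auto intro!: bdd_aboveI[of _ 1])
  finally show ?thesis .
qed

context kmeans_input
begin

lemma clustering_axioms:
  assumes "I \<subseteq> {..<n}" "card ({..<n} - I) \<le> z" "g \<in> I \<rightarrow> {..<n}"
  shows "clustering n z \<delta> V I g"
proof
  show "\<delta> i j = \<delta> j i" if "i < n" "j < n" for i j
    using that length_nth by (simp add: \<delta>_def pdist_commute)
  show "\<delta> i l \<le> \<delta> i j + \<delta> j l" if "i < n" "j < n" "l < n" for i j l
    using that length_nth unfolding \<delta>_def by (intro pdist_triangle) auto
qed (use assms V_nonneg in \<open>auto simp: \<delta>_def\<close>)

lemma centers_cost:
  assumes I: "I \<subseteq> {..<n}" "g \<in> I \<rightarrow> {..<n}" "card ({..<n} - I) \<le> z" "card (g ` I) \<le> k"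
    and cs: "distinct cs" "set cs \<subseteq> {..<n}" "length cs \<le> R"
    and cov: "clustering.covered n z \<delta> V I g cs"
    and C: "C \<in> center_sets d k"
      "wcost (seed_weight cs) (set (seed_points cs m)) C
         \<le> \<alpha> * wOpt d (seed_weight cs) (set (seed_points cs m)) k"
  shows "kcost (set xs) (17420 * k * z) C \<le> (272 + 1096 * max \<alpha> 0) * (\<Sum>i\<in>I. (\<delta> i (g i))\<^sup>2)"
proof -
  interpret cl: clustering n z \<delta> V I g using I by (intro clustering_axioms)
  note CD = center_setsD[OF C(1) k]
  let ?\<Gamma> = "\<Sum>i\<in>I. (\<delta> i (g i))\<^sup>2"
  have \<Gamma>: "cl.total_cost = ?\<Gamma>" by (simp add: cl.total_cost_def)
  obtain E where E: "E \<subseteq> {..<n}" "card E \<le> 12 * z" "(\<Sum>i\<in>{..<n} - E. D cs i) \<le> 136 * ?\<Gamma>"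
    using cov unfolding cl.covered_def \<Gamma> by blast
  \<comment> \<open>17420 = 12 + 544 * 32; \<open>k \<ge> 1\<close> lets \<open>12 * k * z\<close>
    absorb \<open>12 * z\<close>.\<close>
  have "12 * z + (544 * k) * (32 * z) \<le> 12 * (k * z) + (544 * k) * (32 * z)" using k by simp
  then have t: "12 * z + (544 * k) * (32 * z) \<le> 17420 * k * z" by simp
  show ?thesis
  proof (cases "cs = []")
    case True
    \<comment> \<open>Without seeds every point is charged \<open>V\<close>, more than the whole
      allowance, so a covering must discard all points. Then \<open>n \<le> 12 z\<close> and the
      cost is 0.\<close>
    have "n * (4 * Q) * 136 < V"
      using n_pos Q_nonneg by (simp add: V_def algebra_simps)
    moreover have "?\<Gamma> \<le> real n * (4 * Q)"
    proof -
      have "?\<Gamma> \<le> (\<Sum>i\<in>I. 4 * Q)" using I by (intro sum_mono \<delta>_power2_le) (auto simp: Pi_def)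
      also have "\<dots> \<le> (\<Sum>i<n. 4 * Q)" using I Q_nonneg by (intro sum_mono2) auto
      finally show ?thesis by simp
    qed
    ultimately have V: "136 * ?\<Gamma> < V" by linarith
    have "{..<n} - E = {}"
    proof (rule ccontr)
      assume "{..<n} - E \<noteq> {}"
      then have "V * 1 \<le> V * real (card ({..<n} - E))"
        using V_nonneg by (intro mult_left_mono) (auto simp: Suc_le_eq card_gt_0_iff)
      then show False using E(3) V True by (simp add: mult.commute)
    qed
    then have "card {..<n} \<le> card E" using E(1) finite_subset[of E "{..<n}"] by (intro card_mono) auto
    then have "card (set xs) \<le> 12 * z" using E(2) card_length[of xs] unfolding n_def by simp
    also have "\<dots> \<le> 12 * z + (544 * k) * (32 * z)" by (rule le_add1)
    also note t
    finally have "card (set xs) \<le> 17420 * k * z" .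
    then have "kcost (set xs) (17420 * k * z) C \<le> (\<Sum>x\<in>{}. (sdist x C)\<^sup>2)"
      using CD by (intro kcost_le) auto
    then show ?thesis by (simp add: order_trans[OF _ mult_nonneg_nonneg] sum_nonneg)
  next
    case False
    have ns: "nearest_seed \<delta> V cs i < length cs" "(\<delta> i (rev cs ! nearest_seed \<delta> V cs i))\<^sup>2 = D cs i" if "i < n" for i
      using nearest_seed[OF False, of \<delta> i V] \<delta>_less_V that cs(2) by (auto simp: subset_iff)
    have "kcost (set xs) (17420 * k * z) C \<le> kcost (set xs) (12 * z + (544 * k) * (32 * z)) C"
      using CD t by (intro kcost_antimono) auto
    also have "\<dots> \<le> (272 + 1096 * max \<alpha> 0) * ?\<Gamma>"
    proof (rule weighted_seeds_cost[where xs = xs and I = I and g = g and E = E and s = "seed_of cs" and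
          S = "(!) xs ` set cs" and P = "set (seed_points cs m)" and w = "seed_weight cs", folded n_def])
      have "(\<Sum>i\<in>{..<n} - E. (pdist (xs ! i) (seed_of cs i))\<^sup>2) = (\<Sum>i\<in>{..<n} - E. D cs i)"
        using ns(2) by (intro sum.cong) (auto simp: seed_of_def \<delta>_def)
      then show "(\<Sum>i\<in>{..<n} - E. (pdist (xs ! i) (seed_of cs i))\<^sup>2) \<le> 136 * ?\<Gamma>" using E(3) by simp
      show "seed_of cs ` {..<n} \<subseteq> (!) xs ` set cs"
        using ns(1) nth_mem[of _ "rev cs"] by (auto simp: seed_of_def)
      have "card ((!) xs ` set cs) \<le> length cs" by (meson card_image_le card_length finite_set le_trans)
      then show "card ((!) xs ` set cs) \<le> 544 * k" using cs(3) R_le(2) by simp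
      show "seed_weight cs p = (if 32 * z < card {i. i < n \<and> seed_of cs i = p}
          then real (card {i. i < n \<and> seed_of cs i = p}) else 0)" for p
        using False by (simp add: seed_weight_def)
      show "set (seed_points cs m) \<subseteq> points d" using cs(2) by (rule set_seed_points)
    qed (use I E C k d xs in \<open>auto simp: seed_points_def \<delta>_def\<close>)
    finally show ?thesis .
  qed
qed

text \<open>If \<open>544 k\<close> rounds do not fit, then
  \<open>n ^ k \<le> 2 ^ M < 2 ^ (544 k)\<close> bounds \<open>n\<close>, and with it the number of
  clusters.\<close>

lemma prob_covered:
  assumes I: "I \<subseteq> {..<n}" "g \<in> I \<rightarrow> {..<n}" "card ({..<n} - I) \<le> z" "card (g ` I) \<le> k"
  shows "min (1 / 2) ((3 / 272) ^ 2 ^ 544)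
    \<le> measure_pmf.prob (itr (\<lambda>_. seed_round n z \<delta> V) 0 R []) {cs. clustering.covered n z \<delta> V I g cs}"
proof -
  interpret cl: clustering n z \<delta> V I g using I by (intro clustering_axioms)
  define N :: nat where "N = 2 ^ 544"
  let ?p = "measure_pmf.prob (itr (\<lambda>_. seed_round n z \<delta> V) 0 R []) {cs. cl.covered cs}"
  have "min (1 / 2) ((3 / 272) ^ N) \<le> ?p"
  proof (cases "544 * k \<le> M")
    case True
    then have "544 * card (g ` I) \<le> R" using I by (simp add: R_def)
    then have "1 / 2 \<le> ?p" by (rule cl.prob_seeding_long)
    then show ?thesis by simp
  next
    case False
    have "real n ^ k \<le> 2 ^ M" using M_char[of M] by simp
    also have "\<dots> < 2 ^ (544 * k)" using False by (intro power_strict_increasing) auto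
    also have "\<dots> = real N ^ k" by (simp add: N_def power_mult)
    finally have "n < N" using power_less_imp_less_base[of "real n" k "real N"] by simp
    have gn: "card (g ` I) \<le> n" using I(2) card_mono[of "{..<n}" "g ` I"] by (auto simp: Pi_def)
    have "card (g ` I) \<le> R" using I(4) k_le_M by (simp add: R_def)
    then have "(3 / 272) ^ card (g ` I) \<le> ?p" by (rule cl.prob_seeding_short)
    moreover have "(3 / 272 :: real) ^ N \<le> (3 / 272) ^ card (g ` I)"
      using gn \<open>n < N\<close> by (intro power_decreasing) auto
    ultimately show ?thesis by linarith
  qed
  then show ?thesis by (simp only: N_def)
qed

lemma algorithm_spec:
  fixes \<alpha> :: real
  assumes A: "kmeans_approx_alg \<alpha> T A"
  defines "B \<equiv> Seq prep_prog (shifted A)" and "s0 \<equiv> input_state d k z xs (\<lambda>_. 1)"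
  shows "min (1 / 2) ((3 / 272) ^ 2 ^ 544) \<le> result_prob B s0
      (\<lambda>s. output_centers d k s \<in> center_sets d k \<and>
        kcost (set xs) (17420 * k * z) (output_centers d k s)
          \<le> (4 * (272 + 1096 * max \<alpha> 0)) * Opt d (set xs) k z)"
    and "expected_time B s0 \<le> ennreal (62001 * real k * real d * real n * (log 2 (real n))\<^sup>2 + T d k M)"
proof -
  obtain I g where I: "I \<subseteq> {..<n}" "g \<in> I \<rightarrow> {..<n}" "card ({..<n} - I) \<le> z" "card (g ` I) \<le> k"
    and \<Gamma>: "(\<Sum>i\<in>I. (\<delta> i (g i))\<^sup>2) \<le> 4 * Opt d (set xs) k z"
    using ex_discrete_clustering[OF xs k d, of z] unfolding \<delta>_def n_def by blast
  let ?\<mu> = "itr (\<lambda>_. seed_round n z \<delta> V) 0 R []"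
  let ?G = "{cs. clustering.covered n z \<delta> V I g cs}"
  let ?Q = "\<lambda>s. output_centers d k s \<in> center_sets d k \<and>
        kcost (set xs) (17420 * k * z) (output_centers d k s)
          \<le> (4 * (272 + 1096 * max \<alpha> 0)) * Opt d (set xs) k z"
  \<comment> \<open>\<open>T\<close> is real-valued; every step count below it is at most its floor,
    which gives a bound common to all seed lists.\<close>
  define tA where "tA = nat \<lfloor>T d k M\<rfloor>"
  have call: "T d k M \<ge> 0 \<and> det (shifted A) s' tA (\<lambda>s''. cs \<in> ?G \<longrightarrow> ?Q s'')"
    if cs: "distinct cs" "set cs \<subseteq> {..<n}" "length cs \<le> R"
      and view: "shifted_view s' = input_state d k 0 (seed_points cs (M - length cs)) (seed_weight cs)" for cs s'
  proof -
    let ?ps = "seed_points cs (M - length cs)"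
    have len: "length ?ps = M" using cs(3) R_le(1) by (simp add: seed_points_def)
    have "distinct ?ps" "set ?ps \<subseteq> points d" "\<forall>x\<in>set ?ps. 0 \<le> seed_weight cs x"
      using distinct_seed_points[OF cs(1,2)] set_seed_points[OF cs(2)] by (auto simp: seed_weight_def)
    then have "\<exists>t. real t \<le> T d k (length ?ps) \<and>
        (\<forall>(c, s)\<in>set_pmf (run t A (input_state d k 0 ?ps (seed_weight cs))). c = Skip \<and>
          output_centers d k s \<in> center_sets d k \<and>
          wcost (seed_weight cs) (set ?ps) (output_centers d k s) \<le> \<alpha> * wOpt d (seed_weight cs) (set ?ps) k)"
      using A d k unfolding kmeans_approx_alg_def by blast
    then obtain t where t: "real t \<le> T d k M"
      "\<forall>(c, s)\<in>set_pmf (run t A (input_state d k 0 ?ps (seed_weight cs))). c = Skip \<and>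
          output_centers d k s \<in> center_sets d k \<and>
          wcost (seed_weight cs) (set ?ps) (output_centers d k s) \<le> \<alpha> * wOpt d (seed_weight cs) (set ?ps) k"
      unfolding len by blast
    have "det (shifted A) s' t (\<lambda>s''. (\<lambda>s. output_centers d k s \<in> center_sets d k \<and>
        wcost (seed_weight cs) (set ?ps) (output_centers d k s) \<le> \<alpha> * wOpt d (seed_weight cs) (set ?ps) k)
          (shifted_view s''))"
      by (rule det_rename) (use t(2) inj_shift view in auto)
    then have "det (shifted A) s' t (\<lambda>s''. cs \<in> ?G \<longrightarrow> ?Q s'')"
    proof (rule exec_conseq)
      fix s'' assume *: "output_centers d k (shifted_view s'') \<in> center_sets d k \<and>
        wcost (seed_weight cs) (set ?ps) (output_centers d k (shifted_view s''))
          \<le> \<alpha> * wOpt d (seed_weight cs) (set ?ps) k"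
      \<comment> \<open>The renaming fixes array 2, so \<open>A\<close> has written its centers
        where the output is read.\<close>
      have out: "output_centers d k (shifted_view s'') = output_centers d k s''"
        by (simp add: output_centers_def view_def shift_rarr_def)
      show "cs \<in> ?G \<longrightarrow> ?Q s''"
      proof
        assume "cs \<in> ?G"
        then have "kcost (set xs) (17420 * k * z) (output_centers d k s'')
            \<le> (272 + 1096 * max \<alpha> 0) * (\<Sum>i\<in>I. (\<delta> i (g i))\<^sup>2)"
          using I cs * unfolding out by (intro centers_cost) auto
        also have "\<dots> \<le> (272 + 1096 * max \<alpha> 0) * (4 * Opt d (set xs) k z)"
          using \<Gamma> by (intro mult_left_mono) auto
        also have "\<dots> = (4 * (272 + 1096 * max \<alpha> 0)) * Opt d (set xs) k z" by (simp only: mult.assoc mult.left_commute)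
        finally show "?Q s''" using * unfolding out by blast
      qed
    qed
    moreover have "t \<le> tA" using t(1) unfolding tA_def by (simp add: le_nat_floor)
    ultimately show ?thesis using t(1) exec_mono of_nat_0_le_iff order_trans by blast
  qed
  have prep: "exec prep_prog s0 prep_time ?\<mu> (\<lambda>cs s'.
    distinct cs \<and> set cs \<subseteq> {..<n} \<and> length cs \<le> R \<and>
    shifted_view s' = input_state d k 0 (seed_points cs (M - length cs)) (seed_weight cs))"
    unfolding s0_def by (rule prep_prog)
  then have "exec B s0 (prep_time + tA + 1) (bind_pmf ?\<mu> return_pmf) (\<lambda>cs s''. cs \<in> ?G \<longrightarrow> ?Q s'')"
    unfolding B_def
  proof (rule exec_Seq)
    fix cs s' assume "distinct cs \<and> set cs \<subseteq> {..<n} \<and> length cs \<le> R \<and>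
      shifted_view s' = input_state d k 0 (seed_points cs (M - length cs)) (seed_weight cs)"
    then show "exec (shifted A) s' tA (return_pmf cs) (\<lambda>cs s''. cs \<in> ?G \<longrightarrow> ?Q s'')"
      unfolding exec_return_pmf[of _ _ _ cs] using call by blast
  qed
  then have B: "exec B s0 (prep_time + tA + 1) ?\<mu> (\<lambda>cs s''. cs \<in> ?G \<longrightarrow> ?Q s'')"
    by (simp add: bind_return_pmf')
  have "min (1 / 2) ((3 / 272) ^ 2 ^ 544) \<le> measure_pmf.prob ?\<mu> ?G" using I by (rule prob_covered)
  also have "\<dots> \<le> result_prob B s0 ?Q" using B by (rule result_prob_ge) auto
  finally show "min (1 / 2) ((3 / 272) ^ 2 ^ 544) \<le> result_prob B s0 ?Q" .
  \<comment> \<open>A negative \<open>T\<close> would cut into the time allowed for the preparation.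
    Any reachable seed list yields a call of \<open>A\<close>, whose step count is a nonnegative
    lower bound for \<open>T\<close>.\<close>
  have T0: "0 \<le> T d k M"
  proof -
    obtain cs where cs: "cs \<in> set_pmf ?\<mu>" using set_pmf_not_empty by fast
    have "rel_set (\<lambda>cs s'. distinct cs \<and> set cs \<subseteq> {..<n} \<and> length cs \<le> R \<and>
      shifted_view s' = input_state d k 0 (seed_points cs (M - length cs)) (seed_weight cs))
      (set_pmf ?\<mu>) (set_pmf (map_pmf snd (run prep_time prep_prog s0)))"
      using prep unfolding exec_def by (intro rel_pmf_imp_rel_set) (rule conjunct2)
    from rel_setD1[OF this cs] obtain s' where "distinct cs \<and> set cs \<subseteq> {..<n} \<and> length cs \<le> R \<and>
      shifted_view s' = input_state d k 0 (seed_points cs (M - length cs)) (seed_weight cs)"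
      by blast
    then show ?thesis using call by blast
  qed
  have "expected_time B s0 \<le> of_nat (prep_time + tA + 1)"
    using B by (intro expected_time_le) (rule exec_halts)
  also have "\<dots> = ennreal (real (prep_time + tA + 1))" by (simp add: ennreal_of_nat_eq_real_of_nat)
  also have "\<dots> \<le> ennreal (62001 * real k * real d * real n * (log 2 (real n))\<^sup>2 + T d k M)"
  proof (rule ennreal_leI)
    \<comment> \<open>The preparation takes only \<open>O(k d n)\<close> steps; since
      \<open>n \<ge> 2\<close>, the squared logarithm is at least 1.\<close>
    have "1 \<le> log 2 (real n)" using n2 by (subst le_log_iff) (auto simp: n_def)
    then have "(1::real) ^ 2 \<le> (log 2 (real n))\<^sup>2" by (intro power_mono) auto
    then have "62001 * real (k * d * n) * 1 \<le> 62001 * real (k * d * n) * (log 2 (real n))\<^sup>2"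
      by (intro mult_left_mono) auto
    moreover have "1 \<le> k * d * n" using k d n_pos by (simp add: Suc_le_eq)
    then have "real prep_time + 1 \<le> 62001 * real (k * d * n)" unfolding prep_time_def by linarith
    moreover have "real tA \<le> T d k M" using T0 by (simp add: tA_def)
    ultimately show "real (prep_time + tA + 1) \<le> 62001 * real k * real d * real n * (log 2 (real n))\<^sup>2 + T d k M"
      by (simp add: mult.assoc)
  qed
  finally show "expected_time B s0 \<le> ennreal (62001 * real k * real d * real n * (log 2 (real n))\<^sup>2 + T d k M)" .
qed

end

theorem theorem5:
  fixes \<alpha> :: real
  shows "\<exists>(\<beta>::real) (\<gamma>::nat) (\<kappa>::real) (p::real). p > 0 \<and>
    (\<forall>(A::com) (T :: nat \<Rightarrow> nat \<Rightarrow> nat \<Rightarrow> real). kmeans_approx_alg \<alpha> T A \<longrightarrow>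
      (\<exists>B::com. \<forall>(d::nat) (k::nat) (z::nat) (n::nat) (xs::point list).
         d \<ge> 1 \<longrightarrow> k \<ge> 1 \<longrightarrow> n \<ge> 2 \<longrightarrow> length xs = n \<longrightarrow> distinct xs \<longrightarrow> set xs \<subseteq> points d \<longrightarrow>
         result_prob B (input_state d k z xs (\<lambda>_. 1))
           (\<lambda>s. output_centers d k s \<in> center_sets d k \<and>
                kcost (set xs) (\<gamma> * k * z) (output_centers d k s) \<le> \<beta> * Opt d (set xs) k z) \<ge> p \<and>
         expected_time B (input_state d k z xs (\<lambda>_. 1))
           \<le> ennreal (\<kappa> * real k * real d * real n * (log 2 (real n))\<^sup>2
                       + T d k (nat \<lceil>real k * log 2 (real n)\<rceil>))))"
proof -
  have pos: "0 < min (1 / 2) ((3 / 272 :: real) ^ m)" for m :: nat by simp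
  \<comment> \<open>The outer 4 in the first witness is the price of centers among the input points;
    the bracket comes from 2 * 136 and 2 * 548 in \<open>weighted_seeds_cost\<close>. Only this
    witness depends on \<open>\<alpha>\<close>.\<close>
  show ?thesis
  proof (rule exI[of _ "4 * (272 + 1096 * max \<alpha> 0)"], rule exI[of _ 17420], rule exI[of _ 62001],
      rule exI[of _ "min (1 / 2) ((3 / 272) ^ 2 ^ 544)"], rule conjI, rule pos,
      intro allI impI, rule exI, intro allI impI)
    fix A T and d k z n :: nat and xs :: "point list"
    assume A: "kmeans_approx_alg \<alpha> T A"
      and asms: "1 \<le> d" "1 \<le> k" "2 \<le> n" "length xs = n" "distinct xs" "set xs \<subseteq> points d"
    interpret kmeans_input d k z xs using asms by unfold_locales auto
    have n: "kmeans_input.n xs = n" using asms(4) by (simp add: n_def)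
    show "min (1 / 2) ((3 / 272) ^ 2 ^ 544) \<le> result_prob (Seq prep_prog (shifted A)) (input_state d k z xs (\<lambda>_. 1))
        (\<lambda>s. output_centers d k s \<in> center_sets d k \<and>
          kcost (set xs) (17420 * k * z) (output_centers d k s)
            \<le> 4 * (272 + 1096 * max \<alpha> 0) * Opt d (set xs) k z) \<and>
      expected_time (Seq prep_prog (shifted A)) (input_state d k z xs (\<lambda>_. 1))
        \<le> ennreal (62001 * real k * real d * real n * (log 2 (real n))\<^sup>2
             + T d k (nat \<lceil>real k * log 2 (real n)\<rceil>))"
      using algorithm_spec[OF A] unfolding M_def n by blast
  qed
qed

end
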